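(* Let $\Sigma$ be a closed connected oriented surface of genus $g\geqslant 0$ and $\Gamma=\pi_1(\Sigma)$. For all integers $n_1,\ldots,n_k\geqslant 1$, the set $\mathrm{Hol}(\mathcal P(n_1,\ldots,n_k))$ is open in $\mathrm{Hom}(\Gamma,\mathrm{PSL}_2(\mathbb C))/\mathrm{PSL}_2(\mathbb C)$ (equivalently, the set of $\rho\in\mathrm{Hom}(\Gamma,\mathrm{PSL}_2(\mathbb C))$ whose conjugacy class is in it is open in $\mathrm{Hom}(\Gamma,\mathrm{PSL}_2(\mathbb C))$).
   Context: $\mathrm{Hom}(\Gamma,\mathrm{PSL}_2(\mathbb C))$ has the topology of pointwise convergence, and its quotient by conjugation has the quotient topology. Let $\tilde\Sigma$ be the universal cover of $\Sigma$. A branched projective structure on $\Sigma$ is, up to the action of homeomorphisms isotopic to the identity, a maximal atlas of charts $\varphi_\alpha:U_\alpha\to\mathbb{CP}^1$ which, in suitable orientation-preserving local coordinates, have the form $z\mapsto z^{m}$ with $m\geqslant 1$, and such that on overlaps $\varphi_\alpha=h\circ\varphi_\beta$ with $h\in\mathrm{PSL}_2(\mathbb C)$. A point where a chart has local form $z\mapsto z^{n+1}$ has order $n$; it is a branch point if $n\geqslant 1$. $\mathcal P(n_1,\ldots,n_k)$ is the set of branched projective structures on $\Sigma$ with exactly $k$ branch points, of orders $n_1,\ldots,n_k$. Analytic continuation of a chart gives a developing map $f:\tilde\Sigma\to\mathbb{CP}^1$, equivariant under a unique homomorphism $\rho:\Gamma\to\mathrm{PSL}_2(\mathbb C)$, the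 holonomy, well defined up to conjugacy. $\mathrm{Hol}$ maps a branched projective structure to the conjugacy class of its holonomy. *)

theory Defs
  imports "HOL-Complex_Analysis.Complex_Analysis" "HOL-Algebra.Coset"
begin

section \<open>Quotient topologies\<close>

definition quotient_topology :: "'a topology \<Rightarrow> ('a \<Rightarrow> 'b) \<Rightarrow> 'b topology" where
  "quotient_topology X f =
     topology (\<lambda>U. U \<subseteq> f ` topspace X \<and> openin X {x \<in> topspace X. f x \<in> U})"

lemma openin_quotient_topology:
  "openin (quotient_topology X f) U \<longleftrightarrow>
     U \<subseteq> f ` topspace X \<and> openin X {x \<in> topspace X. f x \<in> U}"
proof -
  have "istopology (\<lambda>U. U \<subseteq> f ` topspace X \<and> openin X {x \<in> topspace X. f x \<in> U})"
    unfolding istopology_def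
  proof (intro conjI allI impI)
    fix U V
    assume U: "U \<subseteq> f ` topspace X \<and> openin X {x \<in> topspace X. f x \<in> U}"
      and V: "V \<subseteq> f ` topspace X \<and> openin X {x \<in> topspace X. f x \<in> V}"
    show "U \<inter> V \<subseteq> f ` topspace X" using U by (simp add: le_infI1)
    have "{x \<in> topspace X. f x \<in> U \<inter> V} =
        {x \<in> topspace X. f x \<in> U} \<inter> {x \<in> topspace X. f x \<in> V}"
      by (simp add: set_eq_iff conj_ac)
    then show "openin X {x \<in> topspace X. f x \<in> U \<inter> V}"
      using openin_Int[OF conjunct2[OF U] conjunct2[OF V]] by (rule ssubst)
  next
    fix \<K> assume *: "\<forall>U\<in>\<K>. U \<subseteq> f ` topspace X \<and> openin X {x \<in> topspace X. f x \<in> U}"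
    show "\<Union>\<K> \<subseteq> f ` topspace X" using * by (simp add: Union_least)
    have "{x \<in> topspace X. f x \<in> \<Union>\<K>} = (\<Union>U\<in>\<K>. {x \<in> topspace X. f x \<in> U})"
      by (simp add: set_eq_iff)
    moreover have "openin X (\<Union>U\<in>\<K>. {x \<in> topspace X. f x \<in> U})"
      by (rule openin_Union) (use * in \<open>simp add: image_iff, metis\<close>)
    ultimately show "openin X {x \<in> topspace X. f x \<in> \<Union>\<K>}" by (rule ssubst)
  qed
  then show ?thesis by (simp add: quotient_topology_def)
qed

lemma topspace_quotient_topology [simp]:
  "topspace (quotient_topology X f) = f ` topspace X"
proof
  show "topspace (quotient_topology X f) \<subseteq> f ` topspace X"
    using openin_topspace[of "quotient_topology X f"] by (simp only: openin_quotient_topology)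
  have "{x \<in> topspace X. f x \<in> f ` topspace X} = topspace X"
    by (simp add: set_eq_iff cong: conj_cong)
  then have "openin (quotient_topology X f) (f ` topspace X)"
    by (simp add: openin_quotient_topology)
  then show "f ` topspace X \<subseteq> topspace (quotient_topology X f)" by (rule openin_subset)
qed

lemma quotient_map_quotient_topology: "quotient_map X (quotient_topology X f) f"
  unfolding quotient_map_def openin_quotient_topology by simp


section \<open>The group PSL(2,C) and its action on the projective line\<close>

definition SL2 :: "(complex^2^2) monoid" where
  "SL2 = \<lparr>carrier = {A. det A = 1}, mult = (**), one = mat 1\<rparr>"

abbreviation pm_one :: "(complex^2^2) set" where
  "pm_one \<equiv> {mat 1, - mat 1}"

definition PSL2 :: "(complex^2^2) set monoid" where
  "PSL2 = SL2 Mod pm_one"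

definition PSL2_topology :: "(complex^2^2) set topology" where
  "PSL2_topology =
     quotient_topology (top_of_set (carrier SL2)) (\<lambda>A. pm_one #>\<^bsub>SL2\<^esub> A)"

text \<open>Points of the projective line are the complex lines in \<open>\<complex>\<^sup>2\<close>
  (\<open>vec.span\<close> is the span with complex scalars).\<close>

definition CP1 :: "(complex^2) set topology" where
  "CP1 = quotient_topology (top_of_set (- {0})) (\<lambda>v. vec.span {v})"

text \<open>An element of PSL(2,C) is a coset \<open>M = {A, -A}\<close>; both representatives map a line
  \<open>L\<close> to the same line.\<close>

definition PSL2_act :: "(complex^2^2) set \<Rightarrow> (complex^2) set \<Rightarrow> (complex^2) set" where
  "PSL2_act M L = {A *v v | A v. A \<in> M \<and> v \<in> L}"


section \<open>Oriented surfaces\<close>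

text \<open>A chart is a pair \<open>(U, u)\<close> of an open set and a map that is only relevant on \<open>U\<close>.\<close>

definition planar_chart :: "'a topology \<Rightarrow> 'a set \<times> ('a \<Rightarrow> complex) \<Rightarrow> bool" where
  "planar_chart X = (\<lambda>(U, u). openin X U \<and> open (u ` U) \<and>
     homeomorphic_map (subtopology X U) (top_of_set (u ` U)) u)"

text \<open>Orientation is expressed by local degree: an injective continuous map \<open>h\<close> on an open set
  of the plane preserves orientation iff it maps small positively oriented circles around \<open>z\<close>
  to loops of winding number 1 around \<open>h z\<close>.\<close>

definition orientation_preserving_on :: "complex set \<Rightarrow> (complex \<Rightarrow> complex) \<Rightarrow> bool" where
  "orientation_preserving_on D h \<longleftrightarrow>
     (\<forall>z r. r > 0 \<and> cball z r \<subseteq> D \<longrightarrow> winding_number (h \<circ> circlepath z r) (h z) = 1)"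

definition orientation_compatible ::
  "'a set \<times> ('a \<Rightarrow> complex) \<Rightarrow> 'a set \<times> ('a \<Rightarrow> complex) \<Rightarrow> bool" where
  "orientation_compatible = (\<lambda>(U, u) (V, v).
     orientation_preserving_on (u ` (U \<inter> V)) (v \<circ> inv_into U u))"

definition oriented_atlas :: "'a topology \<Rightarrow> ('a set \<times> ('a \<Rightarrow> complex)) set \<Rightarrow> bool" where
  "oriented_atlas X \<O> \<longleftrightarrow>
     (\<forall>c\<in>\<O>. planar_chart X c) \<and> (\<Union>c\<in>\<O>. fst c) = topspace X \<and>
     (\<forall>c\<in>\<O>. \<forall>d\<in>\<O>. orientation_compatible c d)"

text \<open>Orientation-preserving local coordinates for the orientation defined by \<open>\<O>\<close>; they
  need not belong to \<open>\<O>\<close>.\<close>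

definition oriented_chart ::
  "'a topology \<Rightarrow> ('a set \<times> ('a \<Rightarrow> complex)) set \<Rightarrow> 'a set \<times> ('a \<Rightarrow> complex) \<Rightarrow> bool" where
  "oriented_chart X \<O> c \<longleftrightarrow> planar_chart X c \<and> (\<forall>d\<in>\<O>. orientation_compatible d c)"

definition closed_oriented_surface ::
  "'a::topological_space set \<Rightarrow> ('a set \<times> ('a \<Rightarrow> complex)) set \<Rightarrow> bool" where
  "closed_oriented_surface S \<O> \<longleftrightarrow>
     S \<noteq> {} \<and> compact S \<and> connected S \<and> Hausdorff_space (top_of_set S) \<and>
     oriented_atlas (top_of_set S) \<O>"

text \<open>The complex orientation of the projective line, given by the two affine coordinates
  \<open>[v\<^sub>1 : v\<^sub>2] \<mapsto> v\<^sub>1 / v\<^sub>2\<close> and \<open>[v\<^sub>1 : v\<^sub>2] \<mapsto> v\<^sub>2 / v\<^sub>1\<close>.\<close>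

definition CP1_orientation :: "((complex^2) set set \<times> ((complex^2) set \<Rightarrow> complex)) set" where
  "CP1_orientation =
     {({L \<in> topspace CP1. \<exists>z. vector [z, 1] \<in> L}, \<lambda>L. THE z. vector [z, 1] \<in> L),
      ({L \<in> topspace CP1. \<exists>z. vector [1, z] \<in> L}, \<lambda>L. THE z. vector [1, z] \<in> L)}"


section \<open>Branched projective structures\<close>

type_synonym 'a bp_chart = "'a set \<times> ('a \<Rightarrow> (complex^2) set)"

text \<open>In suitable orientation-preserving coordinates centred at \<open>p\<close> and at \<open>\<phi> p\<close>, the map
  \<open>\<phi>\<close> is \<open>z \<mapsto> z ^ m\<close> near \<open>p\<close>.\<close>

definition power_form_at ::
  "'a::topological_space set \<Rightarrow> ('a set \<times> ('a \<Rightarrow> complex)) set \<Rightarrow> 'a bp_chart \<Rightarrow> 'a \<Rightarrow> nat \<Rightarrow> bool" where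
  "power_form_at S \<O> = (\<lambda>(U, \<phi>) p m.
     \<exists>W w Y y. oriented_chart (top_of_set S) \<O> (W, w) \<and> p \<in> W \<and> W \<subseteq> U \<and> w p = 0 \<and>
       oriented_chart CP1 CP1_orientation (Y, y) \<and> \<phi> p \<in> Y \<and> y (\<phi> p) = 0 \<and>
       (\<forall>x\<in>W. \<phi> x \<in> Y \<and> y (\<phi> x) = w x ^ m))"

definition bp_chart ::
  "'a::topological_space set \<Rightarrow> ('a set \<times> ('a \<Rightarrow> complex)) set \<Rightarrow> 'a bp_chart \<Rightarrow> bool" where
  "bp_chart S \<O> = (\<lambda>(U, \<phi>). openin (top_of_set S) U \<and> \<phi> \<in> extensional U \<and>
     (\<forall>p\<in>U. \<exists>m\<ge>1. power_form_at S \<O> (U, \<phi>) p m))"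

text \<open>The transition element of PSL(2,C) may depend on the connected component of the overlap.\<close>

definition bp_compatible :: "'a::topological_space set \<Rightarrow> 'a bp_chart \<Rightarrow> 'a bp_chart \<Rightarrow> bool" where
  "bp_compatible S = (\<lambda>(U, \<phi>) (V, \<psi>). \<forall>p\<in>U \<inter> V. \<exists>N h. openin (top_of_set S) N \<and> p \<in> N \<and>
     N \<subseteq> U \<inter> V \<and> h \<in> carrier PSL2 \<and> (\<forall>x\<in>N. \<phi> x = PSL2_act h (\<psi> x)))"

definition bp_atlas ::
  "'a::topological_space set \<Rightarrow> ('a set \<times> ('a \<Rightarrow> complex)) set \<Rightarrow> 'a bp_chart set \<Rightarrow> bool" where
  "bp_atlas S \<O> A \<longleftrightarrow> (\<forall>c\<in>A. bp_chart S \<O> c) \<and> (\<Union>c\<in>A. fst c) = S \<and>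
     (\<forall>c\<in>A. \<forall>d\<in>A. bp_compatible S c d)"

definition maximal_bp_atlas ::
  "'a::topological_space set \<Rightarrow> ('a set \<times> ('a \<Rightarrow> complex)) set \<Rightarrow> 'a bp_chart set \<Rightarrow> bool" where
  "maximal_bp_atlas S \<O> A \<longleftrightarrow> bp_atlas S \<O> A \<and> (\<forall>B. bp_atlas S \<O> B \<and> A \<subseteq> B \<longrightarrow> B = A)"

definition has_order ::
  "'a::topological_space set \<Rightarrow> ('a set \<times> ('a \<Rightarrow> complex)) set \<Rightarrow> 'a bp_chart set \<Rightarrow> 'a \<Rightarrow> nat \<Rightarrow> bool" where
  "has_order S \<O> A p n \<longleftrightarrow> (\<exists>c\<in>A. p \<in> fst c \<and> power_form_at S \<O> c p (n + 1))"

definition branch_points ::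
  "'a::topological_space set \<Rightarrow> ('a set \<times> ('a \<Rightarrow> complex)) set \<Rightarrow> 'a bp_chart set \<Rightarrow> 'a set" where
  "branch_points S \<O> A = {p \<in> S. \<exists>n\<ge>1. has_order S \<O> A p n}"

text \<open>Isotopy is homotopy through homeomorphisms.\<close>

definition isotopic_to_id :: "'a::topological_space set \<Rightarrow> ('a \<Rightarrow> 'a) \<Rightarrow> bool" where
  "isotopic_to_id S h \<longleftrightarrow>
     homotopic_with (homeomorphic_map (top_of_set S) (top_of_set S))
       (top_of_set S) (top_of_set S) id h"

definition push_atlas ::
  "'a::topological_space set \<Rightarrow> ('a \<Rightarrow> 'a) \<Rightarrow> 'a bp_chart set \<Rightarrow> 'a bp_chart set" where
  "push_atlas S h A = (\<lambda>(U, \<phi>). (h ` U, restrict (\<phi> \<circ> inv_into S h) (h ` U))) ` A"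

text \<open>A branched projective structure is the orbit of a maximal atlas.\<close>

definition bp_structure_of ::
  "'a::topological_space set \<Rightarrow> 'a bp_chart set \<Rightarrow> 'a bp_chart set set" where
  "bp_structure_of S A = {push_atlas S h A | h. isotopic_to_id S h}"

definition bp_structures ::
  "'a::topological_space set \<Rightarrow> ('a set \<times> ('a \<Rightarrow> complex)) set \<Rightarrow> nat list \<Rightarrow> 'a bp_chart set set set" where
  "bp_structures S \<O> ns = {bp_structure_of S A | A. maximal_bp_atlas S \<O> A \<and>
     (\<exists>ps. distinct ps \<and> set ps = branch_points S \<O> A \<and> list_all2 (has_order S \<O> A) ps ns)}"


section \<open>Fundamental group and universal cover\<close>

definition path_class :: "'a::topological_space set \<Rightarrow> (real \<Rightarrow> 'a) \<Rightarrow> (real \<Rightarrow> 'a) set" where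
  "path_class S p = {q. homotopic_paths S p q}"

definition paths_from :: "'a::topological_space set \<Rightarrow> 'a \<Rightarrow> (real \<Rightarrow> 'a) set" where
  "paths_from S x = {p. path p \<and> path_image p \<subseteq> S \<and> pathstart p = x}"

definition class_join ::
  "'a::topological_space set \<Rightarrow> (real \<Rightarrow> 'a) set \<Rightarrow> (real \<Rightarrow> 'a) set \<Rightarrow> (real \<Rightarrow> 'a) set" where
  "class_join S P Q = {r. \<exists>p\<in>P. \<exists>q\<in>Q. homotopic_paths S (p +++ q) r}"

definition fundamental_group ::
  "'a::topological_space set \<Rightarrow> 'a \<Rightarrow> (real \<Rightarrow> 'a) set monoid" where
  "fundamental_group S x =
     \<lparr>carrier = path_class S ` {p \<in> paths_from S x. pathfinish p = x},
      mult = class_join S,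
      one = path_class S (\<lambda>_. x)\<rparr>"

text \<open>The universal cover based at \<open>x\<close>: homotopy classes of paths starting at \<open>x\<close>, with the
  topology generated by the sets of classes of \<open>p +++ q\<close>, where \<open>q\<close> runs over the paths in an
  open set \<open>U\<close> starting at the end point of \<open>p\<close>. The covering map sends a class to the common
  end point of its members, and \<open>fundamental_group S x\<close> acts from the left by \<open>class_join S\<close>.\<close>

definition universal_cover ::
  "'a::topological_space set \<Rightarrow> 'a \<Rightarrow> (real \<Rightarrow> 'a) set topology" where
  "universal_cover S x = topology_generated_by
     {(\<lambda>q. path_class S (p +++ q)) ` paths_from U (pathfinish p) | p U.
        p \<in> paths_from S x \<and> openin (top_of_set S) U \<and> pathfinish p \<in> U}"

definition cover_proj :: "(real \<Rightarrow> 'a::topological_space) set \<Rightarrow> 'a" where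
  "cover_proj P = the_elem (pathfinish ` P)"


section \<open>Representations, developing maps and holonomy\<close>

text \<open>Homomorphisms are taken to be extensional, so that they are determined by their values on
  the group. The product topology is that of pointwise convergence.\<close>

definition Hom_topology :: "('g, 'b) monoid_scheme \<Rightarrow> ('g \<Rightarrow> (complex^2^2) set) topology" where
  "Hom_topology G = subtopology (product_topology (\<lambda>_. PSL2_topology) (carrier G))
     (hom G PSL2 \<inter> extensional (carrier G))"

definition conj_class ::
  "('g, 'b) monoid_scheme \<Rightarrow> ('g \<Rightarrow> (complex^2^2) set) \<Rightarrow> ('g \<Rightarrow> (complex^2^2) set) set" where
  "conj_class G \<rho> =
     (\<lambda>M. \<lambda>g\<in>carrier G. M \<otimes>\<^bsub>PSL2\<^esub> \<rho> g \<otimes>\<^bsub>PSL2\<^esub> inv\<^bsub>PSL2\<^esub> M) ` carrier PSL2"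

definition Hom_mod_conj ::
  "('g, 'b) monoid_scheme \<Rightarrow> ('g \<Rightarrow> (complex^2^2) set) set topology" where
  "Hom_mod_conj G = quotient_topology (Hom_topology G) (conj_class G)"

text \<open>A map on the universal cover is an analytic continuation of a chart iff it is, locally, a
  chart of the maximal atlas composed with the covering map.\<close>

definition developing_map ::
  "'a::topological_space set \<Rightarrow> 'a \<Rightarrow> 'a bp_chart set \<Rightarrow> ((real \<Rightarrow> 'a) set \<Rightarrow> (complex^2) set) \<Rightarrow> bool" where
  "developing_map S x A f \<longleftrightarrow>
     (\<forall>P\<in>topspace (universal_cover S x). \<exists>V. openin (universal_cover S x) V \<and> P \<in> V \<and>
        (\<exists>(U, \<phi>)\<in>A. \<forall>Q\<in>V. cover_proj Q \<in> U \<and> f Q = \<phi> (cover_proj Q)))"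

definition equivariant ::
  "'a::topological_space set \<Rightarrow> 'a \<Rightarrow> ((real \<Rightarrow> 'a) set \<Rightarrow> (complex^2) set) \<Rightarrow>
     ((real \<Rightarrow> 'a) set \<Rightarrow> (complex^2^2) set) \<Rightarrow> bool" where
  "equivariant S x f \<rho> \<longleftrightarrow>
     (\<forall>g\<in>carrier (fundamental_group S x). \<forall>P\<in>topspace (universal_cover S x).
        f (class_join S g P) = PSL2_act (\<rho> g) (f P))"

text \<open>The class does not depend on the atlas representing the structure: an isotopy from the
  identity lifts to the universal cover, starting at the identity and commuting with the action
  of the fundamental group.\<close>

definition Hol ::
  "'a::topological_space set \<Rightarrow> 'a \<Rightarrow> 'a bp_chart set set \<Rightarrow>
     ((real \<Rightarrow> 'a) set \<Rightarrow> (complex^2^2) set) set" where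
  "Hol S x \<sigma> = (THE C. \<exists>A\<in>\<sigma>. \<exists>f \<rho>. developing_map S x A f \<and>
     \<rho> \<in> topspace (Hom_topology (fundamental_group S x)) \<and> equivariant S x f \<rho> \<and>
     C = conj_class (fundamental_group S x) \<rho>)"

end

theory Submission
  imports Defs
begin

text \<open>The theorem is the stability of developing maps under deformation of the holonomy (the
  Ehresmann--Thurston principle), in a form that keeps the branch points.

  A branched projective structure has a developing map \<open>f\<close> on the universal cover, unique up to
  projective transformations, and hence a holonomy \<open>\<rho>\<close>, unique up to conjugation
  (\<open>developing_map_exists\<close>, \<open>developing_unique\<close>, \<open>holonomy_exists\<close>). An isotopy from the identity lifts
  to the universal cover and the lift commutes with the deck transformations, so that the conjugacy
  class depends only on the structure (\<open>developing_pull_back\<close>, \<open>Hol_eq\<close>). It remains to show that every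
  representation \<open>\<rho>'\<close> close to \<open>\<rho>\<close> is the holonomy of a structure with the same orders at the same
  points (\<open>nearby_holonomy\<close>).

  To this end \<open>f\<close> is deformed into a \<open>\<rho>'\<close>-equivariant map. Finitely many discs \<open>W i\<close> cover the
  surface. Over \<open>W i\<close> the universal cover has a section, along which \<open>f\<close> is a map \<open>\<phi> i\<close>, and over the
  intersection of two discs the section of index \<open>i\<close> is the translate of that of index \<open>j\<close> by an
  element \<open>g\<^sub>i\<^sub>j\<close> of the fundamental group. The corrections \<open>C\<^sub>g = \<rho>'(g) \<rho>(g)\<^sup>-\<^sup>1\<close> are close to the identity.
  At the point over \<open>y\<close> of the section of index \<open>i\<close> the new map takes the value \<open>A\<^sub>i(y) (\<phi> i y)\<close>, where
  the matrix \<open>A\<^sub>i(y)\<close> is the average of lifts of the corrections of the \<open>g\<^sub>i\<^sub>j\<close>, with weights given by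
  bump functions on the discs \<open>W j\<close>. The relation \<open>\<rho>'(g) C\<^sub>h \<rho>(g)\<^sup>-\<^sup>1 = C\<^sub>g\<^sub>h\<close> makes these values
  compatible (\<open>corr_cocycle\<close>).

  The bump functions are chosen as Lipschitz functions of the values of the maps \<open>\<phi> j\<close>, not of
  coordinates on the surface. Near every point \<open>A\<^sub>i(y)\<close> therefore depends on \<open>y\<close> only through
  \<open>\<phi> i y\<close>, and the new map is \<open>k \<circ> \<phi> i\<close> for a map \<open>k\<close> of the projective line that is close to the
  identity in the Lipschitz sense. Such a \<open>k\<close> is an orientation-preserving embedding
  (\<open>mat_comb_near_identity\<close>), so that the new map has the same local form \<open>z \<mapsto> z\<^sup>m\<close> as \<open>f\<close> at every
  point, branch points included (\<open>power_form_at_or_iso\<close>). By compactness one neighbourhood of \<open>\<rho>\<close>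
  serves for all points (\<open>eventually_good\<close>), and the germs of the new map define the required
  maximal atlas (\<open>maximal'\<close>, \<open>has_order_iff\<close>, \<open>developing'\<close>).\<close>

no_notation fps_nth (infixl \<open>$\<close> 75)

section \<open>The group PSL(2,C)\<close>

definition pm :: "complex^2^2 \<Rightarrow> (complex^2^2) set" where
  "pm A = {A, - A}"

lemma pm_uminus [simp]: "pm (- A) = pm A"
  by (auto simp: pm_def)

lemma pm_eq_iff: "pm A = pm B \<longleftrightarrow> A = B \<or> A = - B"
  by (auto simp: pm_def doubleton_eq_iff)

lemma matrix_minus_left [simp]: "(- A) ** B = - (A ** B)" for A B :: "complex^2^2"
  by (simp add: matrix_matrix_mult_def vec_eq_iff sum_negf)

lemma matrix_minus_right [simp]: "A ** (- B) = - (A ** B)" for A B :: "complex^2^2"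
  by (simp add: matrix_matrix_mult_def vec_eq_iff sum_negf)

lemma matrix_vector_minus_left [simp]: "(- A) *v v = - (A *v v)" for A :: "complex^2^2"
  by (simp add: matrix_vector_mult_def vec_eq_iff sum_negf)

lemma det_minus_2 [simp]: "det (- A) = det A" for A :: "complex^2^2"
  by (simp add: det_2)

lemma det_matrix_inv_1:
  fixes A :: "complex^2^2"
  assumes "det A = 1"
  shows "matrix_inv A ** A = mat 1" "A ** matrix_inv A = mat 1" "det (matrix_inv A) = 1"
proof -
  have inv: "invertible A" using assms by (simp add: invertible_det_nz)
  then show 1: "matrix_inv A ** A = mat 1" and "A ** matrix_inv A = mat 1"
    unfolding invertible_def matrix_inv_def by (metis (mono_tags, lifting) someI_ex)+
  have "det (matrix_inv A) * det A = 1" using 1 by (metis det_mul det_I)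
  then show "det (matrix_inv A) = 1" using assms by simp
qed

lemma SL2_simps [simp]:
  "carrier SL2 = {A. det A = 1}" "mult SL2 = (**)" "one SL2 = mat 1"
  by (simp_all add: SL2_def)

lemma group_SL2: "group SL2"
proof (rule groupI)
  fix A assume "A \<in> carrier SL2"
  then show "\<exists>B\<in>carrier SL2. B \<otimes>\<^bsub>SL2\<^esub> A = \<one>\<^bsub>SL2\<^esub>"
    by (intro bexI[of _ "matrix_inv A"]) (simp_all add: det_matrix_inv_1)
qed (simp_all add: det_mul matrix_mul_assoc)

lemma normal_pm_one: "pm_one \<lhd> SL2"
proof -
  interpret group SL2 by (rule group_SL2)
  have inv_minus: "inv\<^bsub>SL2\<^esub> (- mat 1) = - mat 1"
    by (rule inv_equality) auto
  have inv_1: "inv\<^bsub>SL2\<^esub> (mat 1) = mat 1"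
    by (rule inv_equality) auto
  have "subgroup pm_one SL2"
    by (rule subgroupI) (auto simp: inv_minus inv_1)
  moreover have "x \<otimes>\<^bsub>SL2\<^esub> h \<otimes>\<^bsub>SL2\<^esub> inv\<^bsub>SL2\<^esub> x \<in> pm_one"
    if "x \<in> carrier SL2" "h \<in> pm_one" for x h
    using that r_inv[OF that(1)] by auto
  ultimately show ?thesis
    by (simp add: normal_inv_iff)
qed

lemma group_PSL2: "group PSL2"
  unfolding PSL2_def by (rule normal.factorgroup_is_group[OF normal_pm_one])

lemma coset_pm_one: "pm_one #>\<^bsub>SL2\<^esub> A = pm A"
  by (auto simp: r_coset_def pm_def)

lemma carrier_PSL2: "carrier PSL2 = pm ` {A. det A = 1}"
  by (auto simp: PSL2_def FactGroup_def RCOSETS_def coset_pm_one)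

lemma pm_in_PSL2 [simp]: "det A = 1 \<Longrightarrow> pm A \<in> carrier PSL2"
  by (simp add: carrier_PSL2)

lemma PSL2_E:
  assumes "M \<in> carrier PSL2"
  obtains A where "det A = 1" "M = pm A"
  using assms by (auto simp: carrier_PSL2)

lemma mult_pm [simp]: "pm A \<otimes>\<^bsub>PSL2\<^esub> pm B = pm (A ** B)"
  by (auto simp: PSL2_def FactGroup_def set_mult_def pm_def)

lemma one_PSL2 [simp]: "\<one>\<^bsub>PSL2\<^esub> = pm (mat 1)"
  by (auto simp: PSL2_def FactGroup_def pm_def)

interpretation PSL2: group PSL2
  by (rule group_PSL2)

lemma inv_pm: "det A = 1 \<Longrightarrow> inv\<^bsub>PSL2\<^esub> (pm A) = pm (matrix_inv A)"
  by (rule PSL2.inv_equality) (simp_all add: det_matrix_inv_1)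

lemma topspace_CP1: "topspace CP1 = (\<lambda>v. vec.span {v}) ` (- {0})"
  by (simp add: CP1_def)

lemma CP1_E:
  assumes "L \<in> topspace CP1"
  obtains v where "v \<noteq> 0" "L = vec.span {v}"
  using assms by (auto simp: topspace_CP1)

lemma span_in_CP1 [simp]: "v \<noteq> 0 \<Longrightarrow> vec.span {v} \<in> topspace CP1"
  by (auto simp: topspace_CP1)

lemma mem_line: "u \<in> vec.span {v} \<longleftrightarrow> (\<exists>c. u = c *s v)" for v :: "complex^2"
  by (auto simp: vec.span_singleton)

lemma line_eqI:
  fixes u v :: "complex^2"
  assumes "u = c *s v" "c \<noteq> 0"
  shows "vec.span {u} = vec.span {v}"
proof -
  have v: "v = inverse c *s u" using assms by (simp add: vector_smult_assoc)
  have "vec.span {u} \<subseteq> vec.span {v}"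
    unfolding assms(1) by (auto simp: mem_line)
  moreover have "vec.span {v} \<subseteq> vec.span {u}"
    by (subst v) (auto simp: mem_line)
  ultimately show ?thesis by (rule antisym)
qed

lemma line_eqD:
  fixes u v :: "complex^2"
  assumes "vec.span {u} = vec.span {v}" "u \<noteq> 0"
  obtains c where "u = c *s v" "c \<noteq> 0"
proof -
  have "u \<in> vec.span {v}" using assms(1) vec.span_base[of u "{u}"] by simp
  then obtain c where "u = c *s v" by (auto simp: mem_line)
  moreover with \<open>u \<noteq> 0\<close> have "c \<noteq> 0" by auto
  ultimately show ?thesis using that by blast
qed

lemma PSL2_act_pm: "PSL2_act (pm A) (vec.span {v}) = vec.span {A *v v}"
proof -
  have *: "A *v (c *s v) = c *s (A *v v)" for c
    by (simp add: matrix_vector_mult_def vec_eq_iff sum_distrib_left algebra_simps)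
  show ?thesis
  proof (intro subset_antisym subsetI)
    fix w assume "w \<in> PSL2_act (pm A) (vec.span {v})"
    then obtain B c where "w = B *v (c *s v)" "B \<in> {A, - A}"
      unfolding PSL2_act_def pm_def mem_line by blast
    then have "w = A *v (c *s v) \<or> w = (- A) *v (c *s v)" by blast
    then have "w = c *s (A *v v) \<or> w = (- c) *s (A *v v)"
      by (simp add: * vec_eq_iff)
    then show "w \<in> vec.span {A *v v}" unfolding mem_line by blast
  next
    fix w assume "w \<in> vec.span {A *v v}"
    then obtain c where "w = A *v (c *s v)" by (auto simp: mem_line *)
    then show "w \<in> PSL2_act (pm A) (vec.span {v})"
      by (auto simp: PSL2_act_def pm_def mem_line)
  qed
qed

lemma det_1_mult_nonzero:
  fixes A :: "complex^2^2"
  assumes "det A = 1" "v \<noteq> 0"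
  shows "A *v v \<noteq> 0"
proof
  assume "A *v v = 0"
  then have "matrix_inv A *v (A *v v) = 0" by simp
  then show False using assms by (simp add: matrix_vector_mul_assoc det_matrix_inv_1)
qed

lemma PSL2_act_closed [simp]:
  assumes "M \<in> carrier PSL2" "L \<in> topspace CP1"
  shows "PSL2_act M L \<in> topspace CP1"
  using assms by (auto elim!: PSL2_E CP1_E simp: PSL2_act_pm det_1_mult_nonzero)

lemma PSL2_act_mult:
  assumes "M \<in> carrier PSL2" "N \<in> carrier PSL2" "L \<in> topspace CP1"
  shows "PSL2_act (M \<otimes>\<^bsub>PSL2\<^esub> N) L = PSL2_act M (PSL2_act N L)"
  using assms by (auto elim!: PSL2_E CP1_E simp: PSL2_act_pm matrix_vector_mul_assoc)

lemma PSL2_act_one [simp]: "L \<in> topspace CP1 \<Longrightarrow> PSL2_act (pm (mat 1)) L = L"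
  by (auto elim!: CP1_E simp: PSL2_act_pm)

lemma PSL2_act_inv [simp]:
  assumes "M \<in> carrier PSL2" "L \<in> topspace CP1"
  shows "PSL2_act (inv\<^bsub>PSL2\<^esub> M) (PSL2_act M L) = L"
    and "PSL2_act M (PSL2_act (inv\<^bsub>PSL2\<^esub> M) L) = L"
  using assms by (simp_all flip: PSL2_act_mult)

text \<open>A projective transformation is determined by its values at three points: a matrix
  \<open>(a b; c d)\<close> fixes the line of \<open>(z, 1)\<close> iff \<open>z\<close> is a root of \<open>c z\<^sup>2 + (d - a) z - b\<close>, so that it
  is scalar once it fixes infinitely many lines.\<close>

lemma PSL2_fixes_infinite:
  assumes "M \<in> carrier PSL2" "infinite \<L>" "\<L> \<subseteq> topspace CP1"
    and fixed: "\<And>L. L \<in> \<L> \<Longrightarrow> PSL2_act M L = L"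
  shows "M = \<one>\<^bsub>PSL2\<^esub>"
proof -
  obtain A where A: "det A = 1" "M = pm A" using assms(1) by (rule PSL2_E)
  define p where "p = [:- A$1$2, A$2$2 - A$1$1, A$2$1:]"
  have "\<L> - {vec.span {vector [1, 0]}} \<subseteq> (\<lambda>z. vec.span {vector [z, 1]}) ` {z. poly p z = 0}"
  proof
    fix L assume L: "L \<in> \<L> - {vec.span {vector [1, 0]}}"
    then obtain v where v: "v \<noteq> 0" "L = vec.span {v}" using assms(3) by (blast elim: CP1_E)
    have v2: "v$2 \<noteq> 0"
    proof
      assume v0: "v$2 = 0"
      then have "v = (v$1) *s vector [1, 0]" by (simp add: vec_eq_iff forall_2)
      moreover have "v$1 \<noteq> 0" using v v0 by (auto simp: vec_eq_iff forall_2)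
      ultimately have "L = vec.span {vector [1, 0]}" unfolding v(2) by (rule line_eqI)
      then show False using L by simp
    qed
    define z where "z = v$1 / v$2"
    have vz: "v = v$2 *s vector [z, 1]" using v2 by (simp add: vec_eq_iff forall_2 z_def)
    have Lz: "L = vec.span {vector [z, 1]}" unfolding v(2) using vz v2 by (rule line_eqI)
    have "PSL2_act M L = L" using L fixed by blast
    then have "vec.span {A *v vector [z, 1]} = vec.span {vector [z, 1]}"
      by (simp add: A Lz PSL2_act_pm)
    moreover have "A *v vector [z, 1] \<noteq> 0"
      by (rule det_1_mult_nonzero[OF A(1)]) (simp add: vec_eq_iff forall_2)
    ultimately obtain c where "A *v vector [z, 1] = c *s vector [z, 1]" by (rule line_eqD)
    then have "A$1$1 * z + A$1$2 = c * z" "A$2$1 * z + A$2$2 = c"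
      by (auto simp: vec_eq_iff forall_2 matrix_vector_mult_def sum_2)
    then have "poly p z = 0" by (simp add: p_def algebra_simps)
    then show "L \<in> (\<lambda>z. vec.span {vector [z, 1]}) ` {z. poly p z = 0}" using Lz by blast
  qed
  moreover have "infinite (\<L> - {vec.span {vector [1, 0]}})" using assms(2) by simp
  ultimately have "infinite {z. poly p z = 0}" by (meson finite_imageI finite_subset)
  then have "p = 0" using poly_roots_finite by blast
  then have *: "A$1$2 = 0" "A$2$1 = 0" "A$2$2 = A$1$1" by (auto simp: p_def)
  then have "A$1$1 * A$1$1 = 1" using A(1) by (simp add: det_2)
  then have "A$1$1 = 1 \<or> A$1$1 = -1" using square_eq_1_iff by blast
  then have "A = mat 1 \<or> A = - mat 1" using * by (auto simp: vec_eq_iff forall_2 mat_def)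
  then show ?thesis by (simp add: A pm_eq_iff)
qed

lemma PSL2_eqI_infinite:
  assumes "M \<in> carrier PSL2" "N \<in> carrier PSL2" "infinite \<L>" "\<L> \<subseteq> topspace CP1"
    and "\<And>L. L \<in> \<L> \<Longrightarrow> PSL2_act M L = PSL2_act N L"
  shows "M = N"
proof -
  have "inv\<^bsub>PSL2\<^esub> N \<otimes>\<^bsub>PSL2\<^esub> M = \<one>\<^bsub>PSL2\<^esub>"
    by (rule PSL2_fixes_infinite[OF _ assms(3,4)])
       (use assms in \<open>auto simp: PSL2_act_mult subset_iff\<close>)
  then have "inv\<^bsub>PSL2\<^esub> M = inv\<^bsub>PSL2\<^esub> N"
    by (rule PSL2.inv_equality) (use assms in auto)
  then have "inv\<^bsub>PSL2\<^esub> (inv\<^bsub>PSL2\<^esub> M) = inv\<^bsub>PSL2\<^esub> (inv\<^bsub>PSL2\<^esub> N)" by simp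
  then show ?thesis using assms by simp
qed

text \<open>The matrices of determinant 1 whose class has a representative near \<open>B\<close> form the union of two balls,
  around \<open>B\<close> and \<open>- B\<close>; it is open and saturated.\<close>

lemma PSL2_topology_nbhd:
  assumes "det B = 1" "\<epsilon> > 0"
  obtains U where "openin PSL2_topology U" "pm B \<in> U"
    "\<And>M. M \<in> U \<Longrightarrow> \<exists>A. det A = 1 \<and> M = pm A \<and> norm (A - B) < \<epsilon>"
proof
  let ?U = "pm ` {A. det A = 1 \<and> norm (A - B) < \<epsilon>}"
  have "pm A \<in> ?U \<longleftrightarrow> norm (A - B) < \<epsilon> \<or> norm (- A - B) < \<epsilon>" if "det A = 1" for A
  proof
    assume "norm (A - B) < \<epsilon> \<or> norm (- A - B) < \<epsilon>"
    then have "\<exists>C. C \<in> {A. det A = 1 \<and> norm (A - B) < \<epsilon>} \<and> pm A = pm C"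
    proof
      assume "norm (- A - B) < \<epsilon>"
      then show ?thesis using that by (intro exI[of _ "- A"]) simp
    qed (use that in blast)
    then show "pm A \<in> ?U" by blast
  qed (auto simp: pm_eq_iff)
  then have eq: "{A \<in> carrier SL2. pm A \<in> ?U} = carrier SL2 \<inter> {A. norm (A - B) < \<epsilon> \<or> norm (- A - B) < \<epsilon>}"
    by auto
  have "{A. norm (A - B) < \<epsilon> \<or> norm (- A - B) < \<epsilon>} = ball B \<epsilon> \<union> ball (- B) \<epsilon>"
  proof -
    have "norm (- A - B) = dist (- B) A" "norm (A - B) = dist B A" for A
      by (simp_all add: dist_norm norm_minus_commute add.commute)
    then show ?thesis by auto
  qed
  then have op: "open {A. norm (A - B) < \<epsilon> \<or> norm (- A - B) < \<epsilon>}" by (simp only: open_Un open_ball)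
  have "openin (top_of_set (carrier SL2)) {A \<in> carrier SL2. pm A \<in> ?U}"
    unfolding eq by (rule openin_open_Int[OF op])
  then show "openin PSL2_topology ?U"
    unfolding PSL2_topology_def openin_quotient_topology coset_pm_one by auto
qed (use assms in auto)

lemma topspace_PSL2_topology: "topspace PSL2_topology = carrier PSL2"
  by (simp add: PSL2_topology_def coset_pm_one carrier_PSL2)

section \<open>Orientation of planar maps\<close>

text \<open>Local degree 1, as a condition at one point. For injective continuous maps all small circles have
  the same winding number, so that one circle decides.\<close>

definition or_at :: "(complex \<Rightarrow> complex) \<Rightarrow> complex \<Rightarrow> bool" where
  "or_at h z \<longleftrightarrow> (\<forall>\<^sub>F r in at_right 0. winding_number (h \<circ> circlepath z r) (h z) = 1)"

lemma dist_circlepath: "r \<ge> 0 \<Longrightarrow> dist z (circlepath z r t) = r"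
  by (simp add: circlepath dist_norm norm_mult norm_exp_eq_Re)

text \<open>The annulus between the two circles misses \<open>z\<close>, so that its image misses \<open>h z\<close> by injectivity.\<close>

lemma winding_number_image_circle_radius:
  assumes "continuous_on (cball z R) h" "inj_on h (cball z R)" "0 < r" "r \<le> R"
  shows "winding_number (h \<circ> circlepath z r) (h z) = winding_number (h \<circ> circlepath z R) (h z)"
proof -
  have "homotopic_loops (cball z R - {z}) (circlepath z r) (circlepath z R)"
  proof (rule homotopic_loops_linear)
    fix t :: real
    show "closed_segment (circlepath z r t) (circlepath z R t) \<subseteq> cball z R - {z}"
    proof
      fix w assume "w \<in> closed_segment (circlepath z r t) (circlepath z R t)"
      then obtain u where u: "0 \<le> u" "u \<le> 1"
        "w = (1 - u) *\<^sub>R circlepath z r t + u *\<^sub>R circlepath z R t"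
        unfolding closed_segment_def by blast
      define s where "s = (1 - u) * r + u * R"
      have w: "w = circlepath z s t"
        by (simp add: u(3) s_def circlepath scaleR_conv_of_real algebra_simps)
      have "0 < s" "s \<le> R"
        using u assms convex_bound_le[of r R R "1 - u" u]
        by (auto simp: s_def) (smt (verit) mult_pos_pos mult_nonneg_nonneg)
      then show "w \<in> cball z R - {z}"
        using dist_circlepath[of s z t] by (auto simp: w)
    qed
  qed auto
  then have "homotopic_loops (- {h z}) (h \<circ> circlepath z r) (h \<circ> circlepath z R)"
  proof (rule homotopic_loops_continuous_image)
    show "continuous_on (cball z R - {z}) h" using assms(1) by (rule continuous_on_subset) auto
    show "h \<in> (cball z R - {z}) \<rightarrow> - {h z}"
      using assms by (auto dest: inj_onD)
  qed
  then show ?thesis by (rule winding_number_homotopic_loops)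
qed

lemma or_at_iff_circle:
  assumes "continuous_on (cball z R) h" "inj_on h (cball z R)" "0 < R"
  shows "or_at h z \<longleftrightarrow> winding_number (h \<circ> circlepath z R) (h z) = 1"
proof -
  have "\<forall>\<^sub>F r in at_right 0. 0 < r \<and> r \<le> R"
    unfolding eventually_at_right_field using assms(3) by (metis less_imp_le)
  then have *: "\<forall>\<^sub>F r in at_right 0. winding_number (h \<circ> circlepath z r) (h z)
      = winding_number (h \<circ> circlepath z R) (h z)"
    by eventually_elim (rule winding_number_image_circle_radius[OF assms(1,2)], auto)
  show ?thesis
  proof
    assume "or_at h z"
    then have "\<forall>\<^sub>F r :: real in at_right 0. winding_number (h \<circ> circlepath z R) (h z) = 1"
      unfolding or_at_def using * by eventually_elim simp
    then show "winding_number (h \<circ> circlepath z R) (h z) = 1" by simp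
  next
    assume "winding_number (h \<circ> circlepath z R) (h z) = 1"
    then show "or_at h z" unfolding or_at_def using * by simp
  qed
qed

lemma orientation_preserving_on_iff:
  assumes "open D" "continuous_on D h" "inj_on h D"
  shows "orientation_preserving_on D h \<longleftrightarrow> (\<forall>z\<in>D. or_at h z)"
proof
  assume L: "orientation_preserving_on D h"
  show "\<forall>z\<in>D. or_at h z"
  proof
    fix z assume "z \<in> D"
    then obtain R where R: "R > 0" "cball z R \<subseteq> D" using assms(1) open_contains_cball by blast
    then show "or_at h z"
      using L assms
      by (subst or_at_iff_circle[of _ R])
         (auto simp: orientation_preserving_on_def intro: continuous_on_subset inj_on_subset)
  qed
next
  assume R: "\<forall>z\<in>D. or_at h z"
  show "orientation_preserving_on D h"
    unfolding orientation_preserving_on_def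
  proof (intro allI impI)
    fix z :: complex and r :: real assume r: "0 < r \<and> cball z r \<subseteq> D"
    then have "z \<in> D" by auto
    then have "or_at h z" using R by blast
    then show "winding_number (h \<circ> circlepath z r) (h z) = 1"
      using r assms by (subst (asm) or_at_iff_circle[of _ r])
        (auto intro: continuous_on_subset inj_on_subset)
  qed
qed

lemma or_at_cong:
  assumes "\<forall>\<^sub>F w in nhds z. g w = h w"
  shows "or_at g z \<longleftrightarrow> or_at h z"
proof -
  obtain d where d: "d > 0" "\<And>w. dist w z < d \<Longrightarrow> g w = h w"
    using assms by (auto simp: eventually_nhds_metric)
  then have z: "g z = h z" by simp
  have ev: "\<forall>\<^sub>F r in at_right 0. 0 < r \<and> r < d"
    unfolding eventually_at_right_field using d(1) by blast
  have *: "\<forall>\<^sub>F r in at_right 0.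
      winding_number (g \<circ> circlepath z r) (g z) = winding_number (h \<circ> circlepath z r) (h z)"
    using ev
  proof eventually_elim
    case (elim r)
    have "g (circlepath z r t) = h (circlepath z r t)" for t
      using elim by (intro d(2)) (simp add: dist_commute dist_circlepath)
    then show ?case unfolding z by (intro winding_number_cong) simp
  qed
  show ?thesis
    unfolding or_at_def
    by (rule iffI; rule eventually_mp[OF _ *]; erule eventually_mono; simp)
qed

text \<open>The degree is multiplicative. A small loop around \<open>g z\<close> of winding number 1 is homotopic in
  the punctured plane to a small circle; the homotopy is pushed into a punctured disc, on which \<open>h\<close>
  is defined, by the radial retraction.\<close>

lemma or_at_compose:
  assumes U: "open U" "z \<in> U" "continuous_on U g" "inj_on g U"
    and V: "open V" "g z \<in> V" "continuous_on V h" "inj_on h V"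
    and or: "or_at g z" "or_at h (g z)"
  shows "or_at (\<lambda>w. h (g w)) z"
proof -
  define c where "c = g z"
  obtain s where s: "s > 0" "cball c s \<subseteq> V"
    using V open_contains_cball unfolding c_def by blast
  have contg: "continuous_on U g" by fact
  have "open (U \<inter> g -` ball c s)"
    by (rule continuous_open_preimage[OF U(3,1)]) auto
  moreover have "z \<in> U \<inter> g -` ball c s" using U s by (simp add: c_def)
  ultimately obtain d where d: "d > 0" "cball z d \<subseteq> U \<inter> g -` ball c s"
    using open_contains_cball by blast
  define p where "p = g \<circ> circlepath z d"
  define q where "q = circlepath c s"
  have contgd: "continuous_on (cball z d) g" "inj_on g (cball z d)"
    using d U by (auto intro: continuous_on_subset inj_on_subset)
  have conths: "continuous_on (cball c s) h" "inj_on h (cball c s)"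
    using s V by (auto intro: continuous_on_subset inj_on_subset)
  have wp: "winding_number p c = 1"
    using or(1) or_at_iff_circle[OF contgd d(1)] by (simp add: p_def c_def)
  have wq: "winding_number (h \<circ> q) (h c) = 1"
    using or(2) or_at_iff_circle[OF conths s(1)] by (simp add: q_def c_def)
  have p_in: "p t \<in> ball c s - {c}" for t
  proof -
    have "circlepath z d t \<in> cball z d" "circlepath z d t \<noteq> z"
      using dist_circlepath[of d z t] d(1) by auto
    moreover from this have "p t \<noteq> c"
      using contgd(2) d(1) by (auto simp: p_def c_def dest: inj_onD)
    ultimately show ?thesis using d(2) by (auto simp: p_def)
  qed
  have q_in: "q t \<in> cball c s - {c}" for t
    using dist_circlepath[of s c t] s(1) by (auto simp: q_def)
  have "homotopic_loops (- {c}) p q"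
  proof (subst winding_number_homotopic_loops_eq[symmetric])
    show "path p" unfolding p_def
      using d(1) continuous_on_subset[OF contgd(1) sphere_cball] by (intro path_continuous_image) auto
    show "winding_number p c = winding_number q c"
      using wp s(1) by (simp add: q_def winding_number_circlepath_centre)
    show "c \<notin> path_image p" "c \<notin> path_image q"
      using p_in q_in unfolding path_image_def by blast+
    show "pathfinish p = pathstart p" by (simp add: p_def pathfinish_compose pathstart_compose)
  qed (auto simp: q_def)
  \<comment> \<open>the radial retraction to the disc, which is the identity on the disc\<close>
  define \<rho> where "\<rho> w = c + (s / max s (norm (w - c))) *\<^sub>R (w - c)" for w
  have rho_id: "\<rho> w = w" if "w \<in> cball c s" for w
    using that s(1) by (simp add: \<rho>_def dist_norm norm_minus_commute max_absorb1)
  have rho_in: "\<rho> w \<in> cball c s - {c}" if "w \<noteq> c" for w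
  proof -
    have pos: "max s (norm (w - c)) > 0" using s(1) by simp
    have "norm (\<rho> w - c) = s * (norm (w - c) / max s (norm (w - c)))"
      using s(1) by (simp add: \<rho>_def)
    also have "\<dots> \<le> s * 1"
      using s(1) pos by (intro mult_left_mono) auto
    finally have "dist c (\<rho> w) \<le> s" by (simp add: dist_norm norm_minus_commute)
    moreover have "\<rho> w \<noteq> c" using that s(1) pos by (simp add: \<rho>_def)
    ultimately show ?thesis by simp
  qed
  have "homotopic_loops (- {h c}) ((h \<circ> \<rho>) \<circ> p) ((h \<circ> \<rho>) \<circ> q)"
  proof (rule homotopic_loops_continuous_image)
    have "continuous_on (- {c}) \<rho>"
      unfolding \<rho>_def using s(1) by (intro continuous_intros) (auto simp: max_def)
    then show "continuous_on (- {c}) (h \<circ> \<rho>)"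
      by (rule continuous_on_compose) (rule continuous_on_subset[OF conths(1)], use rho_in in blast)
    show "h \<circ> \<rho> \<in> - {c} \<rightarrow> - {h c}"
    proof
      fix w assume "w \<in> - {c}"
      then have "\<rho> w \<in> cball c s" "\<rho> w \<noteq> c" using rho_in by auto
      then have "h (\<rho> w) \<noteq> h c" using conths(2) s(1) by (auto dest: inj_onD)
      then show "(h \<circ> \<rho>) w \<in> - {h c}" by simp
    qed
  qed fact
  then have "winding_number ((h \<circ> \<rho>) \<circ> p) (h c) = winding_number ((h \<circ> \<rho>) \<circ> q) (h c)"
    by (rule winding_number_homotopic_loops)
  moreover have "(h \<circ> \<rho>) \<circ> p = (\<lambda>w. h (g w)) \<circ> circlepath z d"
    using p_in rho_id by (auto simp: p_def fun_eq_iff less_imp_le)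
  moreover have "(h \<circ> \<rho>) \<circ> q = h \<circ> q"
    using q_in rho_id by (auto simp: fun_eq_iff)
  ultimately have "winding_number ((\<lambda>w. h (g w)) \<circ> circlepath z d) (h (g z)) = 1"
    using wq by (simp add: c_def)
  then show ?thesis
  proof (subst or_at_iff_circle[of z d])
    show "continuous_on (cball z d) (\<lambda>w. h (g w))"
      by (rule continuous_on_compose2[OF V(3) contgd(1)]) (use d s in \<open>auto simp: subset_iff\<close>)
    show "inj_on (\<lambda>w. h (g w)) (cball z d)"
    proof (rule inj_onI)
      fix v w assume vw: "v \<in> cball z d" "w \<in> cball z d" "h (g v) = h (g w)"
      have "g v \<in> V" "g w \<in> V" using d s vw by (auto simp: subset_iff)
      then have "g v = g w" using vw V(4) by (auto dest: inj_onD)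
      then show "v = w" using vw contgd(2) by (auto dest: inj_onD)
    qed
  qed (use d in auto)
qed

text \<open>On a small circle the distance of \<open>g\<close> to its linear part is smaller than the distance of the linear
  part to \<open>g z\<close>, so that both loops wind equally often around \<open>g z\<close>.\<close>

lemma or_at_near_linear:
  assumes "open U" "z \<in> U" "continuous_on U g" "inj_on g U" "c \<noteq> 0"
    and near: "\<forall>\<^sub>F w in at z. norm (g w - g z - c * (w - z)) < norm c * norm (w - z)"
  shows "or_at g z"
proof -
  obtain e where e: "e > 0"
    "\<And>w. w \<noteq> z \<Longrightarrow> dist w z < e \<Longrightarrow> norm (g w - g z - c * (w - z)) < norm c * norm (w - z)"
    using near unfolding eventually_at by auto
  obtain d' where d': "d' > 0" "cball z d' \<subseteq> U" using assms open_contains_cball by blast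
  define d where "d = min d' (e/2)"
  have d: "d > 0" "d < e" "cball z d \<subseteq> U" using d' e by (auto simp: d_def)
  define p where "p = g \<circ> circlepath z d"
  define q where "q = (\<lambda>t. g z + c * (circlepath z d t - z))"
  have "winding_number p (g z) = winding_number q (g z)"
  proof (rule winding_number_nearby_loops_eq)
    show "path p" unfolding p_def
      using d(1) continuous_on_subset[OF assms(3) subset_trans[OF sphere_cball d(3)]]
      by (intro path_continuous_image) auto
    have "continuous_on {0..1} (circlepath z d)" using path_circlepath[of z d] by (simp add: path_def)
    then show "path q" unfolding q_def path_def by (intro continuous_intros)
    show "pathfinish p = pathstart p" by (simp add: p_def pathfinish_compose pathstart_compose)
    show "pathfinish q = pathstart q"
      using pathfinish_circlepath[of z d] pathstart_circlepath[of z d]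
      by (simp add: q_def pathfinish_def pathstart_def)
    fix t :: real
    have "dist (circlepath z d t) z = d" using d dist_circlepath by (simp add: dist_commute)
    moreover from this have "circlepath z d t \<noteq> z" using d(1) by auto
    moreover have "p t - q t = g (circlepath z d t) - g z - c * (circlepath z d t - z)"
      "q t - g z = c * (circlepath z d t - z)" by (simp_all add: p_def q_def)
    ultimately show "cmod (p t - q t) < cmod (q t - g z)"
      using e(2)[of "circlepath z d t"] d(1,2) by (simp add: norm_mult)
  qed
  \<comment> \<open>the loop of the linear part is the exponential of a segment of length \<open>2 \<pi>\<close>\<close>
  also have "\<dots> = winding_number (exp \<circ> (\<lambda>t. Ln (c * d) + 2 * pi * \<i> * t)) 0"
    unfolding winding_number_offset[of q]
    using assms(5) d(1) by (intro winding_number_cong) (simp add: q_def circlepath exp_add algebra_simps)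
  also have "\<dots> = 1"
    by (subst winding_number_compose_exp)
       (auto simp: path_def pathfinish_def pathstart_def intro!: continuous_intros)
  finally show ?thesis
    using d assms by (subst or_at_iff_circle[of _ d])
      (auto simp: p_def intro: continuous_on_subset inj_on_subset)
qed

lemma or_at_DERIV:
  assumes "open U" "z \<in> U" "continuous_on U g" "inj_on g U"
    and "(g has_field_derivative c) (at z)" "c \<noteq> 0"
  shows "or_at g z"
proof (rule or_at_near_linear[OF assms(1-4,6)])
  have *: "\<forall>\<^sub>F w in at z. w \<noteq> z" by (rule eventually_neq_at_within)
  have "((\<lambda>w. (g w - g z) / (w - z)) \<longlongrightarrow> c) (at z)"
    using assms(5) by (simp add: has_field_derivative_iff)
  then have "\<forall>\<^sub>F w in at z. dist ((g w - g z) / (w - z)) c < norm c"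
    using assms(6) by (simp add: tendsto_iff)
  then show "\<forall>\<^sub>F w in at z. norm (g w - g z - c * (w - z)) < norm c * norm (w - z)"
    using *
  proof eventually_elim
    case (elim w)
    have "((g w - g z) / (w - z) - c) * (w - z) = (g w - g z) / (w - z) * (w - z) - c * (w - z)"
      by (rule left_diff_distrib)
    then have "g w - g z - c * (w - z) = ((g w - g z) / (w - z) - c) * (w - z)"
      using elim by simp
    then have "norm (g w - g z - c * (w - z)) = dist ((g w - g z) / (w - z)) c * norm (w - z)"
      by (simp add: dist_norm norm_mult)
    then show ?case using elim by (simp add: mult_strict_right_mono)
  qed
qed

section \<open>Planar charts and the projective line\<close>

lemma openin_preimage_subtopology:
  assumes "openin X N" "continuous_map (subtopology X N) Y k" "openin Y V"
  shows "openin X {x \<in> N. k x \<in> V}"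
proof -
  have "topspace (subtopology X N) = N"
    using openin_subset[OF assms(1)] by auto
  then have "openin (subtopology X N) {x \<in> N. k x \<in> V}"
    using openin_continuous_map_preimage[OF assms(2,3)] by simp
  then show ?thesis using assms(1) by (simp add: openin_open_subtopology)
qed

lemma planar_chart_iff:
  "planar_chart X (U, u) \<longleftrightarrow> openin X U \<and> inj_on u U \<and>
     continuous_map (subtopology X U) euclidean u \<and>
     (\<forall>V. openin X V \<and> V \<subseteq> U \<longrightarrow> open (u ` V))" (is "?L \<longleftrightarrow> ?R")
proof
  assume L: ?L
  then have U: "openin X U" "open (u ` U)"
    and h: "homeomorphic_map (subtopology X U) (top_of_set (u ` U)) u"
    by (auto simp: planar_chart_def)
  have top: "topspace (subtopology X U) = U" using openin_subset[OF U(1)] by auto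
  have "open (u ` V)" if "openin X V" "V \<subseteq> U" for V
  proof -
    have "openin (subtopology X U) V" using that U(1) by (simp add: openin_open_subtopology)
    then have "openin (top_of_set (u ` U)) (u ` V)"
      using homeomorphic_map_openness_eq[OF h, of V] by blast
    then show ?thesis using U(2) openin_open_trans by blast
  qed
  moreover have "inj_on u U" using homeomorphic_imp_injective_map[OF h] top by simp
  moreover have "continuous_map (subtopology X U) euclidean u"
    using homeomorphic_imp_continuous_map[OF h] continuous_map_into_fulltopology by blast
  ultimately show ?R using U(1) by blast
next
  assume R: ?R
  have top: "topspace (subtopology X U) = U" using openin_subset R by auto
  have op: "open (u ` U)" using R by blast
  have "homeomorphic_map (subtopology X U) (top_of_set (u ` U)) u"
  proof (rule bijective_open_imp_homeomorphic_map)
    show "continuous_map (subtopology X U) (top_of_set (u ` U)) u"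
      using R top by (auto simp: continuous_map_in_subtopology)
    show "open_map (subtopology X U) (top_of_set (u ` U)) u"
      unfolding open_map_def
    proof (intro allI impI)
      fix V assume "openin (subtopology X U) V"
      then have V: "openin X V" "V \<subseteq> U" using R by (auto simp: openin_open_subtopology)
      then have "open (u ` V)" using R by blast
      moreover have "u ` V \<subseteq> u ` U" using V(2) by blast
      ultimately show "openin (top_of_set (u ` U)) (u ` V)" by (simp add: open_subset)
    qed
    show "u ` topspace (subtopology X U) = topspace (top_of_set (u ` U))" using top by simp
    show "inj_on u (topspace (subtopology X U))" using R top by simp
  qed
  then show ?L using R op by (simp add: planar_chart_def)
qed

lemma planar_chartD:
  assumes "planar_chart X (U, u)"
  shows "openin X U" "inj_on u U" "continuous_map (subtopology X U) euclidean u"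
    "\<And>V. openin X V \<Longrightarrow> V \<subseteq> U \<Longrightarrow> open (u ` V)"
    "open (u ` U)"
  using assms unfolding planar_chart_iff by blast+

lemma planar_chart_restrict:
  assumes "planar_chart X (U, u)" "openin X V" "V \<subseteq> U"
  shows "planar_chart X (V, u)"
  using assms unfolding planar_chart_iff
  by (meson continuous_map_from_subtopology_mono inj_on_subset subset_trans)

lemma oriented_chart_restrict:
  assumes "oriented_chart X \<O> (U, u)" "openin X V" "V \<subseteq> U"
  shows "oriented_chart X \<O> (V, u)"
proof -
  have "d ` (D \<inter> V) \<subseteq> d ` (D \<inter> U)" for D :: "'a set" and d :: "'a \<Rightarrow> complex"
    using assms(3) by blast
  then have "orientation_compatible (D, d) (V, u)" if "orientation_compatible (D, d) (U, u)"
    for D :: "'a set" and d :: "'a \<Rightarrow> complex"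
    using that by (simp add: orientation_compatible_def orientation_preserving_on_def)
      (meson subset_trans)
  then show ?thesis using assms planar_chart_restrict
    unfolding oriented_chart_def by fast
qed

text \<open>A continuous injective map between surfaces, read in planar charts, is a continuous injective
  map on an open subset of the plane.\<close>

lemma in_charts:
  assumes "planar_chart X (U, u)" "planar_chart Y (W, w)" "openin X N"
    "continuous_map (subtopology X N) Y k" "inj_on k N"
  defines "D \<equiv> u ` {p \<in> U \<inter> N. k p \<in> W}"
  shows "open D" "continuous_on D (\<lambda>z. w (k (inv_into U u z)))"
    "inj_on (\<lambda>z. w (k (inv_into U u z))) D"
proof -
  note u = planar_chartD[OF assms(1)] and w = planar_chartD[OF assms(2)]
  have NW: "openin X {p \<in> N. k p \<in> W}"
    by (rule openin_preimage_subtopology[OF assms(3,4) w(1)])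
  have "{p \<in> U \<inter> N. k p \<in> W} = U \<inter> {p \<in> N. k p \<in> W}" by blast
  then have op: "openin X {p \<in> U \<inter> N. k p \<in> W}" using openin_Int[OF u(1) NW] by simp
  then show "open D" unfolding D_def by (rule u(4)) blast
  have inv: "inv_into U u (u p) = p" if "p \<in> U" for p using that u(2) by simp
  show "inj_on (\<lambda>z. w (k (inv_into U u z))) D"
    using w(2) assms(5) inv unfolding D_def inj_on_def by (smt (verit) IntE image_iff mem_Collect_eq)
  show "continuous_on D (\<lambda>z. w (k (inv_into U u z)))"
    unfolding continuous_on_open_vimage[OF \<open>open D\<close>]
  proof (intro allI impI)
    fix B :: "complex set" assume "open B"
    have 1: "openin Y {q \<in> W. w q \<in> B}"
      by (rule openin_preimage_subtopology[OF w(1,3)]) (use \<open>open B\<close> in simp)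
    have 2: "openin X {p \<in> N. k p \<in> {q \<in> W. w q \<in> B}}"
      by (rule openin_preimage_subtopology[OF assms(3,4) 1])
    have "open (u ` (U \<inter> {p \<in> N. k p \<in> {q \<in> W. w q \<in> B}}))"
      by (rule u(4)) (use openin_Int[OF u(1) 2] in auto)
    moreover have "(\<lambda>z. w (k (inv_into U u z))) -` B \<inter> D = u ` (U \<inter> {p \<in> N. k p \<in> {q \<in> W. w q \<in> B}})"
      using inv by (auto simp: D_def)
    ultimately show "open ((\<lambda>z. w (k (inv_into U u z))) -` B \<inter> D)" by simp
  qed
qed

lemma or_at_compose_charts:
  assumes "planar_chart X (U, u)" "planar_chart Y (W, w)" "planar_chart Z (V, v)"
    and k: "openin X N" "continuous_map (subtopology X N) Y k" "inj_on k N"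
    and l: "openin Y M" "continuous_map (subtopology Y M) Z l" "inj_on l M"
    and p: "p \<in> U" "p \<in> N" "k p \<in> W" "k p \<in> M" "l (k p) \<in> V"
    and or: "or_at (\<lambda>z. w (k (inv_into U u z))) (u p)" "or_at (\<lambda>z. v (l (inv_into W w z))) (w (k p))"
  shows "or_at (\<lambda>z. v (l (k (inv_into U u z)))) (u p)"
proof -
  note u = planar_chartD[OF assms(1)] and w = planar_chartD[OF assms(2)]
  define N' where "N' = {x \<in> N. k x \<in> {y \<in> M. l y \<in> V}}"
  have N': "openin X N'" unfolding N'_def
    by (rule openin_preimage_subtopology[OF k(1,2)])
       (rule openin_preimage_subtopology[OF l(1,2) planar_chartD(1)[OF assms(3)]])
  have k': "continuous_map (subtopology X N') Y k" "inj_on k N'"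
    using k by (auto simp: N'_def inj_on_def intro: continuous_map_from_subtopology_mono)
  note c = in_charts[OF assms(1,2) N' k'] and d = in_charts[OF assms(2,3) l]
  have inv: "inv_into U u (u p) = p" "inv_into W w (w q) = q" if "p \<in> U" "q \<in> W" for p q
    using that u(2) w(2) by auto
  define D where "D = u ` {p \<in> U \<inter> N'. k p \<in> W}"
  have upD: "u p \<in> D" using p by (auto simp: D_def N'_def)
  have "or_at (\<lambda>z. v (l (inv_into W w (w (k (inv_into U u z)))))) (u p)"
  proof (rule or_at_compose[OF c(1) _ c(2,3) d(1) _ d(2,3)])
    show "u p \<in> u ` {p \<in> U \<inter> N'. k p \<in> W}" using upD by (simp add: D_def)
    show "w (k (inv_into U u (u p))) \<in> w ` {q \<in> W \<inter> M. l q \<in> V}"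
      using p inv by auto
  qed (use or p inv in auto)
  moreover have "\<forall>\<^sub>F z in nhds (u p). v (l (inv_into W w (w (k (inv_into U u z))))) = v (l (k (inv_into U u z)))"
    using eventually_nhds_in_open[OF c(1)[folded D_def] upD]
    by eventually_elim (use inv in \<open>auto simp: D_def\<close>)
  ultimately show ?thesis by (simp add: or_at_cong)
qed

lemma orientation_compatible_iff:
  assumes "planar_chart X (U, u)" "planar_chart X (V, v)"
  shows "orientation_compatible (U, u) (V, v) \<longleftrightarrow>
    (\<forall>p\<in>U \<inter> V. or_at (\<lambda>z. v (inv_into U u z)) (u p))"
proof -
  have "inj_on (\<lambda>x. x) (topspace X)" "continuous_map (subtopology X (topspace X)) X (\<lambda>x. x)"
    by (auto simp: inj_on_def)
  from in_charts[OF assms openin_topspace this(2,1)]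
  have "open (u ` {p \<in> U \<inter> topspace X. p \<in> V})"
    "continuous_on (u ` {p \<in> U \<inter> topspace X. p \<in> V}) (\<lambda>z. v (inv_into U u z))"
    "inj_on (\<lambda>z. v (inv_into U u z)) (u ` {p \<in> U \<inter> topspace X. p \<in> V})" by auto
  moreover have "{p \<in> U \<inter> topspace X. p \<in> V} = U \<inter> V"
    using openin_subset[OF planar_chartD(1)[OF assms(1)]] by auto
  ultimately show ?thesis
    unfolding orientation_compatible_def o_def
    by (simp add: orientation_preserving_on_iff)
qed

subsection \<open>The affine charts of the projective line\<close>

text \<open>The two affine charts of the projective line are indexed by \<open>bool\<close>: the index is true if the first
  homogeneous coordinate is normalised to 1.\<close>

definition affvec :: "bool \<Rightarrow> complex \<Rightarrow> complex^2" where
  "affvec b z = (if b then vector [1, z] else vector [z, 1])"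

definition affline :: "bool \<Rightarrow> complex \<Rightarrow> (complex^2) set" where
  "affline b z = vec.span {affvec b z}"

definition affdom :: "bool \<Rightarrow> (complex^2) set set" where
  "affdom b = {L \<in> topspace CP1. \<exists>z. affvec b z \<in> L}"

definition affcoord :: "bool \<Rightarrow> (complex^2) set \<Rightarrow> complex" where
  "affcoord b = (\<lambda>L. THE z. affvec b z \<in> L)"

lemma CP1_orientation_aff: "CP1_orientation = (\<lambda>b. (affdom b, affcoord b)) ` UNIV"
  by (auto simp: CP1_orientation_def affdom_def affcoord_def affvec_def UNIV_bool)

lemma affvec_nonzero [simp]: "affvec b z \<noteq> 0"
  by (auto simp: affvec_def vec_eq_iff forall_2)

definition slope :: "bool \<Rightarrow> complex^2 \<Rightarrow> complex" where
  "slope b v = (if b then v$2 / v$1 else v$1 / v$2)"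

definition denom :: "bool \<Rightarrow> complex^2 \<Rightarrow> complex" where
  "denom b v = (if b then v$1 else v$2)"

lemma denom_slope: "denom b v \<noteq> 0 \<Longrightarrow> v = denom b v *s affvec b (slope b v)"
  by (cases b) (auto simp: denom_def slope_def affvec_def vec_eq_iff forall_2)

lemma denom_affvec [simp]: "denom b (affvec b z) = 1"
  and slope_affvec [simp]: "slope b (affvec b z) = z"
  by (auto simp: denom_def slope_def affvec_def)

lemma span_eq_affline: "denom b v \<noteq> 0 \<Longrightarrow> vec.span {v} = affline b (slope b v)"
  unfolding affline_def by (rule line_eqI[OF denom_slope])

lemma affvec_mem_span: "affvec b z \<in> vec.span {v} \<longleftrightarrow> denom b v \<noteq> 0 \<and> z = slope b v"
proof
  assume "affvec b z \<in> vec.span {v}"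
  then obtain c where c: "affvec b z = c *s v" by (auto simp: mem_line)
  have "denom b (c *s v) = c * denom b v" by (simp add: denom_def)
  then have "c * denom b v = 1" using c denom_affvec[of b z] by simp
  moreover from this have "c \<noteq> 0" by auto
  moreover have "z = slope b (c *s v)" using c slope_affvec by metis
  ultimately show "denom b v \<noteq> 0 \<and> z = slope b v"
    by (auto simp: slope_def split: if_splits)
next
  assume *: "denom b v \<noteq> 0 \<and> z = slope b v"
  then have "affvec b z = inverse (denom b v) *s v"
    using denom_slope[of b v] by (metis left_inverse vector_smult_assoc vector_smult_lid)
  then show "affvec b z \<in> vec.span {v}" unfolding mem_line by blast
qed

lemma span_in_affdom: "v \<noteq> 0 \<Longrightarrow> vec.span {v} \<in> affdom b \<longleftrightarrow> denom b v \<noteq> 0"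
  by (auto simp: affdom_def affvec_mem_span)

lemma denom_nonzeroD: "denom b v \<noteq> 0 \<Longrightarrow> v \<noteq> 0"
  by (auto simp: denom_def split: if_splits)

lemma affcoord_span: "denom b v \<noteq> 0 \<Longrightarrow> affcoord b (vec.span {v}) = slope b v"
  by (simp add: affcoord_def affvec_mem_span)

lemma affcoord_affline [simp]: "affcoord b (affline b z) = z"
  by (simp add: affline_def affcoord_span)

lemma affline_in_affdom [simp]: "affline b z \<in> affdom b"
  by (simp add: affline_def span_in_affdom)

lemma affdom_subset: "affdom b \<subseteq> topspace CP1"
  by (auto simp: affdom_def)

lemma affline_in_CP1 [simp]: "affline b z \<in> topspace CP1"
  using affdom_subset affline_in_affdom by blast

lemma affline_affcoord [simp]:
  assumes "L \<in> affdom b" shows "affline b (affcoord b L) = L"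
proof -
  obtain v where "v \<noteq> 0" "L = vec.span {v}" using assms affdom_subset by (blast elim: CP1_E)
  then show ?thesis using assms by (simp add: span_in_affdom affcoord_span span_eq_affline)
qed

lemma CP1_affdom: "L \<in> topspace CP1 \<Longrightarrow> \<exists>b. L \<in> affdom b"
proof -
  assume "L \<in> topspace CP1"
  then obtain v where v: "v \<noteq> 0" "L = vec.span {v}" by (rule CP1_E)
  then have "denom True v \<noteq> 0 \<or> denom False v \<noteq> 0"
    by (auto simp: denom_def vec_eq_iff forall_2)
  then show ?thesis using v span_in_affdom by blast
qed

lemma inv_into_affcoord: "inv_into (affdom b) (affcoord b) z = affline b z"
proof -
  have "inj_on (affcoord b) (affdom b)" by (metis affline_affcoord inj_onI)
  then have "inv_into (affdom b) (affcoord b) (affcoord b (affline b z)) = affline b z"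
    by (rule inv_into_f_f) simp
  then show ?thesis by simp
qed

lemma openin_CP1: "openin CP1 U \<longleftrightarrow> U \<subseteq> topspace CP1 \<and> open {v. v \<noteq> 0 \<and> vec.span {v} \<in> U}"
proof -
  have "open (- {0} :: (complex^2) set)" by (rule open_Compl[OF closed_singleton])
  moreover have "{x \<in> - {0}. vec.span {x} \<in> U} = {v. v \<noteq> 0 \<and> vec.span {v} \<in> U}" by auto
  ultimately show ?thesis
    unfolding CP1_def openin_quotient_topology topspace_CP1[symmetric, unfolded CP1_def]
    by (auto simp: openin_open_eq)
qed

lemma continuous_denom: "continuous_on UNIV (denom b)"
  unfolding denom_def by (cases b) (auto intro!: continuous_intros)

lemma continuous_slope: "continuous_on {v. denom b v \<noteq> 0} (slope b)"
  unfolding denom_def slope_def by (cases b) (auto intro!: continuous_intros)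

lemma open_denom: "open {v. denom b v \<noteq> 0}"
  using open_Collect_neq[OF continuous_denom continuous_on_const, of b 0] by simp

lemma planar_chart_aff: "planar_chart CP1 (affdom b, affcoord b)"
  unfolding planar_chart_iff
proof (intro conjI allI impI)
  have "{v. v \<noteq> 0 \<and> vec.span {v} \<in> affdom b} = {v. denom b v \<noteq> 0}"
    using span_in_affdom denom_nonzeroD by blast
  then show op: "openin CP1 (affdom b)"
    by (simp add: openin_CP1 affdom_subset open_denom)
  show "inj_on (affcoord b) (affdom b)" by (metis affline_affcoord inj_onI)
  have "openin CP1 {L \<in> affdom b. affcoord b L \<in> B}" if "open B" for B
  proof -
    have "{v. v \<noteq> 0 \<and> vec.span {v} \<in> {L \<in> affdom b. affcoord b L \<in> B}} = slope b -` B \<inter> {v. denom b v \<noteq> 0}"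
      using span_in_affdom denom_nonzeroD by (auto simp: affcoord_span)
    moreover have "open (slope b -` B \<inter> {v. denom b v \<noteq> 0})"
      using continuous_slope[of b] that unfolding continuous_on_open_vimage[OF open_denom] by blast
    ultimately show ?thesis using affdom_subset by (auto simp: openin_CP1)
  qed
  then show "continuous_map (subtopology CP1 (affdom b)) euclidean (affcoord b)"
    using op affdom_subset by (auto simp: continuous_map_def openin_open_subtopology Int_absorb1)
  fix V assume V: "openin CP1 V \<and> V \<subseteq> affdom b"
  have "affcoord b ` V = affvec b -` {v. v \<noteq> 0 \<and> vec.span {v} \<in> V}"
  proof (intro subset_antisym subsetI)
    fix z assume "z \<in> affcoord b ` V"
    then obtain L where L: "L \<in> V" "z = affcoord b L" by blast
    then have "affline b z = L" using V by auto
    then show "z \<in> affvec b -` {v. v \<noteq> 0 \<and> vec.span {v} \<in> V}" using L by (simp add: affline_def)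
  next
    fix z assume "z \<in> affvec b -` {v. v \<noteq> 0 \<and> vec.span {v} \<in> V}"
    then have "affline b z \<in> V" by (simp add: affline_def)
    then show "z \<in> affcoord b ` V" by (metis affcoord_affline imageI)
  qed
  moreover have "continuous_on UNIV (affvec b)"
  proof -
    have "affvec b = (\<lambda>z. \<chi> i. if (i = 1) = b then 1 else z)"
      by (auto simp: fun_eq_iff vec_eq_iff forall_2 affvec_def)
    moreover have "continuous_on UNIV (\<lambda>z. if (i = 1) = b then 1 else z :: complex)" for i :: 2
      by (cases "(i = 1) = b") (auto intro!: continuous_intros)
    ultimately show ?thesis by (simp add: continuous_on_vec_lambda)
  qed
  ultimately show "open (affcoord b ` V)"
    using V by (simp only: openin_CP1) (rule open_vimage, auto)
qed

subsection \<open>Orientation-preserving maps of the projective line\<close>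

text \<open>The degree does not depend on the affine charts, whose transition maps are holomorphic.\<close>

definition CP1_or_at :: "((complex^2) set \<Rightarrow> (complex^2) set) \<Rightarrow> (complex^2) set \<Rightarrow> bool" where
  "CP1_or_at k L \<longleftrightarrow> (\<exists>a b. L \<in> affdom a \<and> k L \<in> affdom b \<and>
     or_at (\<lambda>z. affcoord b (k (affline a z))) (affcoord a L))"

text \<open>Orientation-preserving homeomorphisms between open parts of the projective line. The inverse is a
  parameter, which makes the notion symmetric.\<close>

definition or_iso :: "(complex^2) set set \<Rightarrow> (complex^2) set set \<Rightarrow>
    ((complex^2) set \<Rightarrow> (complex^2) set) \<Rightarrow> ((complex^2) set \<Rightarrow> (complex^2) set) \<Rightarrow> bool" where
  "or_iso N N' k k' \<longleftrightarrow> openin CP1 N \<and> openin CP1 N' \<and>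
     homeomorphic_maps (subtopology CP1 N) (subtopology CP1 N') k k' \<and>
     (\<forall>L\<in>N. CP1_or_at k L) \<and> (\<forall>L\<in>N'. CP1_or_at k' L)"

lemma or_iso_sym: "or_iso N N' k k' \<Longrightarrow> or_iso N' N k' k"
  unfolding or_iso_def using homeomorphic_maps_sym by blast

lemma or_isoD:
  assumes "or_iso N N' k k'"
  shows "openin CP1 N" "openin CP1 N'"
    "continuous_map (subtopology CP1 N) CP1 k" "continuous_map (subtopology CP1 N') CP1 k'"
    "\<And>L. L \<in> N \<Longrightarrow> k L \<in> N'" "\<And>L. L \<in> N' \<Longrightarrow> k' L \<in> N"
    "\<And>L. L \<in> N \<Longrightarrow> k' (k L) = L" "\<And>L. L \<in> N' \<Longrightarrow> k (k' L) = L"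
    "inj_on k N" "inj_on k' N'"
proof -
  note * = assms[unfolded or_iso_def homeomorphic_maps_def continuous_map_in_subtopology]
  show o: "openin CP1 N" "openin CP1 N'" using * by blast+
  then have t: "topspace (subtopology CP1 N) = N" "topspace (subtopology CP1 N') = N'"
    using openin_subset[of CP1] by auto
  show "continuous_map (subtopology CP1 N) CP1 k" "continuous_map (subtopology CP1 N') CP1 k'"
    using * by blast+
  show "\<And>L. L \<in> N \<Longrightarrow> k L \<in> N'" "\<And>L. L \<in> N' \<Longrightarrow> k' L \<in> N"
    and 1: "\<And>L. L \<in> N \<Longrightarrow> k' (k L) = L" and 2: "\<And>L. L \<in> N' \<Longrightarrow> k (k' L) = L"
    using * t by auto
  show "inj_on k N" "inj_on k' N'" using 1 2 by (metis inj_onI)+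
qed

lemma continuous_map_PSL2_act:
  assumes "M \<in> carrier PSL2"
  shows "continuous_map CP1 CP1 (PSL2_act M)"
proof -
  obtain A where A: "det A = 1" "M = pm A" using assms by (rule PSL2_E)
  have q: "quotient_map (top_of_set (- {0})) CP1 (\<lambda>v. vec.span {v})"
    unfolding CP1_def by (rule quotient_map_quotient_topology)
  have "continuous_on UNIV (\<lambda>v. A *v v)"
    unfolding matrix_vector_mult_def by (intro continuous_intros continuous_on_vec_lambda)
  then have "continuous_map (top_of_set (- {0})) (top_of_set (- {0})) (\<lambda>v. A *v v)"
    using A(1) by (auto simp: det_1_mult_nonzero intro: continuous_on_subset)
  then have "continuous_map (top_of_set (- {0})) CP1 ((\<lambda>v. vec.span {v}) \<circ> (\<lambda>v. A *v v))"
    by (rule continuous_map_compose) (rule quotient_imp_continuous_map[OF q])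
  then show ?thesis
    by (intro continuous_compose_quotient_map[OF q]) (simp add: o_def A(2) PSL2_act_pm)
qed

lemma DERIV_moebius:
  fixes p q r s z :: complex
  assumes "r * z + s \<noteq> 0"
  shows "((\<lambda>z. (p * z + q) / (r * z + s)) has_field_derivative (p * s - q * r) / (r * z + s)\<^sup>2) (at z)"
proof -
  have "((\<lambda>z. p * z + q) has_field_derivative p) (at z)" "((\<lambda>z. r * z + s) has_field_derivative r) (at z)"
    by (auto intro!: derivative_eq_intros)
  from DERIV_divide[OF this assms]
  have "((\<lambda>z. (p * z + q) / (r * z + s)) has_field_derivative
      (p * (r * z + s) - (p * z + q) * r) / ((r * z + s) * (r * z + s))) (at z)" .
  moreover have "p * (r * z + s) - (p * z + q) * r = p * s - q * r" by (simp add: algebra_simps)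
  ultimately show ?thesis by (simp add: power2_eq_square)
qed

text \<open>A change of affine chart permutes the homogeneous coordinates, hence the rows or columns of the
  matrix; the determinant of the coefficients changes at most by a sign.\<close>

lemma PSL2_act_affine_form:
  assumes "M \<in> carrier PSL2"
  obtains p q r s where "p * s - q * r \<noteq> 0"
    "\<And>z. PSL2_act M (affline a z) \<in> affdom b \<longleftrightarrow> r * z + s \<noteq> 0"
    "\<And>z. r * z + s \<noteq> 0 \<Longrightarrow> affcoord b (PSL2_act M (affline a z)) = (p * z + q) / (r * z + s)"
proof -
  obtain A where A: "det A = 1" "M = pm A" using assms by (rule PSL2_E)
  have dA: "A$1$1 * A$2$2 - A$1$2 * A$2$1 = 1" using A(1) by (simp add: det_2)
  define w where "w = (\<lambda>z. A *v affvec a z)"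
  have act: "PSL2_act M (affline a z) = vec.span {w z}" "w z \<noteq> 0" for z
    by (simp_all add: A(2) affline_def PSL2_act_pm w_def det_1_mult_nonzero[OF A(1)])
  have w: "w z $ 1 = (if a then A$1$1 + A$1$2 * z else A$1$1 * z + A$1$2)"
    "w z $ 2 = (if a then A$2$1 + A$2$2 * z else A$2$1 * z + A$2$2)" for z
    by (simp_all add: w_def affvec_def matrix_vector_mult_def sum_2)
  have "\<exists>p q r s. (\<forall>z. slope b (w z) = (p * z + q) / (r * z + s) \<and> denom b (w z) = r * z + s) \<and>
      p * s - q * r \<noteq> 0"
  proof (cases a; cases b)
    assume "a" "b"
    then show ?thesis using dA
      by (intro exI[of _ "A$2$2"] exI[of _ "A$2$1"] exI[of _ "A$1$2"] exI[of _ "A$1$1"])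
        (simp add: slope_def denom_def w algebra_simps)
  next
    assume "a" "\<not> b"
    then show ?thesis using dA
      by (intro exI[of _ "A$1$2"] exI[of _ "A$1$1"] exI[of _ "A$2$2"] exI[of _ "A$2$1"])
        (simp add: slope_def denom_def w algebra_simps)
  next
    assume "\<not> a" "b"
    then show ?thesis using dA
      by (intro exI[of _ "A$2$1"] exI[of _ "A$2$2"] exI[of _ "A$1$1"] exI[of _ "A$1$2"])
        (simp add: slope_def denom_def w algebra_simps)
  next
    assume "\<not> a" "\<not> b"
    then show ?thesis using dA
      by (intro exI[of _ "A$1$1"] exI[of _ "A$1$2"] exI[of _ "A$2$1"] exI[of _ "A$2$2"])
        (simp add: slope_def denom_def w algebra_simps)
  qed
  then obtain p q r s where pqrs: "\<And>z. slope b (w z) = (p * z + q) / (r * z + s)"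
      "\<And>z. denom b (w z) = r * z + s" "p * s - q * r \<noteq> 0" by blast
  show ?thesis
    by (rule that[OF pqrs(3)]) (use act pqrs in \<open>simp_all add: span_in_affdom affcoord_span\<close>)
qed

lemma or_at_PSL2_act:
  assumes M: "M \<in> carrier PSL2" and L: "L \<in> affdom a" "PSL2_act M L \<in> affdom b"
  shows "or_at (\<lambda>z. affcoord b (PSL2_act M (affline a z))) (affcoord a L)"
proof -
  define z0 where "z0 = affcoord a L"
  have L_eq: "L = affline a z0" using L by (simp add: z0_def)
  have inj: "inj_on (PSL2_act M) (topspace CP1)"
    using PSL2_act_inv(1)[OF M] by (metis inj_onI)
  have "continuous_map (subtopology CP1 (topspace CP1)) CP1 (PSL2_act M)"
    using continuous_map_PSL2_act[OF M] by simp
  note ch = in_charts[OF planar_chart_aff[of a] planar_chart_aff[of b] openin_topspace this inj,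
      unfolded inv_into_affcoord]
  let ?D = "affcoord a ` {p \<in> affdom a \<inter> topspace CP1. PSL2_act M p \<in> affdom b}"
  have z0D: "z0 \<in> ?D" using L affdom_subset by (auto simp: z0_def)
  obtain p q r s where pqrs: "p * s - q * r \<noteq> 0"
    "\<And>z. PSL2_act M (affline a z) \<in> affdom b \<longleftrightarrow> r * z + s \<noteq> 0"
    "\<And>z. r * z + s \<noteq> 0 \<Longrightarrow> affcoord b (PSL2_act M (affline a z)) = (p * z + q) / (r * z + s)"
    by (rule PSL2_act_affine_form[OF M, of a b]) blast
  have D: "r * z + s \<noteq> 0" if "z \<in> ?D" for z using that by (auto simp flip: pqrs(2))
  have "((\<lambda>z. (p * z + q) / (r * z + s)) has_field_derivative (p * s - q * r) / (r * z0 + s)\<^sup>2) (at z0)"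
    by (rule DERIV_moebius[OF D[OF z0D]])
  then have "((\<lambda>z. affcoord b (PSL2_act M (affline a z))) has_field_derivative
      (p * s - q * r) / (r * z0 + s)\<^sup>2) (at z0)"
    by (rule has_field_derivative_transform_within_open[OF _ ch(1) z0D]) (use pqrs(3) D in auto)
  then show ?thesis
    unfolding z0_def[symmetric]
    by (rule or_at_DERIV[OF ch(1) z0D ch(2,3)]) (use pqrs(1) D[OF z0D] in simp)
qed

lemma CP1_or_at_PSL2_act:
  assumes "M \<in> carrier PSL2" "L \<in> topspace CP1"
  shows "CP1_or_at (PSL2_act M) L"
  unfolding CP1_or_at_def
  using or_at_PSL2_act[OF assms(1)] CP1_affdom[OF assms(2)] CP1_affdom[OF PSL2_act_closed[OF assms]]
  by blast

lemma or_iso_PSL2_act: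
  assumes "M \<in> carrier PSL2"
  shows "or_iso (topspace CP1) (topspace CP1) (PSL2_act M) (PSL2_act (inv\<^bsub>PSL2\<^esub> M))"
  using assms
  by (auto simp: or_iso_def homeomorphic_maps_def continuous_map_PSL2_act CP1_or_at_PSL2_act)

lemma or_at_aff_transition:
  assumes "L \<in> affdom a" "L \<in> affdom b"
  shows "or_at (\<lambda>z. affcoord b (affline a z)) (affcoord a L)"
proof -
  have "L \<in> topspace CP1" using assms affdom_subset by blast
  then show ?thesis
    using or_at_PSL2_act[of "pm (mat 1)" L a b] assms by simp
qed

text \<open>By multiplicativity of the degree, precomposition with an orientation-preserving homeomorphism keeps
  a coordinate oriented.\<close>

lemma oriented_chart_or_iso:
  assumes k: "or_iso N N' k k'" and y: "oriented_chart CP1 CP1_orientation (Y, y)"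
  shows "oriented_chart CP1 CP1_orientation ({L \<in> N. k L \<in> Y}, \<lambda>L. y (k L))"
proof -
  note kD = or_isoD[OF k]
  have pY: "planar_chart CP1 (Y, y)" using y by (simp add: oriented_chart_def)
  note yD = planar_chartD[OF pY]
  define Y' where "Y' = {L \<in> N. k L \<in> Y}"
  have op: "openin CP1 Y'" unfolding Y'_def
    by (rule openin_preimage_subtopology[OF kD(1,3) yD(1)])
  have pl: "planar_chart CP1 (Y', \<lambda>L. y (k L))"
    unfolding planar_chart_iff
  proof (intro conjI allI impI op)
    show "inj_on (\<lambda>L. y (k L)) Y'"
    proof (rule inj_onI)
      fix L L' assume *: "L \<in> Y'" "L' \<in> Y'" "y (k L) = y (k L')"
      then have "k L = k L'" using inj_onD[OF yD(2)] by (simp add: Y'_def)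
      then show "L = L'" using inj_onD[OF kD(9)] * by (simp add: Y'_def)
    qed
    have "continuous_map (subtopology CP1 Y') (subtopology CP1 Y) k"
      using kD(3) by (auto simp: continuous_map_in_subtopology Y'_def
          intro: continuous_map_from_subtopology_mono)
    then have "continuous_map (subtopology CP1 Y') euclidean (y \<circ> k)"
      using yD(3) by (rule continuous_map_compose)
    then show "continuous_map (subtopology CP1 Y') euclidean (\<lambda>L. y (k L))" by (simp add: o_def)
    fix V assume V: "openin CP1 V \<and> V \<subseteq> Y'"
    have "k ` V = {L \<in> N'. k' L \<in> V}"
      using V kD(5-8) unfolding Y'_def by (auto simp: image_iff) metis
    moreover have "openin CP1 {L \<in> N'. k' L \<in> V}"
      using openin_preimage_subtopology[OF kD(2,4)] V by blast
    moreover have "k ` V \<subseteq> Y" using V by (auto simp: Y'_def)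
    ultimately have "open (y ` (k ` V))"
      by (intro yD(4)) simp_all
    then show "open ((\<lambda>L. y (k L)) ` V)" by (simp add: image_image)
  qed
  have id: "continuous_map (subtopology CP1 (topspace CP1)) CP1 (\<lambda>L. L)" "inj_on (\<lambda>L. L) (topspace CP1)"
    by (auto simp: inj_on_def)
  have "orientation_compatible (affdom a, affcoord a) (Y', \<lambda>L. y (k L))" for a
    unfolding orientation_compatible_iff[OF planar_chart_aff pl] inv_into_affcoord
  proof
    fix L assume L: "L \<in> affdom a \<inter> Y'"
    then have La: "L \<in> affdom a" and "L \<in> N" "k L \<in> Y" and top: "L \<in> topspace CP1" "k L \<in> topspace CP1"
      using affdom_subset openin_subset[OF yD(1)] by (auto simp: Y'_def)
    then obtain a' b' where ab: "L \<in> affdom a'" "k L \<in> affdom b'"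
      "or_at (\<lambda>z. affcoord b' (k (affline a' z))) (affcoord a' L)"
      using k by (auto simp: or_iso_def CP1_or_at_def)
    have 1: "or_at (\<lambda>z. affcoord b' (k (affline a z))) (affcoord a L)"
      by (rule or_at_compose_charts[OF planar_chart_aff[of a] planar_chart_aff[of a'] planar_chart_aff[of b']
          openin_topspace id kD(1,3,9), of L, unfolded inv_into_affcoord,
          OF La top(1) ab(1) \<open>L \<in> N\<close> ab(2) or_at_aff_transition[OF La ab(1)] ab(3)])
    have "orientation_compatible (affdom b', affcoord b') (Y, y)"
      using y by (auto simp: oriented_chart_def CP1_orientation_aff)
    then have "or_at (\<lambda>z. y (affline b' z)) (affcoord b' (k L))"
      unfolding orientation_compatible_iff[OF planar_chart_aff pY] inv_into_affcoord
      using ab \<open>k L \<in> Y\<close> by blast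
    then show "or_at (\<lambda>z. y (k (affline a z))) (affcoord a L)"
      by (rule or_at_compose_charts[OF planar_chart_aff[of a] planar_chart_aff[of b'] pY kD(1,3,9)
          openin_topspace id, of L, unfolded inv_into_affcoord,
          OF La \<open>L \<in> N\<close> ab(2) top(2) \<open>k L \<in> Y\<close> 1])
  qed
  then show ?thesis
    using pl by (auto simp: oriented_chart_def CP1_orientation_aff Y'_def)
qed

lemma openin_affline_image: "open B \<Longrightarrow> openin CP1 (affline b ` B)"
proof -
  assume "open B"
  have "affline b ` B = {L \<in> affdom b. affcoord b L \<in> B}"
    by (auto simp: image_iff) (metis affline_affcoord)
  then show ?thesis
    using openin_preimage_subtopology[OF planar_chartD(1,3)[OF planar_chart_aff]] \<open>open B\<close> by simp
qed

lemma continuous_map_affline: "continuous_map euclidean CP1 (affline b)"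
proof -
  have "open {z. affline b z \<in> V}" if V: "openin CP1 V" for V
  proof -
    have "{z. affline b z \<in> V} = affcoord b ` (V \<inter> affdom b)"
      by (auto simp: image_iff) (metis affcoord_affline affline_in_affdom IntI)
    then show ?thesis
      using planar_chartD(4)[OF planar_chart_aff, of "V \<inter> affdom b"] V
        planar_chartD(1)[OF planar_chart_aff, of b] by (simp add: openin_Int)
  qed
  then show ?thesis by (auto simp: continuous_map_def)
qed

lemma or_at_near_id:
  assumes "open B" "z \<in> B" "continuous_on B g" "inj_on g B"
    and near: "\<And>w. w \<in> B \<Longrightarrow> norm (g w - g z - (w - z)) \<le> norm (w - z) / 2"
  shows "or_at g z"
proof (rule or_at_near_linear[OF assms(1-4)])
  have "norm (g w - g z - 1 * (w - z)) < norm (1::complex) * norm (w - z)" if "w \<in> B" "w \<noteq> z" for w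
  proof -
    have "norm (w - z) > 0" using that(2) by simp
    then have "norm (w - z) / 2 < norm (w - z)" by linarith
    moreover have "norm (g w - g z - 1 * (w - z)) \<le> norm (w - z) / 2"
      using near[OF that(1)] by simp
    ultimately show ?thesis by (metis le_less_trans mult_1 norm_one)
  qed
  then show "\<forall>\<^sub>F w in at z. norm (g w - g z - 1 * (w - z)) < norm (1::complex) * norm (w - z)"
    unfolding eventually_at_topological using assms(1,2) by blast
qed simp

text \<open>A perturbation of the identity that is Lipschitz with a small constant is an
  orientation-preserving embedding, and so is its inverse. This stability of local homeomorphisms
  needs Lipschitz bounds; uniform closeness to the identity would not suffice.\<close>

lemma or_iso_near_identity:
  fixes \<kappa> :: "complex \<Rightarrow> complex" and b :: bool
  assumes r: "r > 0"
    and near: "\<And>z w. z \<in> ball c r \<Longrightarrow> w \<in> ball c r \<Longrightarrow>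
      norm (\<kappa> z - \<kappa> w - (z - w)) \<le> norm (z - w) / 3"
  defines "k \<equiv> \<lambda>L. affline b (\<kappa> (affcoord b L))"
    and "k' \<equiv> \<lambda>L. affline b (inv_into (ball c r) \<kappa> (affcoord b L))"
  shows "or_iso (affline b ` ball c r) (affline b ` \<kappa> ` ball c r) k k'"
proof -
  let ?B = "ball c r"
  define \<kappa>' where "\<kappa>' = inv_into ?B \<kappa>"
  have lower: "norm (z - w) \<le> 3/2 * norm (\<kappa> z - \<kappa> w)" if "z \<in> ?B" "w \<in> ?B" for z w
    using near[OF that] norm_triangle_ineq2[of "z - w" "z - w - (\<kappa> z - \<kappa> w)"]
    by (simp add: norm_minus_commute)
  have inj: "inj_on \<kappa> ?B"
  proof (rule inj_onI)
    fix z w assume "z \<in> ?B" "w \<in> ?B" "\<kappa> z = \<kappa> w"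
    then show "z = w" using lower[of z w] by simp
  qed
  have "norm (\<kappa> z - \<kappa> w) \<le> 4/3 * norm (z - w)" if "z \<in> ?B" "w \<in> ?B" for z w
    using near[OF that] norm_triangle_ineq[of "\<kappa> z - \<kappa> w - (z - w)" "z - w"] by simp
  then have "(4/3)-lipschitz_on ?B \<kappa>" by (intro lipschitz_onI) (auto simp: dist_norm)
  then have cont: "continuous_on ?B \<kappa>" by (rule lipschitz_on_continuous_on)
  have op: "open (\<kappa> ` ?B)" by (rule invariance_of_domain[OF cont _ inj]) simp
  have k'\<kappa>: "\<kappa>' (\<kappa> z) = z" if "z \<in> ?B" for z using inj that by (simp add: \<kappa>'_def)
  \<comment> \<open>the inverse is close to the identity in the same sense, since \<open>\<kappa>\<close> does not shorten distances by more than the factor 2/3\<close>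
  have near': "norm (\<kappa>' z - \<kappa>' w - (z - w)) \<le> norm (z - w) / 2" if zw: "z \<in> \<kappa> ` ?B" "w \<in> \<kappa> ` ?B" for z w
  proof -
    obtain x y where xy: "x \<in> ?B" "y \<in> ?B" "z = \<kappa> x" "w = \<kappa> y" using zw by blast
    have "norm (x - y - (\<kappa> x - \<kappa> y)) \<le> norm (\<kappa> x - \<kappa> y) / 2"
      using near[OF xy(1,2)] lower[OF xy(1,2)] by (simp add: norm_minus_commute)
    then show ?thesis using xy k'\<kappa> by simp
  qed
  have "norm (\<kappa>' z - \<kappa>' w) \<le> 3/2 * norm (z - w)" if "z \<in> \<kappa> ` ?B" "w \<in> \<kappa> ` ?B" for z w
    using that lower k'\<kappa> by auto
  then have "(3/2)-lipschitz_on (\<kappa> ` ?B) \<kappa>'" by (intro lipschitz_onI) (auto simp: dist_norm)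
  then have cont': "continuous_on (\<kappa> ` ?B) \<kappa>'" by (rule lipschitz_on_continuous_on)
  have inj': "inj_on \<kappa>' (\<kappa> ` ?B)" using k'\<kappa> by (auto simp: inj_on_def)
  have cont_map: "continuous_map (subtopology CP1 (affline b ` B)) CP1 (\<lambda>L. affline b (h (affcoord b L)))"
    if "continuous_on B h" for B and h :: "complex \<Rightarrow> complex"
  proof -
    have "affline b ` B \<subseteq> affdom b" by auto
    then have 1: "continuous_map (subtopology CP1 (affline b ` B)) (top_of_set B) (affcoord b)"
      using planar_chartD(3)[OF planar_chart_aff, of b]
      by (auto simp: continuous_map_in_subtopology intro: continuous_map_from_subtopology_mono)
    have 2: "continuous_map (top_of_set B) euclidean h" using that by simp
    have "continuous_map (subtopology CP1 (affline b ` B)) CP1 ((affline b \<circ> h) \<circ> affcoord b)"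
      by (rule continuous_map_compose[OF 1 continuous_map_compose[OF 2 continuous_map_affline]])
    then show ?thesis by (simp add: o_def)
  qed
  have or: "or_at \<kappa> z" if z: "z \<in> ?B" for z
  proof (rule or_at_near_id[OF open_ball z cont inj])
    fix w assume "w \<in> ?B"
    then have "norm (\<kappa> w - \<kappa> z - (w - z)) \<le> norm (w - z) / 3" using near z by blast
    also have "\<dots> \<le> norm (w - z) / 2" by simp
    finally show "norm (\<kappa> w - \<kappa> z - (w - z)) \<le> norm (w - z) / 2" .
  qed
  have or': "or_at \<kappa>' z" if "z \<in> \<kappa> ` ?B" for z
    using near'[OF _ that] by (intro or_at_near_id[OF op that cont' inj']) blast
  show ?thesis
    unfolding or_iso_def homeomorphic_maps_def continuous_map_in_subtopology
  proof (intro conjI)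
    show "openin CP1 (affline b ` ?B)" "openin CP1 (affline b ` \<kappa> ` ?B)"
      using op by (auto intro: openin_affline_image)
    show "continuous_map (subtopology CP1 (affline b ` ?B)) CP1 k"
      unfolding k_def by (rule cont_map[OF cont])
    show "continuous_map (subtopology CP1 (affline b ` \<kappa> ` ?B)) CP1 k'"
      unfolding k'_def by (rule cont_map[OF cont'[unfolded \<kappa>'_def]])
    show "\<forall>L\<in>affline b ` ?B. CP1_or_at k L"
      using or by (auto simp: CP1_or_at_def k_def intro!: exI[of _ b])
    show "\<forall>L\<in>affline b ` \<kappa> ` ?B. CP1_or_at k' L"
      using or' by (auto simp: CP1_or_at_def k'_def \<kappa>'_def intro!: exI[of _ b])
  qed (use k'\<kappa> in \<open>auto simp: k_def k'_def \<kappa>'_def\<close>)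
qed

section \<open>Local form of branched projective charts\<close>

lemma planar_chart_inverse_continuous:
  assumes pW: "planar_chart (top_of_set S) (W, w)"
  shows "continuous_on (w ` W) (inv_into W w)"
proof -
  note WD = planar_chartD[OF pW]
  have "homeomorphic_map (subtopology (top_of_set S) W) (top_of_set (w ` W)) w"
    using pW by (simp add: planar_chart_def)
  then obtain g where g: "homeomorphic_maps (subtopology (top_of_set S) W) (top_of_set (w ` W)) w g"
    using homeomorphic_map_maps by blast
  have "topspace (subtopology (top_of_set S) W) = W" using openin_subset[OF WD(1)] by auto
  then have "g z = inv_into W w z" if "z \<in> w ` W" for z
    using that g WD(2) by (auto simp: homeomorphic_maps_def)
  moreover have "continuous_map (top_of_set (w ` W)) (subtopology (top_of_set S) W) g"
    using g by (simp add: homeomorphic_maps_def)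
  ultimately have "continuous_map (top_of_set (w ` W)) (subtopology (top_of_set S) W) (inv_into W w)"
    by (rule continuous_map_eq[rotated]) simp
  from continuous_map_into_fulltopology[OF continuous_map_into_fulltopology[OF this]]
  show ?thesis by simp
qed

text \<open>The power form expresses \<open>\<phi>\<close> through a power of a coordinate, so that \<open>\<phi>\<close> is continuous on \<open>W\<close>.\<close>

lemma openin_CP1_chart_preimage:
  assumes w: "planar_chart X (W, w)" and y: "planar_chart CP1 (Y, y)"
    and form: "\<forall>x\<in>W. \<phi> x \<in> Y \<and> y (\<phi> x) = w x ^ m" and N: "openin CP1 N"
  shows "openin X {x \<in> W. \<phi> x \<in> N}"
proof -
  note wD = planar_chartD[OF w] and yD = planar_chartD[OF y]
  have "openin X {x \<in> W. w x \<in> (\<lambda>z. z ^ m) -` y ` (N \<inter> Y)}"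
  proof (rule openin_preimage_subtopology[OF wD(1,3)])
    have "open (y ` (N \<inter> Y))" by (rule yD(4)) (use N yD(1) in auto)
    then have "open ((\<lambda>z. z ^ m) -` y ` (N \<inter> Y))"
      by (rule open_vimage) (intro continuous_intros)
    then show "openin euclidean ((\<lambda>z. z ^ m) -` y ` (N \<inter> Y))" by simp
  qed
  moreover have "{x \<in> W. \<phi> x \<in> N} = {x \<in> W. w x \<in> (\<lambda>z. z ^ m) -` y ` (N \<inter> Y)}"
  proof -
    have "\<phi> x \<in> N \<longleftrightarrow> w x ^ m \<in> y ` (N \<inter> Y)" if "x \<in> W" for x
    proof -
      have 1: "\<phi> x \<in> Y" "w x ^ m = y (\<phi> x)" using form that by auto
      show ?thesis unfolding 1(2) using inj_on_image_mem_iff[OF yD(2) 1(1), of "N \<inter> Y"] 1(1) by simp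
    qed
    then show ?thesis by auto
  qed
  ultimately show ?thesis by simp
qed

text \<open>Composition with an orientation-preserving local homeomorphism \<open>k\<close> of the projective line
  preserves the order at \<open>p\<close>: the coordinate \<open>y\<close> near \<open>\<phi> p\<close> is replaced by \<open>y \<circ> k\<^sup>-\<^sup>1\<close> near
  \<open>k (\<phi> p)\<close>, while the coordinate near \<open>p\<close> is unchanged.\<close>

lemma power_form_at_or_iso:
  assumes form: "power_form_at S \<O> (U, \<phi>) p m" and k: "or_iso N N' k k'" "\<phi> p \<in> N"
    and V: "openin (top_of_set S) V" "p \<in> V" "V \<subseteq> U'" "\<And>x. x \<in> V \<Longrightarrow> \<phi>' x = k (\<phi> x)"
  shows "power_form_at S \<O> (U', \<phi>') p m"
proof -
  obtain W w Y y where W: "oriented_chart (top_of_set S) \<O> (W, w)" "p \<in> W" "W \<subseteq> U" "w p = 0"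
    and Y: "oriented_chart CP1 CP1_orientation (Y, y)" "\<phi> p \<in> Y" "y (\<phi> p) = 0"
    and wy: "\<forall>x\<in>W. \<phi> x \<in> Y \<and> y (\<phi> x) = w x ^ m"
    using form by (auto simp: power_form_at_def)
  note kD = or_isoD[OF k(1)]
  define W' where "W' = {x \<in> W. \<phi> x \<in> N} \<inter> V"
  have "openin (top_of_set S) W'"
    unfolding W'_def using W(1) Y(1) wy kD(1) V(1)
    by (intro openin_Int openin_CP1_chart_preimage) (auto simp: oriented_chart_def)
  then have "oriented_chart (top_of_set S) \<O> (W', w)"
    by (rule oriented_chart_restrict[OF W(1)]) (auto simp: W'_def)
  moreover have "oriented_chart CP1 CP1_orientation ({L \<in> N'. k' L \<in> Y}, \<lambda>L. y (k' L))"
    by (rule oriented_chart_or_iso[OF or_iso_sym[OF k(1)] Y(1)])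
  moreover have "\<phi>' x \<in> N' \<and> k' (\<phi>' x) = \<phi> x" if "x \<in> W'" for x
    using that V(4) kD(5,7) by (auto simp: W'_def)
  moreover have "p \<in> W'" using W V k by (auto simp: W'_def)
  ultimately show ?thesis
    unfolding power_form_at_def case_prod_conv
    using W V wy Y by (intro exI[of _ W'] exI[of _ w] exI[of _ "{L \<in> N'. k' L \<in> Y}"]
        exI[of _ "\<lambda>L. y (k' L)"]) (auto simp: W'_def)
qed

lemma power_form_at_value:
  assumes "power_form_at S \<O> (U, \<phi>) p m"
  shows "\<phi> p \<in> topspace CP1"
proof -
  obtain Y y where Y: "oriented_chart CP1 CP1_orientation (Y, y)" "\<phi> p \<in> Y"
    using assms by (auto simp: power_form_at_def)
  then have "planar_chart CP1 (Y, y)" by (simp add: oriented_chart_def)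
  then show ?thesis using openin_subset[OF planar_chartD(1)] Y(2) by blast
qed

lemma power_form_at_cong:
  assumes form: "power_form_at S \<O> (U, \<phi>) p m" and "M \<in> carrier PSL2"
    and V: "openin (top_of_set S) V" "p \<in> V" "V \<subseteq> U'" "\<And>x. x \<in> V \<Longrightarrow> \<phi>' x = PSL2_act M (\<phi> x)"
  shows "power_form_at S \<O> (U', \<phi>') p m"
  by (rule power_form_at_or_iso[OF form or_iso_PSL2_act[OF assms(2)] power_form_at_value[OF form] V])

text \<open>The power map is injective on a real radius of the coordinate disc.\<close>

lemma power_form_at_infinite_image:
  assumes form: "power_form_at S \<O> (U, \<phi>) p m" "m \<ge> 1" and N: "openin (top_of_set S) N" "p \<in> N"
  shows "infinite (\<phi> ` (N \<inter> U))"
proof -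
  obtain W w Y y where W: "oriented_chart (top_of_set S) \<O> (W, w)" "p \<in> W" "W \<subseteq> U" "w p = 0"
    and Y: "oriented_chart CP1 CP1_orientation (Y, y)" "\<phi> p \<in> Y"
    and wy: "\<forall>x\<in>W. \<phi> x \<in> Y \<and> y (\<phi> x) = w x ^ m"
    using form by (auto simp: power_form_at_def)
  have pw: "planar_chart (top_of_set S) (W, w)" and py: "planar_chart CP1 (Y, y)"
    using W Y by (auto simp: oriented_chart_def)
  have "open (w ` (N \<inter> W))"
    by (rule planar_chartD(4)[OF pw]) (use N planar_chartD(1)[OF pw] in auto)
  moreover have "0 \<in> w ` (N \<inter> W)" using W N by force
  ultimately obtain e where e: "e > 0" "ball 0 e \<subseteq> w ` (N \<inter> W)" using open_contains_ball by blast
  have "(\<lambda>t. complex_of_real t ^ m) ` {0<..<e} \<subseteq> y ` \<phi> ` (N \<inter> U)"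
  proof
    fix v assume "v \<in> (\<lambda>t. complex_of_real t ^ m) ` {0<..<e}"
    then obtain t where t: "0 < t" "t < e" "v = complex_of_real t ^ m" by auto
    then have "complex_of_real t \<in> w ` (N \<inter> W)" using e(2) by (auto simp: subset_iff)
    then obtain x where x: "x \<in> N" "x \<in> W" "complex_of_real t = w x" by blast
    then have "v = y (\<phi> x)" using wy t(3) by simp
    then show "v \<in> y ` \<phi> ` (N \<inter> U)" using x W(3) by blast
  qed
  moreover have "inj_on (\<lambda>t. complex_of_real t ^ m) {0<..<e}"
  proof (rule inj_onI)
    fix s t assume *: "s \<in> {0<..<e}" "t \<in> {0<..<e}" "complex_of_real s ^ m = complex_of_real t ^ m"
    then have "s ^ m = t ^ m" by (metis of_real_eq_iff of_real_power)
    then show "s = t" using * form(2) by (intro power_eq_imp_eq_base[of s m t]) auto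
  qed
  ultimately have "infinite (y ` \<phi> ` (N \<inter> U))"
    using e(1) by (meson finite_imageD finite_subset infinite_Ioo)
  then show "infinite (\<phi> ` (N \<inter> U))" by blast
qed

text \<open>A disc around \<open>q\<close> on which the chart takes values in an affine part of the projective line.
  The points of the disc whose values are close to the value at the centre form a compact subset, so
  that a bump function supported there can be chosen as a function of the chart.\<close>

lemma power_form_disc:
  assumes form: "power_form_at S \<O> (U, \<phi>) q m" "m \<ge> 1" and V: "openin (top_of_set S) V" "q \<in> V"
  obtains W w a r \<delta> K where "planar_chart (top_of_set S) (W, w)" "q \<in> W" "W \<subseteq> U \<inter> V"
    "w ` W = ball 0 r" "r > 0" "\<phi> ` W \<subseteq> affdom a" "\<delta> > 0" "compact K" "K \<subseteq> W"
    "\<And>x. x \<in> W \<Longrightarrow> norm (affcoord a (\<phi> x) - affcoord a (\<phi> q)) < \<delta> \<Longrightarrow> x \<in> K"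
    "continuous_map (subtopology (top_of_set S) W) CP1 \<phi>"
proof -
  obtain W0 w Y y where W0: "oriented_chart (top_of_set S) \<O> (W0, w)" "q \<in> W0" "W0 \<subseteq> U" "w q = 0"
    and Y: "oriented_chart CP1 CP1_orientation (Y, y)" "\<phi> q \<in> Y" "y (\<phi> q) = 0"
    and wy: "\<forall>x\<in>W0. \<phi> x \<in> Y \<and> y (\<phi> x) = w x ^ m"
    using form by (auto simp: power_form_at_def)
  have pw: "planar_chart (top_of_set S) (W0, w)" and py: "planar_chart CP1 (Y, y)"
    using W0 Y by (auto simp: oriented_chart_def)
  note wD = planar_chartD[OF pw] and yD = planar_chartD[OF py]
  note cont = openin_CP1_chart_preimage[OF pw py wy]
  obtain a where a: "\<phi> q \<in> affdom a"
    using CP1_affdom Y(2) openin_subset[OF yD(1)] by blast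
  note aD = planar_chartD[OF planar_chart_aff[of a]]
  define V0 where "V0 = {x \<in> W0. \<phi> x \<in> affdom a} \<inter> V"
  have V0: "openin (top_of_set S) V0" "V0 \<subseteq> W0" "q \<in> V0"
    using cont[OF aD(1)] V W0 a by (auto simp: V0_def)
  have "open (w ` V0)" by (rule wD(4)[OF V0(1,2)])
  moreover have "0 \<in> w ` V0" using V0(3) W0(4) by force
  ultimately obtain r where r: "r > 0" "cball 0 r \<subseteq> w ` V0" using open_contains_cball by blast
  define W where "W = {x \<in> V0. w x \<in> ball 0 r}"
  have pV0: "planar_chart (top_of_set S) (V0, w)" by (rule planar_chart_restrict[OF pw V0(1,2)])
  have opW: "openin (top_of_set S) W"
    unfolding W_def by (rule openin_preimage_subtopology[OF planar_chartD(1,3)[OF pV0]]) simp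
  have WW0: "W \<subseteq> W0" using V0(2) by (auto simp: W_def)
  have pW: "planar_chart (top_of_set S) (W, w)" by (rule planar_chart_restrict[OF pw opW WW0])
  have wW: "w ` W = ball 0 r"
  proof (intro subset_antisym subsetI)
    fix z :: complex assume z: "z \<in> ball 0 r"
    then have "z \<in> w ` V0" using r(2) by (auto simp: subset_iff)
    then show "z \<in> w ` W" using z by (auto simp: W_def)
  qed (auto simp: W_def)
  note WD = planar_chartD[OF pW]
  have invW: "inv_into W w (w x) = x" if "x \<in> W" for x using WD(2) that by simp
  define K where "K = inv_into W w ` cball 0 (r/2)"
  have sub: "cball 0 (r/2) \<subseteq> w ` W" using r(1) by (auto simp: wW)
  have "continuous_on (w ` W) (inv_into W w)" by (rule planar_chart_inverse_continuous[OF pW])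
  then have "compact K" unfolding K_def
    by (intro compact_continuous_image continuous_on_subset[OF _ sub]) auto
  have KW: "K \<subseteq> W"
    using sub by (auto simp: K_def intro: inv_into_into)
  have Kmem: "x \<in> K" if "x \<in> W" "norm (w x) \<le> r/2" for x
  proof -
    have "inv_into W w (w x) \<in> K" unfolding K_def using that(2) by (intro imageI) simp
    then show ?thesis using invW[OF that(1)] by simp
  qed
  \<comment> \<open>values in \<open>G\<close> are taken only at points with \<open>norm (w x) < r/2\<close>, because \<open>y (\<phi> x) = w x ^ m\<close>\<close>
  define G where "G = {L \<in> Y. y L \<in> ball 0 ((r/2)^m)} \<inter> affdom a"
  have "openin CP1 {L \<in> Y. y L \<in> ball 0 ((r/2)^m)}"
    by (rule openin_preimage_subtopology[OF yD(1,3)]) simp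
  then have G: "openin CP1 G" unfolding G_def using aD(1) by (rule openin_Int)
  have "open (affcoord a ` G)" by (rule aD(4)[OF G]) (simp add: G_def)
  moreover have "\<phi> q \<in> G" using a Y r(1) by (simp add: G_def)
  ultimately obtain \<delta> where \<delta>: "\<delta> > 0" "ball (affcoord a (\<phi> q)) \<delta> \<subseteq> affcoord a ` G"
    using open_contains_ball by blast
  show ?thesis
  proof
    show "x \<in> K" if x: "x \<in> W" "norm (affcoord a (\<phi> x) - affcoord a (\<phi> q)) < \<delta>" for x
    proof (rule Kmem[OF x(1)])
      have "affcoord a (\<phi> x) \<in> affcoord a ` G"
        using \<delta>(2) x(2) by (auto simp: subset_iff dist_norm norm_minus_commute)
      moreover have "\<phi> x \<in> affdom a" using x(1) by (auto simp: W_def V0_def)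
      ultimately have "\<phi> x \<in> G"
        using inj_on_image_mem_iff[OF aD(2), of "\<phi> x" G] by (auto simp: G_def)
      then have "norm (w x ^ m) < (r/2)^m" using wy WW0 x(1) by (auto simp: G_def)
      then have "norm (w x) ^ m < (r/2)^m" by (simp add: norm_power)
      then show "norm (w x) \<le> r/2"
        using r(1) power_less_imp_less_base[of "norm (w x)" m "r/2"] by simp
    qed
    show "continuous_map (subtopology (top_of_set S) W) CP1 \<phi>"
    proof -
      have top: "topspace (subtopology (top_of_set S) W) = W" using openin_subset[OF opW] by auto
      have "openin (subtopology (top_of_set S) W) {x \<in> W. \<phi> x \<in> N}" if "openin CP1 N" for N
      proof -
        have "{x \<in> W. \<phi> x \<in> N} = W \<inter> {x \<in> W0. \<phi> x \<in> N}" using WW0 by blast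
        then show ?thesis
          using openin_Int[OF opW cont[OF that]] opW by (simp add: openin_open_subtopology)
      qed
      moreover have "\<phi> x \<in> topspace CP1" if "x \<in> W" for x
        using wy WW0 that openin_subset[OF yD(1)] by blast
      ultimately show ?thesis unfolding continuous_map_def top by blast
    qed
    show "W \<subseteq> U \<inter> V" "\<phi> ` W \<subseteq> affdom a" "q \<in> W"
      using W0 V0 r by (auto simp: W_def V0_def)
  qed fact+
qed

section \<open>Homotopy classes of paths and the universal cover\<close>

text \<open>Paths in a convex set with common end points are homotopic there. The map \<open>c\<close> carries the homotopy
  into a space without linear structure.\<close>

lemma homotopic_paths_push:
  fixes c :: "'b::real_normed_vector \<Rightarrow> 'a::topological_space"
  assumes "convex Z" "continuous_on Z c" "c ` Z \<subseteq> S"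
    and a: "path a" "path_image a \<subseteq> Z" and b: "path b" "path_image b \<subseteq> Z"
    and ends: "pathstart a = pathstart b" "pathfinish a = pathfinish b"
  shows "homotopic_paths S (c \<circ> a) (c \<circ> b)"
proof (rule homotopic_paths_continuous_image[of Z])
  show "homotopic_paths Z a b"
  proof (rule homotopic_paths_linear)
    fix t :: real assume "t \<in> {0..1}"
    then have "a t \<in> Z" "b t \<in> Z" using a b by (auto simp: path_image_def)
    then show "closed_segment (a t) (b t) \<subseteq> Z" using assms(1) by (rule closed_segment_subset)
  qed (use a b ends in auto)
qed (use assms in auto)

definition pth :: "'a::topological_space set \<Rightarrow> (real \<Rightarrow> 'a) \<Rightarrow> bool" where
  "pth S p \<longleftrightarrow> path p \<and> path_image p \<subseteq> S"

lemma pthD: "pth S p \<Longrightarrow> path p" "pth S p \<Longrightarrow> path_image p \<subseteq> S"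
  by (auto simp: pth_def)

lemma pth_mono: "pth U p \<Longrightarrow> U \<subseteq> S \<Longrightarrow> pth S p"
  by (auto simp: pth_def)

lemma pth_join [simp]: "pth S p \<Longrightarrow> pth S q \<Longrightarrow> pathfinish p = pathstart q \<Longrightarrow> pth S (p +++ q)"
  by (auto simp: pth_def path_image_join)

lemma pth_reversepath [simp]: "pth S (reversepath p) \<longleftrightarrow> pth S p"
  by (auto simp: pth_def)

lemma pth_const [simp]: "pth S (\<lambda>_. y) \<longleftrightarrow> y \<in> S"
  by (auto simp: pth_def path_def path_image_def)

lemma pathstart_const [simp]: "pathstart (\<lambda>_. y) = y" and pathfinish_const [simp]: "pathfinish (\<lambda>_. y) = y"
  by (auto simp: pathstart_def pathfinish_def)

lemma pth_ends: "pth S p \<Longrightarrow> pathstart p \<in> S" "pth S p \<Longrightarrow> pathfinish p \<in> S"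
  by (auto simp: pth_def)

lemma pth_reparam:
  assumes "pth S p" "path a" "path_image a \<subseteq> {0..1}" "path b" "path_image b \<subseteq> {0..1}"
    "pathstart a = pathstart b" "pathfinish a = pathfinish b"
  shows "homotopic_paths S (p \<circ> a) (p \<circ> b)"
  by (rule homotopic_paths_push[of "{0..1}"])
    (use assms in \<open>auto simp: pth_def path_def path_image_def\<close>)

lemma compose_linepath_01: "p \<circ> linepath 0 1 = (p :: real \<Rightarrow> 'a::topological_space)"
  by (simp add: fun_eq_iff linepath_def)

lemma compose_linepath_const: "p \<circ> linepath u u = (\<lambda>_. p (u :: real) :: 'a::topological_space)"
  by (simp add: fun_eq_iff linepath_refl)

lemma compose_linepath_10: "p \<circ> linepath 1 0 = reversepath (p :: real \<Rightarrow> 'a::topological_space)"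
  by (simp add: fun_eq_iff linepath_def reversepath_def)

lemma hp_rid: assumes "pth S p" shows "homotopic_paths S (p +++ (\<lambda>_. pathfinish p)) p"
proof -
  have "homotopic_paths S (p \<circ> (linepath 0 1 +++ linepath 1 1)) (p \<circ> linepath 0 1)"
    by (rule pth_reparam[OF assms]) (auto simp: path_image_join closed_segment_eq_real_ivl)
  then show ?thesis
    by (simp add: path_compose_join compose_linepath_01 compose_linepath_10 compose_linepath_const pathfinish_def)
qed

lemma hp_linv: assumes "pth S p" shows "homotopic_paths S (reversepath p +++ p) (\<lambda>_. pathfinish p)"
proof -
  have "homotopic_paths S (p \<circ> (linepath 1 0 +++ linepath 0 1)) (p \<circ> linepath 1 1)"
    by (rule pth_reparam[OF assms]) (auto simp: path_image_join closed_segment_eq_real_ivl)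
  then show ?thesis
    by (simp add: path_compose_join compose_linepath_01 compose_linepath_10 compose_linepath_const pathfinish_def)
qed

text \<open>The restriction of a path to a subinterval, without a vector space structure on the target.\<close>

definition path_segment :: "real \<Rightarrow> real \<Rightarrow> (real \<Rightarrow> 'a) \<Rightarrow> real \<Rightarrow> 'a" where
  "path_segment u v p = p \<circ> linepath u v"

lemma pathstart_segment [simp]: "pathstart (path_segment u v p) = p u"
  and pathfinish_segment [simp]: "pathfinish (path_segment u v p) = p v"
  for p :: "real \<Rightarrow> 'a::topological_space"
  by (simp_all add: path_segment_def pathstart_def pathfinish_def linepath_def)

lemma pth_segment:
  assumes "pth S p" "u \<in> {0..1}" "v \<in> {0..1}" "p ` closed_segment u v \<subseteq> U"
  shows "pth U (path_segment u v p)"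
proof -
  have "closed_segment u v \<subseteq> {0..1}" using assms(2,3) by (rule closed_segment_subset) auto
  moreover have "continuous_on {0..1} p" using assms(1) by (simp add: pth_def path_def)
  ultimately have "path (p \<circ> linepath u v)"
    by (intro path_continuous_image) (auto intro: continuous_on_subset)
  then show ?thesis using assms(4) by (simp add: pth_def path_segment_def path_image_compose)
qed

lemma hp_segment:
  assumes "pth S p" "s \<in> {0..1}" "t \<in> {0..1}"
  shows "homotopic_paths S (path_segment 0 s p +++ path_segment s t p) (path_segment 0 t p)"
  unfolding path_segment_def path_compose_join[symmetric]
  by (rule pth_reparam[OF assms(1)])
    (use assms in \<open>auto simp: path_image_join closed_segment_eq_real_ivl split: if_splits\<close>)

lemma path_class_eq_iff: "pth S p \<Longrightarrow> path_class S p = path_class S q \<longleftrightarrow> homotopic_paths S p q"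
  unfolding path_class_def pth_def
  by (metis (mono_tags, lifting) homotopic_paths_refl homotopic_paths_sym homotopic_paths_trans
      mem_Collect_eq Collect_cong)

lemma path_class_eqI: "homotopic_paths S p q \<Longrightarrow> path_class S p = path_class S q"
  using path_class_eq_iff homotopic_paths_imp_path homotopic_paths_imp_subset by (metis pth_def)

lemma mem_path_class: "pth S p \<Longrightarrow> p \<in> path_class S p"
  by (simp add: path_class_def pth_def)

lemma class_join_path_class:
  assumes "pth S p" "pth S q" "pathfinish p = pathstart q"
  shows "class_join S (path_class S p) (path_class S q) = path_class S (p +++ q)"
proof (intro subset_antisym subsetI)
  fix r assume "r \<in> class_join S (path_class S p) (path_class S q)"
  then obtain p' q' where "homotopic_paths S p p'" "homotopic_paths S q q'" "homotopic_paths S (p' +++ q') r"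
    by (auto simp: class_join_def path_class_def)
  then show "r \<in> path_class S (p +++ q)"
    using homotopic_paths_join[of S p p' q q'] assms(3) homotopic_paths_trans
    by (auto simp: path_class_def)
next
  fix r assume "r \<in> path_class S (p +++ q)"
  then have "homotopic_paths S (p +++ q) r" by (simp add: path_class_def)
  then show "r \<in> class_join S (path_class S p) (path_class S q)"
    unfolding class_join_def using mem_path_class[OF assms(1)] mem_path_class[OF assms(2)] by blast
qed

lemma path_class_join_cong:
  assumes "path_class S p = path_class S p'" "path_class S q = path_class S q'"
    "pth S p" "pth S q" "pathfinish p = pathstart q"
  shows "path_class S (p +++ q) = path_class S (p' +++ q')"
  using assms by (auto intro!: path_class_eqI homotopic_paths_join simp: path_class_eq_iff)

lemma path_class_assoc:
  assumes "pth S p" "pth S q" "pth S r" "pathfinish p = pathstart q" "pathfinish q = pathstart r"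
  shows "path_class S ((p +++ q) +++ r) = path_class S (p +++ (q +++ r))"
  by (rule path_class_eqI[OF homotopic_paths_sym[OF homotopic_paths_assoc]])
    (use assms in \<open>auto simp: pth_def\<close>)

lemma path_class_ends:
  assumes "path_class S p = path_class S q" "pth S p"
  shows "pathstart p = pathstart q" "pathfinish p = pathfinish q" "pth S q"
  using assms homotopic_paths_imp_pathstart homotopic_paths_imp_pathfinish homotopic_paths_imp_path
    homotopic_paths_imp_subset unfolding path_class_eq_iff[OF assms(2)] pth_def by blast+

lemma path_class_cancel_right:
  assumes "pth S p" "pth S q" "pathfinish p = pathfinish q"
  shows "path_class S ((p +++ reversepath q) +++ q) = path_class S p"
proof -
  have "path_class S ((p +++ reversepath q) +++ q) = path_class S (p +++ (reversepath q +++ q))"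
    using assms by (intro path_class_assoc) auto
  also have "\<dots> = path_class S (p +++ (\<lambda>_. pathfinish q))"
    using assms path_class_eqI[OF hp_linv[OF assms(2)]] by (intro path_class_join_cong) auto
  also have "\<dots> = path_class S p"
    using path_class_eqI[OF hp_rid[OF assms(1)]] assms(3) by simp
  finally show ?thesis .
qed

lemma path_class_cancel_right':
  assumes "pth S p" "pth S q" "pathfinish p = pathstart q"
  shows "path_class S ((p +++ q) +++ reversepath q) = path_class S p"
  using path_class_cancel_right[of S p "reversepath q"] assms by simp

lemma paths_from_iff: "p \<in> paths_from S x \<longleftrightarrow> pth S p \<and> pathstart p = x"
  by (auto simp: paths_from_def pth_def)

lemma carrier_fundamental_group:
  "carrier (fundamental_group S x) = path_class S ` {p. pth S p \<and> pathstart p = x \<and> pathfinish p = x}"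
  by (auto simp: fundamental_group_def paths_from_iff)

lemma mult_fundamental_group [simp]: "mult (fundamental_group S x) = class_join S"
  and one_fundamental_group: "one (fundamental_group S x) = path_class S (\<lambda>_. x)"
  by (simp_all add: fundamental_group_def)

lemma cover_proj_path_class [simp]:
  assumes "pth S p" shows "cover_proj (path_class S p) = pathfinish p"
proof -
  have "pathfinish ` path_class S p = {pathfinish p}"
    using mem_path_class[OF assms] homotopic_paths_imp_pathfinish[of S p]
    by (auto simp: path_class_def) 
  then show ?thesis by (simp add: cover_proj_def)
qed

text \<open>The basic open sets of the universal cover. Over a disc \<open>U\<close> they are the sheets of the covering.\<close>

definition sheet :: "'a::topological_space set \<Rightarrow> (real \<Rightarrow> 'a) \<Rightarrow> 'a set \<Rightarrow> (real \<Rightarrow> 'a) set set" where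
  "sheet S p U = (\<lambda>q. path_class S (p +++ q)) ` {q. pth U q \<and> pathstart q = pathfinish p}"

lemma mem_sheet_self:
  assumes "pth S p" "pathfinish p \<in> U"
  shows "path_class S p \<in> sheet S p U"
  unfolding sheet_def using assms path_class_eqI[OF hp_rid[OF assms(1)]]
  by (intro image_eqI[of _ _ "\<lambda>_. pathfinish p"]) auto

lemma sheet_mono: "U \<subseteq> U' \<Longrightarrow> sheet S p U \<subseteq> sheet S p U'"
  unfolding sheet_def using pth_mono by blast

text \<open>A sheet contains the sheet of each of its points over the same set. This makes the sheets a basis
  of the topology and not only a subbasis.\<close>

lemma sheet_subset:
  assumes p: "pth S p" "pth S p'" and U: "U \<subseteq> S" and "path_class S p \<in> sheet S p' U"
  shows "sheet S p U \<subseteq> sheet S p' U"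
proof
  fix Q assume "Q \<in> sheet S p U"
  then obtain r where r: "pth U r" "pathstart r = pathfinish p" "Q = path_class S (p +++ r)"
    by (auto simp: sheet_def)
  obtain q where q: "pth U q" "pathstart q = pathfinish p'" "path_class S p = path_class S (p' +++ q)"
    using assms(4) by (auto simp: sheet_def)
  have "pathfinish q = pathfinish p" using path_class_ends[OF q(3) p(1)] by simp
  then have qr: "pth U (q +++ r)" "pathfinish q = pathstart r" using q r by auto
  have "Q = path_class S ((p' +++ q) +++ r)"
    unfolding r(3) using q(3) p r(2) pth_mono[OF r(1) U] by (intro path_class_join_cong) auto
  also have "\<dots> = path_class S (p' +++ (q +++ r))"
    using p q(1,2) pth_mono[OF r(1) U] pth_mono[OF q(1) U] qr(2)
    by (intro path_class_assoc) auto
  finally show "Q \<in> sheet S p' U"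
    unfolding sheet_def using qr q by (intro image_eqI[of _ _ "q +++ r"]) auto
qed

definition ucover :: "'a::topological_space set \<Rightarrow> 'a \<Rightarrow> (real \<Rightarrow> 'a) set set" where
  "ucover S x = path_class S ` {p. pth S p \<and> pathstart p = x}"

lemma ucoverI: "pth S p \<Longrightarrow> pathstart p = x \<Longrightarrow> path_class S p \<in> ucover S x"
  by (auto simp: ucover_def)

lemma ucoverE:
  assumes "P \<in> ucover S x"
  obtains p where "pth S p" "pathstart p = x" "P = path_class S p"
  using assms by (auto simp: ucover_def)

lemma sheet_in_ucover:
  assumes "pth S p" "pathstart p = x" "U \<subseteq> S"
  shows "sheet S p U \<subseteq> ucover S x"
proof
  fix Q assume "Q \<in> sheet S p U"
  then obtain q where "pth U q" "pathstart q = pathfinish p" "Q = path_class S (p +++ q)"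
    by (auto simp: sheet_def)
  then show "Q \<in> ucover S x" using assms pth_mono[of U q S] by (auto intro: ucoverI)
qed

lemma universal_cover_sheets:
  "universal_cover S x = topology_generated_by {sheet S p U | p U.
     pth S p \<and> pathstart p = x \<and> openin (top_of_set S) U \<and> pathfinish p \<in> U}"
  unfolding universal_cover_def sheet_def by (simp add: paths_from_def pth_def conj_ac)

lemma openin_universal_cover:
  "openin (universal_cover S x) V \<longleftrightarrow> V \<subseteq> ucover S x \<and>
     (\<forall>p. pth S p \<and> pathstart p = x \<and> path_class S p \<in> V \<longrightarrow>
       (\<exists>U. openin (top_of_set S) U \<and> pathfinish p \<in> U \<and> sheet S p U \<subseteq> V))" (is "?L \<longleftrightarrow> ?R V")
proof
  let ?B = "{sheet S p U | p U. pth S p \<and> pathstart p = x \<and> openin (top_of_set S) U \<and> pathfinish p \<in> U}"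
  assume ?L
  then have "generate_topology_on ?B V"
    unfolding universal_cover_sheets openin_topology_generated_by_iff .
  then show "?R V"
  proof induction
    case Empty then show ?case by auto
  next
    case (Int V W)
    show ?case
    proof (intro conjI allI impI)
      show "V \<inter> W \<subseteq> ucover S x" using Int by blast
      fix p assume p: "pth S p \<and> pathstart p = x \<and> path_class S p \<in> V \<inter> W"
      have "\<exists>U. openin (top_of_set S) U \<and> pathfinish p \<in> U \<and> sheet S p U \<subseteq> V"
        by (rule conjunct2[OF Int.IH(1), rule_format]) (use p in simp)
      then obtain U where "openin (top_of_set S) U" "pathfinish p \<in> U" "sheet S p U \<subseteq> V" by blast
      moreover have "\<exists>U. openin (top_of_set S) U \<and> pathfinish p \<in> U \<and> sheet S p U \<subseteq> W"
        by (rule conjunct2[OF Int.IH(2), rule_format]) (use p in simp)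
      then obtain U' where "openin (top_of_set S) U'" "pathfinish p \<in> U'" "sheet S p U' \<subseteq> W" by blast
      ultimately show "\<exists>U. openin (top_of_set S) U \<and> pathfinish p \<in> U \<and> sheet S p U \<subseteq> V \<inter> W"
        using sheet_mono[of "U \<inter> U'" U S p] sheet_mono[of "U \<inter> U'" U' S p]
        by (intro exI[of _ "U \<inter> U'"]) auto
    qed
  next
    case (UN K)
    show ?case
    proof (intro conjI allI impI)
      show "\<Union>K \<subseteq> ucover S x" using UN by blast
      fix p assume p: "pth S p \<and> pathstart p = x \<and> path_class S p \<in> \<Union>K"
      then obtain V where "V \<in> K" "path_class S p \<in> V" by blast
      moreover from this have "\<exists>U. openin (top_of_set S) U \<and> pathfinish p \<in> U \<and> sheet S p U \<subseteq> V"
        by (intro conjunct2[OF UN.IH, rule_format]) (use p in simp_all)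
      ultimately show "\<exists>U. openin (top_of_set S) U \<and> pathfinish p \<in> U \<and> sheet S p U \<subseteq> \<Union>K"
        by blast
    qed
  next
    case (Basis V)
    then obtain p' U where U: "V = sheet S p' U" "pth S p'" "pathstart p' = x"
      "openin (top_of_set S) U" "pathfinish p' \<in> U" by blast
    then have US: "U \<subseteq> S" using openin_imp_subset by blast
    show ?case
    proof (intro conjI allI impI)
      show "V \<subseteq> ucover S x" using sheet_in_ucover[OF U(2,3) US] U(1) by simp
      fix p assume p: "pth S p \<and> pathstart p = x \<and> path_class S p \<in> V"
      then obtain q where q: "pth U q" "pathstart q = pathfinish p'" "path_class S p = path_class S (p' +++ q)"
        by (auto simp: U(1) sheet_def)
      have "pathfinish p = pathfinish q" using path_class_ends[OF q(3)] p by simp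
      then have "pathfinish p \<in> U" using pth_ends(2)[OF q(1)] by simp
      moreover have "sheet S p U \<subseteq> V" unfolding U(1) using p U by (intro sheet_subset[OF _ U(2) US]) auto
      ultimately show "\<exists>U. openin (top_of_set S) U \<and> pathfinish p \<in> U \<and> sheet S p U \<subseteq> V"
        using U(4) by blast
    qed
  qed
next
  let ?B = "{sheet S p U | p U. pth S p \<and> pathstart p = x \<and> openin (top_of_set S) U \<and> pathfinish p \<in> U}"
  assume R: "?R V"
  have "\<exists>T. openin (universal_cover S x) T \<and> P \<in> T \<and> T \<subseteq> V" if "P \<in> V" for P
  proof -
    have "P \<in> ucover S x" using R \<open>P \<in> V\<close> by blast
    then obtain p where p: "pth S p" "pathstart p = x" "P = path_class S p" by (rule ucoverE)
    have "\<exists>U. openin (top_of_set S) U \<and> pathfinish p \<in> U \<and> sheet S p U \<subseteq> V"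
      by (rule conjunct2[OF R, rule_format]) (use p \<open>P \<in> V\<close> in simp)
    then obtain U where U: "openin (top_of_set S) U" "pathfinish p \<in> U" "sheet S p U \<subseteq> V" by blast
    have "openin (universal_cover S x) (sheet S p U)"
      unfolding universal_cover_sheets
      by (rule topology_generated_by_Basis) (use p U in blast)
    then show ?thesis using U p mem_sheet_self by blast
  qed
  then show ?L using openin_subopen by blast
qed

lemma openin_sheet:
  assumes "pth S p" "pathstart p = x" "openin (top_of_set S) U" "pathfinish p \<in> U"
  shows "openin (universal_cover S x) (sheet S p U)"
  unfolding universal_cover_sheets
  by (rule topology_generated_by_Basis) (use assms in blast)

lemma topspace_universal_cover: "topspace (universal_cover S x) = ucover S x"
proof
  show "topspace (universal_cover S x) \<subseteq> ucover S x"
    using openin_universal_cover[of S x "topspace (universal_cover S x)"] by simp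
  have "openin (universal_cover S x) (ucover S x)"
    unfolding openin_universal_cover
    using pth_ends by (auto intro!: exI[of _ S] sheet_in_ucover[THEN subsetD])
  then show "ucover S x \<subseteq> topspace (universal_cover S x)" by (rule openin_subset)
qed

text \<open>The classes of the initial segments of \<open>p\<close> join the class of the constant path to the class of \<open>p\<close>.\<close>

lemma connected_space_universal_cover: "connected_space (universal_cover S x)"
proof -
  let ?X = "universal_cover S x"
  define P0 where "P0 = path_class S (\<lambda>_. x)"
  have "\<exists>T. connectedin ?X T \<and> P0 \<in> T \<and> P \<in> T" if P: "P \<in> ucover S x" for P
  proof -
    obtain p where p: "pth S p" "pathstart p = x" "P = path_class S p" using P by (rule ucoverE)
    define c where "c t = path_class S (path_segment 0 t p)" for t
    have p0: "p 0 = x" using p(2) by (simp add: pathstart_def)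
    have pS: "p t \<in> S" if "t \<in> {0..1}" for t using p(1) that by (auto simp: pth_def path_image_def)
    have sub: "pth S (path_segment u v p)" if "u \<in> {0..1}" "v \<in> {0..1}" for u v
      using that pS closed_segment_subset[OF that]
      by (intro pth_segment[OF p(1)]) (auto simp: convex_real_interval)
    have cin: "c t \<in> ucover S x" if "t \<in> {0..1}" for t
      unfolding c_def using that p0 by (intro ucoverI sub) auto
    have cont: "continuous_map (top_of_set {0..1}) ?X c"
      unfolding continuous_map_def topspace_universal_cover
    proof (intro conjI allI impI)
      show "c \<in> topspace (top_of_set {0..1}) \<rightarrow> ucover S x" using cin by auto
      fix V assume V: "openin ?X V"
      have "\<exists>T. openin (top_of_set {0..1}) T \<and> t \<in> T \<and> T \<subseteq> {t \<in> {0..1}. c t \<in> V}"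
        if t: "t \<in> {0..1}" "c t \<in> V" for t
      proof -
        have "\<exists>U. openin (top_of_set S) U \<and> pathfinish (path_segment 0 t p) \<in> U \<and>
            sheet S (path_segment 0 t p) U \<subseteq> V"
          by (rule conjunct2[OF V[unfolded openin_universal_cover], rule_format])
            (use t sub[of 0 t] p0 in \<open>simp add: c_def\<close>)
        then obtain U where U: "openin (top_of_set S) U" "pathfinish (path_segment 0 t p) \<in> U"
          "sheet S (path_segment 0 t p) U \<subseteq> V" by blast
        have pt: "p t \<in> U" using U(2) by simp
        have "continuous_on {0..1} p" using p by (simp add: pth_def path_def)
        moreover have "p \<in> {0..1} \<rightarrow> S" using p by (auto simp: pth_def path_image_def)
        ultimately have "openin (top_of_set {0..1}) ({0..1} \<inter> p -` U)"
          using U(1) by (rule continuous_openin_preimage)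
        then have "\<forall>u\<in>{0..1} \<inter> p -` U. \<exists>e>0. ball u e \<inter> {0..1} \<subseteq> {0..1} \<inter> p -` U"
          unfolding openin_contains_ball by (rule conjunct2)
        moreover have "t \<in> {0..1} \<inter> p -` U" using t(1) pt by blast
        ultimately obtain e where e': "e > 0" "ball t e \<inter> {0..1} \<subseteq> {0..1} \<inter> p -` U" by blast
        have e: "e > 0" "\<And>s. s \<in> {0..1} \<Longrightarrow> dist s t < e \<Longrightarrow> p s \<in> U"
          using e' by (auto simp: dist_commute subset_iff)
        have "c s \<in> V" if s: "s \<in> {0..1}" "dist s t < e" for s
        proof -
          have "pth U (path_segment t s p)"
          proof (rule pth_segment[OF p(1) t(1) s(1)])
            have "dist u t < e" if "u \<in> closed_segment t s" for u
              using that s(2) by (auto simp: closed_segment_eq_real_ivl dist_real_def split: if_splits)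
            moreover have "u \<in> {0..1}" if "u \<in> closed_segment t s" for u
              using that s(1) t(1) by (auto simp: closed_segment_eq_real_ivl split: if_splits)
            ultimately show "p ` closed_segment t s \<subseteq> U" using e(2) by auto
          qed
          moreover have "c s = path_class S (path_segment 0 t p +++ path_segment t s p)"
            unfolding c_def using path_class_eqI[OF hp_segment[OF p(1) t(1) s(1)]] by simp
          ultimately have "c s \<in> sheet S (path_segment 0 t p) U"
            unfolding sheet_def by (intro image_eqI[of _ _ "path_segment t s p"]) auto
          then show ?thesis using U(3) by blast
        qed
        then show ?thesis using e(1) t
          by (intro exI[of _ "{0..1} \<inter> ball t e"]) (auto simp: dist_commute)
      qed
      then show "openin (top_of_set {0..1}) {t \<in> topspace (top_of_set {0..1}). c t \<in> V}"
        using openin_subopen[of "top_of_set {0..1}" "{t \<in> {0..1}. c t \<in> V}"] by auto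
    qed
    have "connectedin ?X (c ` {0..1})"
      by (rule connectedin_continuous_map_image[OF cont]) (auto simp: connectedin_subtopology)
    moreover have "c 0 = P0" using p by (simp add: c_def P0_def path_segment_def compose_linepath_const pathstart_def)
    moreover have "c 1 = P" using p by (simp add: c_def path_segment_def compose_linepath_01)
    ultimately show ?thesis by (intro exI[of _ "c ` {0..1}"]) force
  qed
  then obtain T where T: "\<And>P. P \<in> ucover S x \<Longrightarrow> connectedin ?X (T P) \<and> P0 \<in> T P \<and> P \<in> T P" by metis
  have "connectedin ?X (\<Union>(T ` ucover S x))"
    by (rule connectedin_Union) (use T in auto)
  moreover have "\<Union>(T ` ucover S x) = ucover S x"
    using T connectedin_subset_topspace by (force simp: topspace_universal_cover)
  ultimately show ?thesis by (metis connectedin_topspace topspace_universal_cover)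
qed

subsection \<open>Deck transformations\<close>

definition loops :: "'a::topological_space set \<Rightarrow> 'a \<Rightarrow> (real \<Rightarrow> 'a) set" where
  "loops S x = {l. pth S l \<and> pathstart l = x \<and> pathfinish l = x}"

lemma carrier_fundamental_group_loops: "carrier (fundamental_group S x) = path_class S ` loops S x"
  by (simp add: carrier_fundamental_group loops_def)

lemma loopsD:
  assumes "l \<in> loops S x" shows "pth S l" "pathstart l = x" "pathfinish l = x"
  using assms by (auto simp: loops_def)

lemma deck_path_class:
  assumes "l \<in> loops S x" "pth S p" "pathstart p = x"
  shows "class_join S (path_class S l) (path_class S p) = path_class S (l +++ p)"
  by (rule class_join_path_class) (use loopsD[OF assms(1)] assms in simp_all)

lemma deck_in_ucover:
  assumes "g \<in> carrier (fundamental_group S x)" "P \<in> ucover S x"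
  shows "class_join S g P \<in> ucover S x" "cover_proj (class_join S g P) = cover_proj P"
proof -
  obtain l where l: "l \<in> loops S x" "g = path_class S l"
    using assms(1) by (auto simp: carrier_fundamental_group_loops)
  obtain p where p: "pth S p" "pathstart p = x" "P = path_class S p"
    using assms(2) by (rule ucoverE)
  have lp: "pth S (l +++ p)" using loopsD[OF l(1)] p by simp
  show "class_join S g P \<in> ucover S x"
    unfolding l(2) p(3) deck_path_class[OF l(1) p(1,2)]
    using lp loopsD[OF l(1)] by (intro ucoverI) simp_all
  show "cover_proj (class_join S g P) = cover_proj P"
    unfolding l(2) p(3) deck_path_class[OF l(1) p(1,2)] using lp p by simp
qed

lemma deck_mult:
  assumes "g \<in> carrier (fundamental_group S x)" "h \<in> carrier (fundamental_group S x)" "P \<in> ucover S x"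
  shows "class_join S (class_join S g h) P = class_join S g (class_join S h P)"
    and "class_join S g h \<in> carrier (fundamental_group S x)"
proof -
  obtain l m where l: "l \<in> loops S x" "g = path_class S l" and m: "m \<in> loops S x" "h = path_class S m"
    using assms(1,2) by (auto simp: carrier_fundamental_group_loops)
  obtain p where p: "pth S p" "pathstart p = x" "P = path_class S p"
    using assms(3) by (rule ucoverE)
  have lm: "l +++ m \<in> loops S x" using l m by (auto simp: loops_def)
  have gh: "class_join S g h = path_class S (l +++ m)"
    unfolding l(2) m(2) using l m by (intro class_join_path_class) (auto simp: loops_def)
  then show "class_join S g h \<in> carrier (fundamental_group S x)"
    using lm by (simp add: carrier_fundamental_group_loops)
  have "class_join S (class_join S g h) P = path_class S ((l +++ m) +++ p)"
    unfolding gh p(3) by (rule deck_path_class[OF lm p(1,2)])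
  also have "\<dots> = path_class S (l +++ (m +++ p))"
    using l m p by (intro path_class_assoc) (auto simp: loops_def)
  also have "\<dots> = class_join S g (path_class S (m +++ p))"
    unfolding l(2) using l m p by (intro deck_path_class[symmetric]) (auto simp: loops_def)
  also have "\<dots> = class_join S g (class_join S h P)"
    unfolding m(2) p(3) deck_path_class[OF m(1) p(1,2)] ..
  finally show "class_join S (class_join S g h) P = class_join S g (class_join S h P)" .
qed

lemma deck_sheet:
  assumes l: "l \<in> loops S x" and p: "pth S p" "pathstart p = x" and U: "U \<subseteq> S"
  shows "class_join S (path_class S l) ` sheet S p U = sheet S (l +++ p) U"
proof -
  have "class_join S (path_class S l) (path_class S (p +++ q)) = path_class S ((l +++ p) +++ q)"
    if "pth U q" "pathstart q = pathfinish p" for q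
  proof -
    note q = pth_mono[OF that(1) U] that(2)
    have "class_join S (path_class S l) (path_class S (p +++ q)) = path_class S (l +++ (p +++ q))"
      using l p q by (intro deck_path_class) auto
    also have "\<dots> = path_class S ((l +++ p) +++ q)"
      using l p q by (intro path_class_assoc[symmetric]) (auto simp: loops_def)
    finally show ?thesis .
  qed
  then show ?thesis
    unfolding sheet_def image_image using p by (intro image_cong) (auto simp: loops_def)
qed

lemma deck_transitive:
  assumes "P \<in> ucover S x" "Q \<in> ucover S x" "cover_proj P = cover_proj Q"
  shows "\<exists>g\<in>carrier (fundamental_group S x). P = class_join S g Q"
proof -
  obtain p where p: "pth S p" "pathstart p = x" "P = path_class S p" using assms(1) by (rule ucoverE)
  obtain q where q: "pth S q" "pathstart q = x" "Q = path_class S q" using assms(2) by (rule ucoverE)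
  have e: "pathfinish p = pathfinish q" using assms(3) p q by simp
  have l: "p +++ reversepath q \<in> loops S x" using p q e by (auto simp: loops_def)
  have "class_join S (path_class S (p +++ reversepath q)) Q = P"
    unfolding q(3) p(3) deck_path_class[OF l q(1,2)] using p q e by (intro path_class_cancel_right) auto
  then show ?thesis using l by (auto simp: carrier_fundamental_group_loops)
qed

section \<open>Closed surfaces\<close>

locale surface =
  fixes S :: "'a::topological_space set" and \<O> :: "('a set \<times> ('a \<Rightarrow> complex)) set"
  assumes surface: "closed_oriented_surface S \<O>"
begin

abbreviation opn :: "'a set \<Rightarrow> bool" where
  "opn \<equiv> openin (top_of_set S)"

lemma opn_subset: "opn N \<Longrightarrow> N \<subseteq> S"
  by (rule openin_imp_subset)

text \<open>Convexity of the coordinate image makes a disc path connected and simply connected.\<close>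

definition disc :: "'a set \<Rightarrow> bool" where
  "disc W \<longleftrightarrow> (\<exists>w. planar_chart (top_of_set S) (W, w) \<and> convex (w ` W))"

lemma disc_opn: "disc W \<Longrightarrow> opn W"
  unfolding disc_def using planar_chartD(1) by blast

lemma disc_nbhd:
  assumes "opn V" "q \<in> V"
  obtains W where "disc W" "q \<in> W" "W \<subseteq> V"
proof -
  have "oriented_atlas (top_of_set S) \<O>" using surface by (simp add: closed_oriented_surface_def)
  then have atlas: "\<And>c. c \<in> \<O> \<Longrightarrow> planar_chart (top_of_set S) c" "(\<Union>c\<in>\<O>. fst c) = S"
    by (simp_all add: oriented_atlas_def)
  have "q \<in> (\<Union>c\<in>\<O>. fst c)" using assms opn_subset atlas(2) by blast
  then obtain c where c: "c \<in> \<O>" "q \<in> fst c" by blast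
  obtain U u where eq: "c = (U, u)" by (rule prod.exhaust)
  have U: "q \<in> U" "planar_chart (top_of_set S) (U, u)" using c atlas(1)[OF c(1)] by (simp_all add: eq)
  note u = planar_chartD[OF U(2)]
  have UV: "opn (U \<inter> V)" using u(1) assms(1) by (rule openin_Int)
  have pUV: "planar_chart (top_of_set S) (U \<inter> V, u)" by (rule planar_chart_restrict[OF U(2) UV]) simp
  note v = planar_chartD[OF pUV]
  have "u q \<in> u ` (U \<inter> V)" using U assms by blast
  then obtain e where e: "e > 0" "ball (u q) e \<subseteq> u ` (U \<inter> V)"
    using v(5) open_contains_ball by blast
  define W where "W = {y \<in> U \<inter> V. u y \<in> ball (u q) e}"
  have W: "opn W" unfolding W_def by (rule openin_preimage_subtopology[OF v(1,3)]) simp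
  have "planar_chart (top_of_set S) (W, u)" by (rule planar_chart_restrict[OF pUV W]) (auto simp: W_def)
  moreover have "u ` W = ball (u q) e" using e(2) by (auto simp: W_def)
  ultimately have "disc W" unfolding disc_def by (intro exI[of _ u]) simp
  moreover have "q \<in> W" using U assms e by (simp add: W_def)
  ultimately show ?thesis using that W_def by blast
qed

lemma disc_path:
  assumes "disc W" "y \<in> W" "z \<in> W"
  obtains a where "pth W a" "pathstart a = y" "pathfinish a = z"
proof -
  obtain w where w: "planar_chart (top_of_set S) (W, w)" "convex (w ` W)"
    using assms(1) by (auto simp: disc_def)
  note wD = planar_chartD[OF w(1)]
  define a where "a = inv_into W w \<circ> linepath (w y) (w z)"
  have seg: "closed_segment (w y) (w z) \<subseteq> w ` W"
    using w(2) assms by (intro closed_segment_subset) auto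
  have "path a" unfolding a_def
    using planar_chart_inverse_continuous[OF w(1)] seg
    by (intro path_continuous_image) (auto intro: continuous_on_subset)
  moreover have "path_image a \<subseteq> W"
    unfolding a_def path_image_compose using seg by (auto simp: subset_iff intro: inv_into_into)
  moreover have "pathstart a = y" "pathfinish a = z"
    using wD(2) assms by (simp_all add: a_def pathstart_compose pathfinish_compose)
  ultimately show ?thesis using that by (simp add: pth_def)
qed

lemma disc_homotopic:
  assumes "disc W" "pth W a" "pth W b" "pathstart a = pathstart b" "pathfinish a = pathfinish b"
  shows "homotopic_paths S a b"
proof -
  obtain w where w: "planar_chart (top_of_set S) (W, w)" "convex (w ` W)"
    using assms(1) by (auto simp: disc_def)
  note wD = planar_chartD[OF w(1)]
  have cw: "continuous_on W w"
    using wD(3) disc_opn[OF assms(1)] opn_subset[of W]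
    by (simp add: subtopology_subtopology Int_absorb1)
  have pw: "path (w \<circ> c)" "path_image (w \<circ> c) \<subseteq> w ` W" if "pth W c" for c
    using that cw by (auto simp: pth_def path_image_compose intro: path_continuous_image continuous_on_subset)
  have 1: "homotopic_paths S (inv_into W w \<circ> (w \<circ> a)) (inv_into W w \<circ> (w \<circ> b))"
  proof (rule homotopic_paths_push[OF w(2) planar_chart_inverse_continuous[OF w(1)]])
    show "inv_into W w ` w ` W \<subseteq> S"
      using wD(2) opn_subset[OF wD(1)] by auto
  qed (use pw assms in \<open>auto simp: pathstart_compose pathfinish_compose\<close>)
  have 2: "homotopic_paths S (inv_into W w \<circ> (w \<circ> c)) c" if "pth W c" for c
  proof (rule homotopic_paths_sym, rule homotopic_paths_eq)
    show "path c" "path_image c \<subseteq> S" using that opn_subset[OF wD(1)] by (auto simp: pth_def)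
    fix t :: real assume "t \<in> {0..1}"
    then have "c t \<in> W" using that by (auto simp: pth_def path_image_def)
    then show "c t = (inv_into W w \<circ> (w \<circ> c)) t" using wD(2) by simp
  qed
  show ?thesis
    by (rule homotopic_paths_trans[OF homotopic_paths_trans[OF homotopic_paths_sym[OF 2[OF assms(2)]] 1]
          2[OF assms(3)]])
qed

lemma path_to:
  assumes "x \<in> S" "y \<in> S"
  obtains p where "pth S p" "pathstart p = x" "pathfinish p = y"
proof -
  define R where "R a b \<longleftrightarrow> (\<exists>p. pth S p \<and> pathstart p = a \<and> pathfinish p = b)" for a b
  have "R x y"
  proof (rule connected_equivalence_relation[of S x y R])
    show "connected S" using surface by (simp add: closed_oriented_surface_def)
    show "R b a" if "R a b" for a b
      using that unfolding R_def by (metis pth_reversepath pathstart_reversepath pathfinish_reversepath)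
    show "R a c" if "R a b" "R b c" for a b c
      using that unfolding R_def by (metis pth_join pathstart_join pathfinish_join)
    fix a assume "a \<in> S"
    then obtain W where W: "disc W" "a \<in> W" using disc_nbhd[of S a] by auto
    have "R a b" if b: "b \<in> W" for b
    proof -
      obtain p where "pth W p" "pathstart p = a" "pathfinish p = b" using disc_path[OF W b] .
      then show ?thesis unfolding R_def using pth_mono opn_subset[OF disc_opn[OF W(1)]] by blast
    qed
    then show "\<exists>T. opn T \<and> a \<in> T \<and> (\<forall>b\<in>T. R a b)" using W disc_opn by blast
  qed (use assms in auto)
  then show ?thesis using that by (auto simp: R_def)
qed

lemma connected_disc: "disc W \<Longrightarrow> connected W"
proof -
  assume W: "disc W"
  then obtain w where w: "planar_chart (top_of_set S) (W, w)" "convex (w ` W)"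
    by (auto simp: disc_def)
  have "connected (inv_into W w ` w ` W)"
    by (rule connected_continuous_image[OF planar_chart_inverse_continuous[OF w(1)] convex_connected[OF w(2)]])
  moreover have "inv_into W w ` w ` W = W"
    using planar_chartD(2)[OF w(1)] by (simp add: image_image)
  ultimately show ?thesis by simp
qed

subsection \<open>Germs of maps to the projective line\<close>

lemma finite_opn_cover:
  assumes "\<And>y. y \<in> S \<Longrightarrow> opn (N y)" "\<And>y. y \<in> S \<Longrightarrow> y \<in> N y"
  obtains Y where "finite Y" "Y \<subseteq> S" "S \<subseteq> \<Union>(N ` Y)"
proof -
  have "compact_space (top_of_set S)"
    using surface by (simp add: closed_oriented_surface_def compact_space_subtopology)
  moreover have "S \<subseteq> \<Union>(N ` S)" using assms(2) by blast
  moreover have "\<forall>V\<in>N ` S. opn V" using assms(1) by simp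
  ultimately have "\<exists>F. finite F \<and> F \<subseteq> N ` S \<and> S \<subseteq> \<Union>F"
    unfolding compact_space_alt by simp
  then obtain F where F: "finite F" "F \<subseteq> N ` S" "S \<subseteq> \<Union>F" by (elim exE conjE)
  obtain Y where "Y \<subseteq> S" "finite Y" "F = N ` Y" using finite_subset_image[OF F(1,2)] by (elim exE conjE)
  then show ?thesis using that F(3) by simp
qed

lemma opn_affcoord_ball:
  assumes W: "opn W" "continuous_map (subtopology (top_of_set S) W) CP1 \<phi>" "\<And>y. y \<in> W \<Longrightarrow> \<phi> y \<in> affdom a"
  shows "opn {y \<in> W. affcoord a (\<phi> y) \<in> ball c r}"
proof -
  have "openin CP1 {L \<in> affdom a. affcoord a L \<in> ball c r}"
    by (rule openin_preimage_subtopology[OF planar_chartD(1,3)[OF planar_chart_aff]]) simp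
  from openin_preimage_subtopology[OF W(1,2) this]
  have "opn {y \<in> W. \<phi> y \<in> {L \<in> affdom a. affcoord a L \<in> ball c r}}" .
  moreover have "{y \<in> W. \<phi> y \<in> {L \<in> affdom a. affcoord a L \<in> ball c r}} = {y \<in> W. affcoord a (\<phi> y) \<in> ball c r}"
    using W(3) by auto
  ultimately show ?thesis by simp
qed

definition germ_eq :: "'a \<Rightarrow> ('a \<Rightarrow> (complex^2) set) \<Rightarrow> ('a \<Rightarrow> (complex^2) set) \<Rightarrow> bool" where
  "germ_eq y F G \<longleftrightarrow> (\<exists>N. opn N \<and> y \<in> N \<and> (\<forall>z\<in>N. F z = G z))"

text \<open>The equivalence relation on germs that underlies the compatibility of charts.\<close>

definition germ_rel :: "'a \<Rightarrow> ('a \<Rightarrow> (complex^2) set) \<Rightarrow> ('a \<Rightarrow> (complex^2) set) \<Rightarrow> bool" where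
  "germ_rel y F G \<longleftrightarrow> (\<exists>N M. opn N \<and> y \<in> N \<and> M \<in> carrier PSL2 \<and>
     (\<forall>z\<in>N. G z \<in> topspace CP1 \<and> F z = PSL2_act M (G z)))"

lemma germ_eqI: "opn N \<Longrightarrow> y \<in> N \<Longrightarrow> (\<And>z. z \<in> N \<Longrightarrow> F z = G z) \<Longrightarrow> germ_eq y F G"
  unfolding germ_eq_def by blast

lemma germ_eqD: "germ_eq y F G \<Longrightarrow> F y = G y"
  unfolding germ_eq_def by blast

lemma germ_eq_sym: "germ_eq y F G \<Longrightarrow> germ_eq y G F"
  unfolding germ_eq_def by metis

lemma germ_eq_trans:
  assumes "germ_eq y F G" "germ_eq y G H" shows "germ_eq y F H"
proof -
  obtain N N' where "opn N" "y \<in> N" "\<forall>z\<in>N. F z = G z" "opn N'" "y \<in> N'" "\<forall>z\<in>N'. G z = H z"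
    using assms by (auto simp: germ_eq_def)
  then show ?thesis by (intro germ_eqI[of "N \<inter> N'"]) (auto intro: openin_Int)
qed

lemma germ_eq_act: "germ_eq y F G \<Longrightarrow> germ_eq y (\<lambda>z. PSL2_act M (F z)) (\<lambda>z. PSL2_act M (G z))"
  unfolding germ_eq_def by metis

lemma germ_relI:
  assumes "opn N" "y \<in> N" "M \<in> carrier PSL2"
    "\<And>z. z \<in> N \<Longrightarrow> G z \<in> topspace CP1" "\<And>z. z \<in> N \<Longrightarrow> F z = PSL2_act M (G z)"
  shows "germ_rel y F G"
  unfolding germ_rel_def using assms by blast

lemma germ_relE:
  assumes "germ_rel y F G" "opn V" "y \<in> V"
  obtains N M where "opn N" "y \<in> N" "N \<subseteq> V" "M \<in> carrier PSL2"
    "\<And>z. z \<in> N \<Longrightarrow> G z \<in> topspace CP1" "\<And>z. z \<in> N \<Longrightarrow> F z = PSL2_act M (G z)"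
proof -
  obtain N M where N: "opn N" "y \<in> N" "M \<in> carrier PSL2"
    "\<forall>z\<in>N. G z \<in> topspace CP1 \<and> F z = PSL2_act M (G z)"
    using assms(1) unfolding germ_rel_def by blast
  show ?thesis by (rule that[of "N \<inter> V" M]) (use N assms in \<open>auto intro: openin_Int\<close>)
qed

lemma germ_rel_sym:
  assumes "germ_rel y F G" shows "germ_rel y G F"
proof -
  obtain N M where N: "opn N" "y \<in> N" "M \<in> carrier PSL2"
    "\<forall>z\<in>N. G z \<in> topspace CP1 \<and> F z = PSL2_act M (G z)"
    using assms(1) unfolding germ_rel_def by blast
  show ?thesis
    by (rule germ_relI[OF N(1,2), of "inv\<^bsub>PSL2\<^esub> M"]) (use N in auto)
qed

lemma germ_rel_trans:
  assumes "germ_rel y F G" "germ_rel y G H" shows "germ_rel y F H"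
proof -
  obtain N M where N: "opn N" "y \<in> N" "M \<in> carrier PSL2"
    "\<forall>z\<in>N. G z \<in> topspace CP1 \<and> F z = PSL2_act M (G z)"
    using assms(1) unfolding germ_rel_def by blast
  obtain N' M' where N': "opn N'" "y \<in> N'" "M' \<in> carrier PSL2"
    "\<forall>z\<in>N'. H z \<in> topspace CP1 \<and> G z = PSL2_act M' (H z)"
    using assms(2) unfolding germ_rel_def by blast
  show ?thesis
    by (rule germ_relI[of "N \<inter> N'" _ "M \<otimes>\<^bsub>PSL2\<^esub> M'"])
      (use N N' in \<open>auto intro: openin_Int simp: PSL2_act_mult\<close>)
qed

lemma germ_rel_eq:
  assumes "germ_eq y F F'" "germ_rel y F' G" shows "germ_rel y F G"
proof -
  obtain V where V: "opn V" "y \<in> V" "\<forall>z\<in>V. F z = F' z" using assms(1) by (auto simp: germ_eq_def)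
  obtain N M where N: "opn N" "y \<in> N" "N \<subseteq> V" "M \<in> carrier PSL2"
    "\<And>z. z \<in> N \<Longrightarrow> G z \<in> topspace CP1" "\<And>z. z \<in> N \<Longrightarrow> F' z = PSL2_act M (G z)"
    by (rule germ_relE[OF assms(2) V(1,2)]) blast
  show ?thesis by (rule germ_relI[OF N(1,2,4,5)]) (use N V in auto)
qed

lemma power_form_at_germ_rel:
  assumes "power_form_at S \<O> (U, \<phi>) y m" "germ_rel y F \<phi>" "opn V" "y \<in> V"
  shows "power_form_at S \<O> (V, F) y m"
proof -
  obtain N M where N: "opn N" "y \<in> N" "N \<subseteq> V" "M \<in> carrier PSL2"
    "\<And>z. z \<in> N \<Longrightarrow> \<phi> z \<in> topspace CP1" "\<And>z. z \<in> N \<Longrightarrow> F z = PSL2_act M (\<phi> z)"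
    by (rule germ_relE[OF assms(2-4)]) blast
  show ?thesis by (rule power_form_at_cong[OF assms(1) N(4,1,2,3,6)])
qed

lemma bp_chartD:
  assumes "bp_chart S \<O> (U, \<phi>)"
  shows "opn U" "\<phi> \<in> extensional U" "\<And>p. p \<in> U \<Longrightarrow> \<exists>m\<ge>1. power_form_at S \<O> (U, \<phi>) p m"
    "\<And>p. p \<in> U \<Longrightarrow> \<phi> p \<in> topspace CP1"
proof -
  show "opn U" "\<phi> \<in> extensional U" and *: "\<And>p. p \<in> U \<Longrightarrow> \<exists>m\<ge>1. power_form_at S \<O> (U, \<phi>) p m"
    using assms by (auto simp: bp_chart_def)
  show "\<And>p. p \<in> U \<Longrightarrow> \<phi> p \<in> topspace CP1" using * power_form_at_value by blast
qed

lemma bp_chart_germ_refl: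
  assumes "bp_chart S \<O> (U, \<phi>)" "y \<in> U" shows "germ_rel y \<phi> \<phi>"
  by (rule germ_relI[of U _ "\<one>\<^bsub>PSL2\<^esub>"]) (use assms bp_chartD[OF assms(1)] in auto)

lemma bp_compatible_germ_rel:
  assumes "bp_chart S \<O> (U, \<phi>)" "bp_chart S \<O> (V, \<psi>)"
  shows "bp_compatible S (U, \<phi>) (V, \<psi>) \<longleftrightarrow> (\<forall>p\<in>U \<inter> V. germ_rel p \<phi> \<psi>)"
proof
  assume L: "bp_compatible S (U, \<phi>) (V, \<psi>)"
  show "\<forall>p\<in>U \<inter> V. germ_rel p \<phi> \<psi>"
  proof
    fix p assume "p \<in> U \<inter> V"
    then obtain N h where N: "opn N" "p \<in> N" "N \<subseteq> U \<inter> V" "h \<in> carrier PSL2" "\<forall>x\<in>N. \<phi> x = PSL2_act h (\<psi> x)"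
      using L unfolding bp_compatible_def by blast
    then show "germ_rel p \<phi> \<psi>" using bp_chartD(4)[OF assms(2)] by (intro germ_relI[OF N(1,2,4)]) auto
  qed
next
  assume R: "\<forall>p\<in>U \<inter> V. germ_rel p \<phi> \<psi>"
  have UV: "opn (U \<inter> V)" using bp_chartD(1)[OF assms(1)] bp_chartD(1)[OF assms(2)] by (rule openin_Int)
  show "bp_compatible S (U, \<phi>) (V, \<psi>)"
    unfolding bp_compatible_def case_prod_conv
  proof
    fix p assume p: "p \<in> U \<inter> V"
    obtain N M where "opn N" "p \<in> N" "N \<subseteq> U \<inter> V" "M \<in> carrier PSL2"
      "\<And>z. z \<in> N \<Longrightarrow> \<phi> z = PSL2_act M (\<psi> z)"
      by (rule germ_relE[OF R[rule_format, OF p] UV p]) blast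
    then show "\<exists>N h. opn N \<and> p \<in> N \<and> N \<subseteq> U \<inter> V \<and> h \<in> carrier PSL2 \<and> (\<forall>x\<in>N. \<phi> x = PSL2_act h (\<psi> x))"
      by blast
  qed
qed

text \<open>An atlas is determined by the germs of its charts.\<close>

definition charts_of :: "('a \<Rightarrow> ('a \<Rightarrow> (complex^2) set) \<Rightarrow> bool) \<Rightarrow> 'a bp_chart set" where
  "charts_of g = {(U, \<phi>). bp_chart S \<O> (U, \<phi>) \<and> (\<forall>y\<in>U. g y \<phi>)}"

text \<open>A chart \<open>\<phi>\<close> that is compatible with all members of the family is, near any point, projectively equivalent
  to a member of the family, so that the germs of \<open>\<phi>\<close> satisfy \<open>g\<close>.\<close>

lemma maximal_charts_of:
  assumes cover: "\<And>y. y \<in> S \<Longrightarrow> \<exists>U \<phi>. bp_chart S \<O> (U, \<phi>) \<and> y \<in> U \<and> (\<forall>z\<in>U. g z \<phi>)"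
    and rel: "\<And>y F G. g y F \<Longrightarrow> g y G \<Longrightarrow> germ_rel y F G"
    and closed: "\<And>y F G. g y G \<Longrightarrow> germ_rel y F G \<Longrightarrow> g y F"
  shows "maximal_bp_atlas S \<O> (charts_of g)"
  unfolding maximal_bp_atlas_def
proof (intro conjI allI impI)
  have "fst c \<subseteq> S" if "c \<in> charts_of g" for c
    using that bp_chartD(1) opn_subset by (fastforce simp: charts_of_def)
  then have "(\<Union>c\<in>charts_of g. fst c) = S"
    using cover by (fastforce simp: charts_of_def)
  then show at: "bp_atlas S \<O> (charts_of g)"
    unfolding bp_atlas_def
  proof (intro conjI ballI)
    fix c d assume cd: "c \<in> charts_of g" "d \<in> charts_of g"
    obtain U \<phi> V \<psi> where eq: "c = (U, \<phi>)" "d = (V, \<psi>)" by (metis surj_pair)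
    have c: "bp_chart S \<O> (U, \<phi>)" "\<forall>y\<in>U. g y \<phi>" and d: "bp_chart S \<O> (V, \<psi>)" "\<forall>y\<in>V. g y \<psi>"
      using cd by (auto simp: charts_of_def eq)
    show "bp_compatible S c d"
      unfolding eq bp_compatible_germ_rel[OF c(1) d(1)] using rel c d by blast
  qed (auto simp: charts_of_def)
  fix B assume B: "bp_atlas S \<O> B \<and> charts_of g \<subseteq> B"
  show "B = charts_of g"
  proof
    show "B \<subseteq> charts_of g"
    proof
      fix c assume "c \<in> B"
      obtain U \<phi> where eq: "c = (U, \<phi>)" by (metis surj_pair)
      have c: "bp_chart S \<O> (U, \<phi>)" using B \<open>c \<in> B\<close> by (auto simp: bp_atlas_def eq)
      have "g y \<phi>" if y: "y \<in> U" for y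
      proof -
        have "y \<in> S" using y bp_chartD(1)[OF c] opn_subset by blast
        then obtain V \<psi> where V: "bp_chart S \<O> (V, \<psi>)" "y \<in> V" "\<forall>z\<in>V. g z \<psi>" using cover by blast
        then have "(V, \<psi>) \<in> B" using B by (auto simp: charts_of_def)
        then have "bp_compatible S (U, \<phi>) (V, \<psi>)" using B \<open>c \<in> B\<close> by (auto simp: bp_atlas_def eq)
        then have "germ_rel y \<phi> \<psi>" using bp_compatible_germ_rel[OF c V(1)] y V(2) by blast
        then show ?thesis using closed V by blast
      qed
      then show "c \<in> charts_of g" using c by (auto simp: charts_of_def eq)
    qed
  qed (use B in blast)
qed

end

section \<open>Flat maps of a branched projective structure\<close>

locale branched = surface S \<O> for S :: "'a::topological_space set" and \<O> +
  fixes A :: "'a bp_chart set"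
  assumes maximal: "maximal_bp_atlas S \<O> A"
begin

lemma atlas_chart: "(U, \<phi>) \<in> A \<Longrightarrow> bp_chart S \<O> (U, \<phi>)"
  using maximal by (auto simp: maximal_bp_atlas_def bp_atlas_def)

lemma atlas_cover: "y \<in> S \<Longrightarrow> \<exists>U \<phi>. (U, \<phi>) \<in> A \<and> y \<in> U"
proof -
  assume "y \<in> S"
  moreover have "(\<Union>c\<in>A. fst c) = S" using maximal by (auto simp: maximal_bp_atlas_def bp_atlas_def)
  ultimately show ?thesis by force
qed

lemma atlas_germ_rel: "(U, \<phi>) \<in> A \<Longrightarrow> (V, \<psi>) \<in> A \<Longrightarrow> p \<in> U \<Longrightarrow> p \<in> V \<Longrightarrow> germ_rel p \<phi> \<psi>"
proof -
  assume *: "(U, \<phi>) \<in> A" "(V, \<psi>) \<in> A" "p \<in> U" "p \<in> V"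
  then have "bp_compatible S (U, \<phi>) (V, \<psi>)"
    using maximal by (auto simp: maximal_bp_atlas_def bp_atlas_def)
  then show ?thesis using bp_compatible_germ_rel[OF atlas_chart atlas_chart] * by blast
qed

text \<open>Locally a chart up to projective transformations. These are the locally constant sections
  of the flat bundle of germs that defines the developing map.\<close>

definition flat :: "'a set \<Rightarrow> ('a \<Rightarrow> (complex^2) set) \<Rightarrow> bool" where
  "flat N F \<longleftrightarrow> opn N \<and> (\<forall>y\<in>N. \<exists>U \<phi>. (U, \<phi>) \<in> A \<and> y \<in> U \<and> germ_rel y F \<phi>)"

lemma flat_opn: "flat N F \<Longrightarrow> opn N"
  by (simp add: flat_def)

lemma flatE:
  assumes "flat N F" "y \<in> N"
  obtains U \<phi> where "(U, \<phi>) \<in> A" "y \<in> U" "germ_rel y F \<phi>"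
  using assms by (auto simp: flat_def)

lemma flat_subset: "flat N F \<Longrightarrow> opn N' \<Longrightarrow> N' \<subseteq> N \<Longrightarrow> flat N' F"
  unfolding flat_def by blast

lemma flat_chart: "(U, \<phi>) \<in> A \<Longrightarrow> flat U \<phi>"
  unfolding flat_def using atlas_chart bp_chartD(1) bp_chart_germ_refl by blast

lemma flat_exists:
  assumes "y \<in> S" obtains N F where "flat N F" "y \<in> N"
  using atlas_cover[OF assms] flat_chart by blast

lemma flat_germ_rel:
  assumes "flat N F" "flat N' G" "y \<in> N" "y \<in> N'"
  shows "germ_rel y F G"
proof -
  obtain U \<phi> where U: "(U, \<phi>) \<in> A" "y \<in> U" "germ_rel y F \<phi>" using flatE[OF assms(1,3)] .
  obtain V \<psi> where V: "(V, \<psi>) \<in> A" "y \<in> V" "germ_rel y G \<psi>" using flatE[OF assms(2,4)] .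
  show ?thesis
    using germ_rel_trans[OF U(3) germ_rel_trans[OF atlas_germ_rel[OF U(1) V(1) U(2) V(2)] germ_rel_sym[OF V(3)]]] .
qed

lemma flat_values: "flat N F \<Longrightarrow> y \<in> N \<Longrightarrow> F y \<in> topspace CP1"
proof -
  assume "flat N F" "y \<in> N"
  then have "germ_rel y F F" using flat_germ_rel by blast
  then show ?thesis unfolding germ_rel_def by blast
qed

lemma flat_act: assumes "flat N F" "M \<in> carrier PSL2" shows "flat N (\<lambda>y. PSL2_act M (F y))"
  unfolding flat_def
proof (intro conjI ballI)
  fix y assume y: "y \<in> N"
  obtain U \<phi> where U: "(U, \<phi>) \<in> A" "y \<in> U" "germ_rel y F \<phi>" using flatE[OF assms(1) y] .
  have "germ_rel y (\<lambda>y. PSL2_act M (F y)) F"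
    by (rule germ_relI[OF flat_opn[OF assms(1)] y assms(2)]) (use flat_values[OF assms(1)] in auto)
  from germ_rel_trans[OF this U(3)]
  show "\<exists>U \<phi>. (U, \<phi>) \<in> A \<and> y \<in> U \<and> germ_rel y (\<lambda>y. PSL2_act M (F y)) \<phi>" using U by blast
qed (rule flat_opn[OF assms(1)])

text \<open>A flat map is compatible with all charts of the atlas, so that it belongs to the atlas by maximality.\<close>

lemma flat_in_atlas:
  assumes F: "flat N F"
  shows "(N, restrict F N) \<in> A"
proof -
  let ?F = "restrict F N"
  have eq: "germ_eq y ?F F" if "y \<in> N" for y
    by (rule germ_eqI[OF flat_opn[OF F] that]) simp
  have "bp_chart S \<O> (N, ?F)"
    unfolding bp_chart_def case_prod_conv
  proof (intro conjI ballI)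
    fix p assume p: "p \<in> N"
    obtain U \<phi> where U: "(U, \<phi>) \<in> A" "p \<in> U" "germ_rel p F \<phi>" using flatE[OF F p] .
    obtain m where "m \<ge> 1" "power_form_at S \<O> (U, \<phi>) p m"
      using bp_chartD(3)[OF atlas_chart[OF U(1)] U(2)] by blast
    then show "\<exists>m\<ge>1. power_form_at S \<O> (N, ?F) p m"
      using power_form_at_germ_rel[OF _ germ_rel_eq[OF eq[OF p] U(3)] flat_opn[OF F] p] by blast
  qed (use flat_opn[OF F] in auto)
  note chart = this
  have rel: "germ_rel p ?F \<psi>" if "(V, \<psi>) \<in> A" "p \<in> N" "p \<in> V" for V \<psi> p
    by (rule germ_rel_eq[OF eq[OF that(2)] flat_germ_rel[OF F flat_chart[OF that(1)] that(2,3)]])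
  have "bp_atlas S \<O> (insert (N, ?F) A)"
    unfolding bp_atlas_def
  proof (intro conjI ballI)
    show "bp_chart S \<O> c" if "c \<in> insert (N, ?F) A" for c
      using that chart atlas_chart by (cases c) auto
    have "(\<Union>c\<in>A. fst c) = S" using maximal by (auto simp: maximal_bp_atlas_def bp_atlas_def)
    then show "(\<Union>c\<in>insert (N, ?F) A. fst c) = S" using opn_subset[OF flat_opn[OF F]] by auto
    fix c d assume cd: "c \<in> insert (N, ?F) A" "d \<in> insert (N, ?F) A"
    obtain U \<phi> V \<psi> where e: "c = (U, \<phi>)" "d = (V, \<psi>)" by (metis surj_pair)
    have charts: "bp_chart S \<O> (U, \<phi>)" "bp_chart S \<O> (V, \<psi>)" using cd chart atlas_chart e by auto
    show "bp_compatible S c d"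
      unfolding e bp_compatible_germ_rel[OF charts]
    proof
      fix p assume p: "p \<in> U \<inter> V"
      show "germ_rel p \<phi> \<psi>"
      proof (cases "c \<in> A"; cases "d \<in> A")
        assume "c \<in> A" "d \<in> A" then show ?thesis using atlas_germ_rel e p by blast
      next
        assume "c \<in> A" "d \<notin> A"
        then show ?thesis using rel[of U \<phi> p] cd p e by (auto intro: germ_rel_sym)
      next
        assume "c \<notin> A" "d \<in> A"
        then show ?thesis using rel[of V \<psi> p] cd p e by auto
      next
        assume "c \<notin> A" "d \<notin> A"
        then have "(U, \<phi>) = (V, \<psi>)" using cd e by auto
        then show ?thesis using bp_chart_germ_refl[OF charts(1)] p by auto
      qed
    qed
  qed
  then have "insert (N, ?F) A = A"
    using maximal unfolding maximal_bp_atlas_def by (meson subset_insertI)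
  then show ?thesis by blast
qed

lemma flat_infinite:
  assumes F: "flat N F" and N': "opn N'" "N' \<subseteq> N" "N' \<noteq> {}"
  shows "infinite (F ` N')"
proof -
  obtain y where y: "y \<in> N'" using N' by blast
  have F': "flat N' F" by (rule flat_subset[OF F N'(1,2)])
  obtain m where m: "m \<ge> 1" "power_form_at S \<O> (N', restrict F N') y m"
    using bp_chartD(3)[OF atlas_chart[OF flat_in_atlas[OF F']] y] by blast
  have "infinite (restrict F N' ` (N' \<inter> N'))"
    by (rule power_form_at_infinite_image[OF m(2,1) N'(1) y])
  then show ?thesis by (simp add: image_restrict_eq)
qed

lemma flat_act_unique:
  assumes F: "flat N F" and N': "opn N'" "N' \<subseteq> N" "N' \<noteq> {}"
    and M: "M \<in> carrier PSL2" "M' \<in> carrier PSL2" "\<And>y. y \<in> N' \<Longrightarrow> PSL2_act M (F y) = PSL2_act M' (F y)"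
  shows "M = M'"
  by (rule PSL2_eqI_infinite[OF M(1,2) flat_infinite[OF F N']])
    (use M(3) flat_values[OF F] N'(2) in auto)

lemma flat_rel_act:
  assumes "flat N F" "flat N' G" "y \<in> N" "y \<in> N'"
  obtains M where "M \<in> carrier PSL2" "germ_eq y F (\<lambda>z. PSL2_act M (G z))"
  using flat_germ_rel[OF assms] unfolding germ_rel_def germ_eq_def by blast

text \<open>Unique continuation: the projective transformation relating two flat maps is locally
  constant, because a flat map has infinitely many values on every open set.\<close>

lemma flat_identity:
  assumes F: "flat N F" and G: "flat N G" and N: "connected N" "y \<in> N" "z \<in> N" and eq: "germ_eq y F G"
  shows "germ_eq z F G"
proof (rule connected_induction_simple[of N y z "\<lambda>z. germ_eq z F G"])
  fix a assume a: "a \<in> N"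
  obtain T M where T: "opn T" "a \<in> T" "T \<subseteq> N" "M \<in> carrier PSL2"
    "\<And>z. z \<in> T \<Longrightarrow> F z = PSL2_act M (G z)"
    by (rule germ_relE[OF flat_germ_rel[OF F G a a] flat_opn[OF F] a]) blast
  have "germ_eq v F G" if uv: "u \<in> T" "v \<in> T" "germ_eq u F G" for u v
  proof -
    obtain V where V: "opn V" "u \<in> V" "\<forall>z\<in>V. F z = G z" using uv(3) by (auto simp: germ_eq_def)
    have "M = \<one>\<^bsub>PSL2\<^esub>"
    proof (rule flat_act_unique[OF G openin_Int[OF V(1) T(1)]])
      show "PSL2_act M (G y) = PSL2_act \<one>\<^bsub>PSL2\<^esub> (G y)" if y: "y \<in> V \<inter> T" for y
      proof -
        have "G y \<in> topspace CP1" using flat_values[OF G] T(3) y by blast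
        moreover have "F y = G y" "F y = PSL2_act M (G y)" using V(3) T(5) y by auto
        ultimately show ?thesis by simp
      qed
      show "M \<in> carrier PSL2" "\<one>\<^bsub>PSL2\<^esub> \<in> carrier PSL2" using T(4) PSL2.one_closed by auto
    qed (use uv V T in auto)
    then show ?thesis
      using T flat_values[OF G] uv by (intro germ_eqI[OF T(1)]) auto
  qed
  moreover have "openin (top_of_set N) T" 
    by (rule openin_subset_trans[OF T(1,3) opn_subset[OF flat_opn[OF F]]])
  ultimately show "\<exists>T. openin (top_of_set N) T \<and> a \<in> T \<and> (\<forall>u\<in>T. \<forall>v\<in>T. germ_eq u F G \<longrightarrow> germ_eq v F G)"
    using T(2) by blast
qed (use N eq in auto)

section \<open>Analytic continuation\<close>

text \<open>A locally constant choice of germs along a map \<open>c\<close> into the surface.\<close>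

definition flat_section :: "'b::real_normed_vector set \<Rightarrow> ('b \<Rightarrow> 'a) \<Rightarrow> ('b \<Rightarrow> 'a \<Rightarrow> (complex^2) set) \<Rightarrow> bool" where
  "flat_section Z c s \<longleftrightarrow> (\<forall>z0\<in>Z. \<exists>T N F. openin (top_of_set Z) T \<and> z0 \<in> T \<and> flat N F \<and>
     (\<forall>z\<in>T. c z \<in> N \<and> germ_eq (c z) (s z) F))"

lemma flat_sectionE:
  assumes "flat_section Z c s" "z0 \<in> Z"
  obtains T N F where "openin (top_of_set Z) T" "z0 \<in> T" "flat N F"
    "\<And>z. z \<in> T \<Longrightarrow> c z \<in> N" "\<And>z. z \<in> T \<Longrightarrow> germ_eq (c z) (s z) F"
proof -
  obtain T N F where T: "openin (top_of_set Z) T \<and> z0 \<in> T \<and> flat N F \<and>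
     (\<forall>z\<in>T. c z \<in> N \<and> germ_eq (c z) (s z) F)"
    using bspec[OF assms(1)[unfolded flat_section_def] assms(2)] by (elim exE)
  show ?thesis by (rule that[of T N F]) (use T in auto)
qed

lemma flat_sectionE_point:
  assumes "flat_section Z c s" "z0 \<in> Z"
  obtains N F where "flat N F" "c z0 \<in> N" "germ_eq (c z0) (s z0) F"
  using flat_sectionE[OF assms] by metis

lemma flat_section_const:
  assumes "flat N F" "c ` Z \<subseteq> N"
  shows "flat_section Z c (\<lambda>_. F)"
  unfolding flat_section_def
proof
  fix z0 assume "z0 \<in> Z"
  moreover have "germ_eq (c z) F F" if "z \<in> Z" for z
    using assms that flat_opn by (intro germ_eqI[of N]) auto
  ultimately show "\<exists>T N F'. openin (top_of_set Z) T \<and> z0 \<in> T \<and> flat N F' \<and>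
     (\<forall>z\<in>T. c z \<in> N \<and> germ_eq (c z) F F')"
    using assms by (intro exI[of _ Z] exI[of _ N] exI[of _ F]) auto
qed

lemma flat_section_pullback:
  assumes s: "flat_section Z c s" and g: "continuous_on Y g" "g ` Y \<subseteq> Z"
    and c': "\<And>y. y \<in> Y \<Longrightarrow> c' y = c (g y)"
  shows "flat_section Y c' (\<lambda>y. s (g y))"
  unfolding flat_section_def
proof
  fix y0 assume y0: "y0 \<in> Y"
  then have "g y0 \<in> Z" using g by blast
  then obtain T N F where T: "openin (top_of_set Z) T" "g y0 \<in> T" "flat N F"
    "\<And>z. z \<in> T \<Longrightarrow> c z \<in> N" "\<And>z. z \<in> T \<Longrightarrow> germ_eq (c z) (s z) F"
    by (rule flat_sectionE[OF s]) blast
  have "openin (top_of_set Y) (Y \<inter> g -` T)"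
    using g T(1) by (intro continuous_openin_preimage) auto
  then show "\<exists>T N F. openin (top_of_set Y) T \<and> y0 \<in> T \<and> flat N F \<and>
      (\<forall>z\<in>T. c' z \<in> N \<and> germ_eq (c' z) (s (g z)) F)"
    using T y0 c' by (intro exI[of _ "Y \<inter> g -` T"] exI[of _ N] exI[of _ F]) auto
qed

lemma flat_section_subset:
  "flat_section Z c s \<Longrightarrow> Y \<subseteq> Z \<Longrightarrow> flat_section Y c s"
  using flat_section_pullback[of Z c s Y "\<lambda>y. y" c] by auto

lemma flat_section_act:
  assumes "flat_section Z c s" "M \<in> carrier PSL2"
  shows "flat_section Z c (\<lambda>z y. PSL2_act M (s z y))"
  unfolding flat_section_def
proof
  fix z0 assume "z0 \<in> Z"
  then obtain T N F where T: "openin (top_of_set Z) T" "z0 \<in> T" "flat N F"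
    "\<And>z. z \<in> T \<Longrightarrow> c z \<in> N" "\<And>z. z \<in> T \<Longrightarrow> germ_eq (c z) (s z) F"
    by (rule flat_sectionE[OF assms(1)]) blast
  then show "\<exists>T N F. openin (top_of_set Z) T \<and> z0 \<in> T \<and> flat N F \<and>
      (\<forall>z\<in>T. c z \<in> N \<and> germ_eq (c z) (\<lambda>y. PSL2_act M (s z y)) F)"
    using flat_act[OF T(3) assms(2)] germ_eq_act[OF T(5)]
    by (intro exI[of _ T] exI[of _ N] exI[of _ "\<lambda>y. PSL2_act M (F y)"]) auto
qed

text \<open>Two sections that agree at one parameter agree nearby by unique continuation, and \<open>Z\<close> is connected.\<close>

lemma flat_section_unique:
  assumes s: "flat_section Z c s" "flat_section Z c s'"
    and c: "continuous_on Z c" "c ` Z \<subseteq> S" and Z: "connected Z" "z1 \<in> Z" "z2 \<in> Z"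
    and eq: "germ_eq (c z1) (s z1) (s' z1)"
  shows "germ_eq (c z2) (s z2) (s' z2)"
proof (rule connected_induction_simple[of Z z1 z2 "\<lambda>z. germ_eq (c z) (s z) (s' z)"])
  fix z0 assume z0: "z0 \<in> Z"
  obtain T N F where T: "openin (top_of_set Z) T" "z0 \<in> T" "flat N F"
    "\<And>z. z \<in> T \<Longrightarrow> c z \<in> N" "\<And>z. z \<in> T \<Longrightarrow> germ_eq (c z) (s z) F"
    by (rule flat_sectionE[OF s(1) z0]) blast
  obtain T' N' F' where T': "openin (top_of_set Z) T'" "z0 \<in> T'" "flat N' F'"
    "\<And>z. z \<in> T' \<Longrightarrow> c z \<in> N'" "\<And>z. z \<in> T' \<Longrightarrow> germ_eq (c z) (s' z) F'"
    by (rule flat_sectionE[OF s(2) z0]) blast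
  have "opn (N \<inter> N')" "c z0 \<in> N \<inter> N'"
    using openin_Int[OF flat_opn[OF T(3)] flat_opn[OF T'(3)]] T T' by auto
  then obtain W where W: "disc W" "c z0 \<in> W" "W \<subseteq> N \<inter> N'" by (rule disc_nbhd)
  have FW: "flat W F" "flat W F'"
    using flat_subset[OF T(3) disc_opn[OF W(1)]] flat_subset[OF T'(3) disc_opn[OF W(1)]] W(3) by auto
  define R where "R = T \<inter> T' \<inter> (Z \<inter> c -` W)"
  have pre: "openin (top_of_set Z) (Z \<inter> c -` W)"
    using c disc_opn[OF W(1)] by (intro continuous_openin_preimage) auto
  have R: "openin (top_of_set Z) R"
    unfolding R_def by (rule openin_Int[OF openin_Int[OF T(1) T'(1)] pre])
  have "germ_eq (c v) (s v) (s' v)" if uv: "u \<in> R" "v \<in> R" "germ_eq (c u) (s u) (s' u)" for u v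
  proof -
    have u: "germ_eq (c u) (s u) F" "germ_eq (c u) (s' u) F'" and v: "germ_eq (c v) (s v) F" "germ_eq (c v) (s' v) F'"
      using T(5) T'(5) uv by (auto simp: R_def)
    have "germ_eq (c u) F F'"
      by (rule germ_eq_trans[OF germ_eq_trans[OF germ_eq_sym[OF u(1)] uv(3)] u(2)])
    then have "germ_eq (c v) F F'"
      using flat_identity[OF FW connected_disc[OF W(1)]] uv by (auto simp: R_def)
    from germ_eq_trans[OF germ_eq_trans[OF v(1) this] germ_eq_sym[OF v(2)]] show ?thesis .
  qed
  moreover have "z0 \<in> R" using T T' W z0 by (auto simp: R_def)
  ultimately show "\<exists>T. openin (top_of_set Z) T \<and> z0 \<in> T \<and>
      (\<forall>u\<in>T. \<forall>v\<in>T. germ_eq (c u) (s u) (s' u) \<longrightarrow> germ_eq (c v) (s v) (s' v))"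
    using R by blast
qed (use Z eq in auto)

lemma flat_section_glue:
  assumes X: "closed X" "closed Y" and c: "continuous_on (X \<union> Y) c" "c ` (X \<union> Y) \<subseteq> S"
    and s: "flat_section X c s1" "flat_section Y c s2"
    and eq: "\<And>z. z \<in> X \<Longrightarrow> z \<in> Y \<Longrightarrow> germ_eq (c z) (s1 z) (s2 z)"
  shows "flat_section (X \<union> Y) c (\<lambda>z. if z \<in> X then s1 z else s2 z)"
  unfolding flat_section_def
proof
  fix z0 assume z0: "z0 \<in> X \<union> Y"
  let ?s = "\<lambda>z. if z \<in> X then s1 z else s2 z"
  consider "z0 \<in> X" "z0 \<notin> Y" | "z0 \<notin> X" "z0 \<in> Y" | "z0 \<in> X" "z0 \<in> Y" using z0 by blast
  then show "\<exists>T N F. openin (top_of_set (X \<union> Y)) T \<and> z0 \<in> T \<and> flat N F \<and>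
      (\<forall>z\<in>T. c z \<in> N \<and> germ_eq (c z) (?s z) F)"
  proof cases
    case 1
    obtain T N F where T: "openin (top_of_set X) T" "z0 \<in> T" "flat N F"
      "\<And>z. z \<in> T \<Longrightarrow> c z \<in> N" "\<And>z. z \<in> T \<Longrightarrow> germ_eq (c z) (s1 z) F"
      by (rule flat_sectionE[OF s(1) 1(1)]) blast
    obtain B where B: "open B" "T = X \<inter> B" using T(1) by (auto simp: openin_open)
    have "openin (top_of_set (X \<union> Y)) ((X \<union> Y) \<inter> (B - Y))"
      using B(1) X(2) by (intro openin_open_Int open_Diff)
    then show ?thesis
      using T B 1 by (intro exI[of _ "(X \<union> Y) \<inter> (B - Y)"] exI[of _ N] exI[of _ F]) auto
  next
    case 2
    obtain T N F where T: "openin (top_of_set Y) T" "z0 \<in> T" "flat N F"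
      "\<And>z. z \<in> T \<Longrightarrow> c z \<in> N" "\<And>z. z \<in> T \<Longrightarrow> germ_eq (c z) (s2 z) F"
      by (rule flat_sectionE[OF s(2) 2(2)]) blast
    obtain B where B: "open B" "T = Y \<inter> B" using T(1) by (auto simp: openin_open)
    have "openin (top_of_set (X \<union> Y)) ((X \<union> Y) \<inter> (B - X))"
      using B(1) X(1) by (intro openin_open_Int open_Diff)
    then show ?thesis
      using T B 2 by (intro exI[of _ "(X \<union> Y) \<inter> (B - X)"] exI[of _ N] exI[of _ F]) auto
  next
    case 3
    obtain T N F where T: "openin (top_of_set X) T" "z0 \<in> T" "flat N F"
      "\<And>z. z \<in> T \<Longrightarrow> c z \<in> N" "\<And>z. z \<in> T \<Longrightarrow> germ_eq (c z) (s1 z) F"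
      by (rule flat_sectionE[OF s(1) 3(1)]) blast
    obtain T' N' F' where T': "openin (top_of_set Y) T'" "z0 \<in> T'" "flat N' F'"
      "\<And>z. z \<in> T' \<Longrightarrow> c z \<in> N'" "\<And>z. z \<in> T' \<Longrightarrow> germ_eq (c z) (s2 z) F'"
      by (rule flat_sectionE[OF s(2) 3(2)]) blast
    obtain B where B: "open B" "T = X \<inter> B" using T(1) by (auto simp: openin_open)
    obtain B' where B': "open B'" "T' = Y \<inter> B'" using T'(1) by (auto simp: openin_open)
    have "germ_eq (c z0) F F'"
      by (rule germ_eq_trans[OF germ_eq_trans[OF germ_eq_sym[OF T(5)[OF T(2)]] eq[OF 3]] T'(5)[OF T'(2)]])
    then obtain V where V: "opn V" "c z0 \<in> V" "\<forall>z\<in>V. F z = F' z" by (auto simp: germ_eq_def)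
    define N1 where "N1 = N \<inter> V"
    have N1: "opn N1" "c z0 \<in> N1" using openin_Int[OF flat_opn[OF T(3)] V(1)] T V by (auto simp: N1_def)
    define R where "R = (X \<union> Y) \<inter> (B \<inter> B') \<inter> ((X \<union> Y) \<inter> c -` N1)"
    have pre: "openin (top_of_set (X \<union> Y)) ((X \<union> Y) \<inter> c -` N1)"
      using c N1(1) by (intro continuous_openin_preimage) auto
    have R: "openin (top_of_set (X \<union> Y)) R"
      unfolding R_def by (rule openin_Int[OF openin_open_Int[OF open_Int[OF B(1) B'(1)]] pre])
    have "germ_eq (c z) (?s z) F" if z: "z \<in> R" for z
    proof (cases "z \<in> X")
      case True
      then have "z \<in> T" using z B by (auto simp: R_def)
      then show ?thesis using T(5) True by simp
    next
      case False
      then have "z \<in> T'" using z B' by (auto simp: R_def)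
      then have 1: "germ_eq (c z) (s2 z) F'" by (rule T'(5))
      have "germ_eq (c z) F' F"
        by (rule germ_eqI[OF V(1)]) (use z V in \<open>auto simp: R_def N1_def\<close>)
      from germ_eq_trans[OF 1 this] show ?thesis using False by simp
    qed
    moreover have "c z \<in> N" if "z \<in> R" for z using that by (auto simp: R_def N1_def)
    moreover have "z0 \<in> R" using T T' B B' N1 3 by (auto simp: R_def)
    ultimately show ?thesis using R T(3) by blast
  qed
qed

lemma flat_section_normalise:
  assumes s: "flat_section Z c s" "z1 \<in> Z" and F: "flat N F" "c z1 \<in> N"
  obtains s' where "flat_section Z c s'" "germ_eq (c z1) (s' z1) F"
proof -
  obtain N' G where G: "flat N' G" "c z1 \<in> N'" "germ_eq (c z1) (s z1) G"
    by (rule flat_sectionE_point[OF s]) blast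
  obtain M where M: "M \<in> carrier PSL2" "germ_eq (c z1) F (\<lambda>z. PSL2_act M (G z))"
    by (rule flat_rel_act[OF F(1) G(1) F(2) G(2)]) blast
  have "germ_eq (c z1) (\<lambda>y. PSL2_act M (s z1 y)) F"
    by (rule germ_eq_trans[OF germ_eq_act[OF G(3)] germ_eq_sym[OF M(2)]])
  then show ?thesis using that flat_section_act[OF s(1) M(1)] by blast
qed

text \<open>After a projective transformation the two sections agree at one point of the intersection, hence on
  all of it, since it is connected.\<close>

lemma flat_section_join:
  assumes X: "closed X" "closed Y" and c: "continuous_on (X \<union> Y) c" "c ` (X \<union> Y) \<subseteq> S"
    and s: "flat_section X c s1" "flat_section Y c s2" and con: "connected (X \<inter> Y)" "z1 \<in> X \<inter> Y"
  shows "\<exists>s. flat_section (X \<union> Y) c s"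
proof -
  obtain N F where F: "flat N F" "c z1 \<in> N" "germ_eq (c z1) (s1 z1) F"
    by (rule flat_sectionE_point[OF s(1), of z1]) (use con in auto)
  obtain s2' where s2': "flat_section Y c s2'" "germ_eq (c z1) (s2' z1) F"
    by (rule flat_section_normalise[OF s(2) _ F(1,2)]) (use con in auto)
  have "germ_eq (c z) (s1 z) (s2' z)" if "z \<in> X" "z \<in> Y" for z
  proof (rule flat_section_unique[of "X \<inter> Y" c s1 s2' z1 z])
    show "flat_section (X \<inter> Y) c s1" "flat_section (X \<inter> Y) c s2'"
      using flat_section_subset[OF s(1)] flat_section_subset[OF s2'(1)] by auto
    show "continuous_on (X \<inter> Y) c" using c(1) by (rule continuous_on_subset) auto
    show "germ_eq (c z1) (s1 z1) (s2' z1)" by (rule germ_eq_trans[OF F(3) germ_eq_sym[OF s2'(2)]])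
  qed (use c con that in auto)
  from flat_section_glue[OF X c s(1) s2'(1) this] show ?thesis by blast
qed

text \<open>A square carries no monodromy. It is cut into thin strips, and each strip into small
  rectangles on which a single flat map serves; neighbouring pieces meet in a connected edge.\<close>

lemma flat_section_square:
  fixes c :: "real \<times> real \<Rightarrow> 'a"
  assumes c: "continuous_on ({0..1} \<times> {0..1}) c" "c ` ({0..1} \<times> {0..1}) \<subseteq> S"
  shows "\<exists>s. flat_section ({0..1} \<times> {0..1}) c s"
proof -
  let ?Q = "{0..1} \<times> {0..1} :: (real \<times> real) set"
  have sub: "continuous_on Z c" "c ` Z \<subseteq> S" if "Z \<subseteq> ?Q" for Z
    using c that by (auto intro: continuous_on_subset)
  \<comment> \<open>every narrow strip around the abscissa \<open>x\<close> carries a section, by bisection of its height\<close>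
  have strip: "\<exists>\<delta>>0. \<forall>a b. 0 \<le> a \<and> a \<le> x \<and> x \<le> b \<and> b \<le> 1 \<and> b - a < \<delta> \<longrightarrow>
      (\<exists>s. flat_section ({a..b} \<times> {0..1}) c s)" if x: "0 \<le> x" "x \<le> 1" for x
  proof -
    define P where "P u v \<longleftrightarrow> (0 \<le> u \<longrightarrow> v \<le> 1 \<longrightarrow> (\<exists>\<delta>>0. \<forall>a b. 0 \<le> a \<and> a \<le> x \<and> x \<le> b \<and> b \<le> 1 \<and> b - a < \<delta> \<longrightarrow>
      (\<exists>s. flat_section ({a..b} \<times> {u..v}) c s)))" for u v
    have "P 0 1"
    proof (rule Bolzano)
      fix u v w assume *: "P u v" "P v w" "u \<le> v" "v \<le> w"
      show "P u w" unfolding P_def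
      proof (intro impI)
        assume uw: "0 \<le> u" "w \<le> 1"
        then obtain \<delta> where \<delta>: "\<delta> > 0" "\<And>a b. 0 \<le> a \<and> a \<le> x \<and> x \<le> b \<and> b \<le> 1 \<and> b - a < \<delta> \<Longrightarrow>
            \<exists>s. flat_section ({a..b} \<times> {u..v}) c s" using * unfolding P_def by force
        obtain \<delta>' where \<delta>': "\<delta>' > 0" "\<And>a b. 0 \<le> a \<and> a \<le> x \<and> x \<le> b \<and> b \<le> 1 \<and> b - a < \<delta>' \<Longrightarrow>
            \<exists>s. flat_section ({a..b} \<times> {v..w}) c s" using * uw unfolding P_def by force
        have "\<exists>s. flat_section ({a..b} \<times> {u..w}) c s"
          if ab: "0 \<le> a \<and> a \<le> x \<and> x \<le> b \<and> b \<le> 1 \<and> b - a < min \<delta> \<delta>'" for a b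
        proof -
          have "\<exists>s. flat_section ({a..b} \<times> {u..v}) c s" by (rule \<delta>(2)) (use ab in simp)
          then obtain s1 where s1: "flat_section ({a..b} \<times> {u..v}) c s1" by blast
          have "\<exists>s. flat_section ({a..b} \<times> {v..w}) c s" by (rule \<delta>'(2)) (use ab in simp)
          then obtain s2 where s2: "flat_section ({a..b} \<times> {v..w}) c s2" by blast
          have un: "{a..b} \<times> {u..v} \<union> {a..b} \<times> {v..w} = {a..b} \<times> {u..w}" using *(3,4) by auto
          have int: "({a..b} \<times> {u..v}) \<inter> ({a..b} \<times> {v..w}) = {a..b} \<times> {v}" using *(3,4) by auto
          have Q: "{a..b} \<times> {u..w} \<subseteq> ?Q" using ab uw by auto
          show ?thesis
            using flat_section_join[of "{a..b} \<times> {u..v}" "{a..b} \<times> {v..w}" c s1 s2 "(x, v)"]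
              s1 s2 sub[OF Q] ab unfolding un int
            by (simp add: closed_Times connected_Times)
        qed
        then show "\<exists>\<delta>>0. \<forall>a b. 0 \<le> a \<and> a \<le> x \<and> x \<le> b \<and> b \<le> 1 \<and> b - a < \<delta> \<longrightarrow>
            (\<exists>s. flat_section ({a..b} \<times> {u..w}) c s)"
          using \<delta>(1) \<delta>'(1) by (intro exI[of _ "min \<delta> \<delta>'"]) simp
      qed
    next
      fix t :: real assume t: "0 \<le> t" "t \<le> 1"
      then have "c (x, t) \<in> S" using c x by auto
      then obtain N F where F: "flat N F" "c (x, t) \<in> N" by (rule flat_exists)
      have "openin (top_of_set ?Q) (?Q \<inter> c -` N)"
        using c flat_opn[OF F(1)] by (intro continuous_openin_preimage) auto
      then have "\<forall>z\<in>?Q \<inter> c -` N. \<exists>e>0. ball z e \<inter> ?Q \<subseteq> ?Q \<inter> c -` N"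
        unfolding openin_contains_ball by (rule conjunct2)
      moreover have "(x, t) \<in> ?Q \<inter> c -` N" using x t F by auto
      ultimately obtain e where e: "e > 0" "ball (x, t) e \<inter> ?Q \<subseteq> ?Q \<inter> c -` N" by blast
      have "P u v" if uv: "u \<le> t \<and> t \<le> v \<and> v - u < e/2" for u v
        unfolding P_def
      proof (intro impI exI[of _ "e/2"] conjI allI)
        fix a b assume uv1: "0 \<le> u" "v \<le> 1" and ab: "0 \<le> a \<and> a \<le> x \<and> x \<le> b \<and> b \<le> 1 \<and> b - a < e/2"
        have "{a..b} \<times> {u..v} \<subseteq> ball (x, t) e \<inter> ?Q"
        proof
          fix z assume z: "z \<in> {a..b} \<times> {u..v}"
          obtain z1 z2 where zz: "z = (z1, z2)" by (rule prod.exhaust)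
          have "dist (x, t) z \<le> dist x z1 + dist t z2"
            unfolding zz dist_Pair_Pair by (rule sqrt_sum_squares_le_sum) auto
          also have "\<dots> < e" using z zz ab uv by (auto simp: dist_real_def)
          finally show "z \<in> ball (x, t) e \<inter> ?Q" using z zz ab uv1 by auto
        qed
        then have "c ` ({a..b} \<times> {u..v}) \<subseteq> N" using e(2) by blast
        then show "\<exists>s. flat_section ({a..b} \<times> {u..v}) c s"
          using flat_section_const[OF F(1)] by blast
      qed (use e in auto)
      then show "\<exists>d>0. \<forall>u v. u \<le> t \<and> t \<le> v \<and> v - u < d \<longrightarrow> P u v"
        using e(1) by (intro exI[of _ "e/2"]) auto
    qed simp
    then show ?thesis by (simp add: P_def)
  qed
  define P where "P a b \<longleftrightarrow> (0 \<le> a \<longrightarrow> b \<le> 1 \<longrightarrow> (\<exists>s. flat_section ({a..b} \<times> {0..1}) c s))" for a b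
  have "P 0 1"
  proof (rule Bolzano)
    fix u v w assume *: "P u v" "P v w" "u \<le> v" "v \<le> w"
    show "P u w" unfolding P_def
    proof (intro impI)
      assume uw: "0 \<le> u" "w \<le> 1"
      obtain s1 where s1: "flat_section ({u..v} \<times> {0..1}) c s1" using * uw unfolding P_def by force
      obtain s2 where s2: "flat_section ({v..w} \<times> {0..1}) c s2" using * uw unfolding P_def by force
      have un: "{u..v} \<times> {0..1} \<union> {v..w} \<times> {0..1} = {u..w} \<times> {0..1::real}" using *(3,4) by auto
      have int: "({u..v} \<times> {0..1}) \<inter> ({v..w} \<times> {0..1}) = {v} \<times> {0..1::real}" using *(3,4) by auto
      have Q: "{u..w} \<times> {0..1} \<subseteq> ?Q" using uw by auto
      show "\<exists>s. flat_section ({u..w} \<times> {0..1}) c s"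
        using flat_section_join[of "{u..v} \<times> {0..1}" "{v..w} \<times> {0..1}" c s1 s2 "(v, 0)"]
          s1 s2 sub[OF Q] unfolding un int
        by (simp add: closed_Times connected_Times)
    qed
  next
    fix x :: real assume x: "0 \<le> x" "x \<le> 1"
    obtain \<delta> where "\<delta> > 0" "\<forall>a b. 0 \<le> a \<and> a \<le> x \<and> x \<le> b \<and> b \<le> 1 \<and> b - a < \<delta> \<longrightarrow>
      (\<exists>s. flat_section ({a..b} \<times> {0..1}) c s)" using strip[OF x] by blast
    then show "\<exists>d>0. \<forall>a b. a \<le> x \<and> x \<le> b \<and> b - a < d \<longrightarrow> P a b"
      unfolding P_def by blast
  qed simp
  then show ?thesis by (simp add: P_def)
qed

end

section \<open>Developing maps and holonomy\<close>

lemma topspace_Hom_topology: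
  "topspace (Hom_topology G) = hom G PSL2 \<inter> extensional (carrier G)"
proof -
  have "hom G PSL2 \<inter> extensional (carrier G) \<subseteq> (\<Pi>\<^sub>E g\<in>carrier G. carrier PSL2)"
    by (auto simp: hom_def PiE_def)
  then show ?thesis
    by (auto simp: Hom_topology_def topspace_PSL2_topology)
qed

lemma cover_proj_sheet:
  assumes "pth S p" "U \<subseteq> S" "Q \<in> sheet S p U"
  shows "cover_proj Q \<in> U"
proof -
  obtain q where q: "pth U q" "pathstart q = pathfinish p" "Q = path_class S (p +++ q)"
    using assms(3) by (auto simp: sheet_def)
  then have "pth S (p +++ q)" using assms(1) pth_mono[OF q(1) assms(2)] by simp
  then show ?thesis using q pth_ends(2)[OF q(1)] by simp
qed

context branched
begin

text \<open>By maximality any flat map may replace a chart of the atlas, and sheets may replace open sets.\<close>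

lemma developing_map_iff:
  "developing_map S x A f \<longleftrightarrow> (\<forall>p. pth S p \<and> pathstart p = x \<longrightarrow>
     (\<exists>N F. flat N F \<and> pathfinish p \<in> N \<and> (\<forall>Q\<in>sheet S p N. f Q = F (cover_proj Q))))"
  (is "?L \<longleftrightarrow> ?R")
proof
  assume L: ?L
  show ?R
  proof (intro allI impI)
    fix p assume p: "pth S p \<and> pathstart p = x"
    then have "path_class S p \<in> topspace (universal_cover S x)"
      by (simp add: topspace_universal_cover ucoverI)
    from bspec[OF L[unfolded developing_map_def] this]
    obtain V c where V: "openin (universal_cover S x) V" "path_class S p \<in> V" "c \<in> A"
      "case c of (U, \<phi>) \<Rightarrow> \<forall>Q\<in>V. cover_proj Q \<in> U \<and> f Q = \<phi> (cover_proj Q)"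
      by (elim exE conjE bexE)
    obtain U \<phi> where c: "c = (U, \<phi>)" by (rule prod.exhaust)
    have U: "(U, \<phi>) \<in> A" "\<And>Q. Q \<in> V \<Longrightarrow> cover_proj Q \<in> U" "\<And>Q. Q \<in> V \<Longrightarrow> f Q = \<phi> (cover_proj Q)"
      using V(3,4) by (auto simp: c)
    have "\<exists>U. opn U \<and> pathfinish p \<in> U \<and> sheet S p U \<subseteq> V"
      by (rule conjunct2[OF V(1)[unfolded openin_universal_cover], rule_format]) (use p V(2) in simp)
    then obtain U' where U': "opn U'" "pathfinish p \<in> U'" "sheet S p U' \<subseteq> V" by blast
    have "opn (U \<inter> U')" using flat_opn[OF flat_chart[OF U(1)]] U'(1) by (rule openin_Int)
    then have fl: "flat (U \<inter> U') \<phi>" using flat_subset[OF flat_chart[OF U(1)]] by blast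
    have "pathfinish p \<in> U" using U(2)[OF V(2)] p by simp
    moreover have "f Q = \<phi> (cover_proj Q)" if "Q \<in> sheet S p (U \<inter> U')" for Q
      using U(3) U'(3) sheet_mono[of "U \<inter> U'" U' S p] that by blast
    ultimately show "\<exists>N F. flat N F \<and> pathfinish p \<in> N \<and> (\<forall>Q\<in>sheet S p N. f Q = F (cover_proj Q))"
      using fl U'(2) by (intro exI[of _ "U \<inter> U'"] exI[of _ \<phi>]) simp
  qed
next
  assume R: ?R
  show ?L
    unfolding developing_map_def topspace_universal_cover
  proof
    fix P assume "P \<in> ucover S x"
    then obtain p where p: "pth S p" "pathstart p = x" "P = path_class S p" by (rule ucoverE)
    obtain N F where N: "flat N F" "pathfinish p \<in> N" "\<forall>Q\<in>sheet S p N. f Q = F (cover_proj Q)"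
      using R p by blast
    have proj: "cover_proj Q \<in> N" if "Q \<in> sheet S p N" for Q
      by (rule cover_proj_sheet[OF p(1) opn_subset[OF flat_opn[OF N(1)]] that])
    show "\<exists>V. openin (universal_cover S x) V \<and> P \<in> V \<and>
      (\<exists>(U, \<phi>)\<in>A. \<forall>Q\<in>V. cover_proj Q \<in> U \<and> f Q = \<phi> (cover_proj Q))"
    proof (intro exI[of _ "sheet S p N"] conjI bexI[OF _ flat_in_atlas[OF N(1)]])
      show "openin (universal_cover S x) (sheet S p N)"
        by (rule openin_sheet[OF p(1,2) flat_opn[OF N(1)] N(2)])
      show "P \<in> sheet S p N" unfolding p(3) by (rule mem_sheet_self[OF p(1) N(2)])
      show "case (N, restrict F N) of (U, \<phi>) \<Rightarrow> \<forall>Q\<in>sheet S p N. cover_proj Q \<in> U \<and> f Q = \<phi> (cover_proj Q)"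
        using N(3) proj by simp
    qed
  qed
qed

lemma developingE:
  assumes "developing_map S x A f" "pth S p" "pathstart p = x"
  obtains N F where "flat N F" "pathfinish p \<in> N" "\<And>Q. Q \<in> sheet S p N \<Longrightarrow> f Q = F (cover_proj Q)"
proof -
  have "\<exists>N F. flat N F \<and> pathfinish p \<in> N \<and> (\<forall>Q\<in>sheet S p N. f Q = F (cover_proj Q))"
    by (rule assms(1)[unfolded developing_map_iff, rule_format]) (use assms(2,3) in simp)
  then show ?thesis using that by blast
qed

subsection \<open>Existence\<close>

text \<open>Analytic continuation of the germ of \<open>F0\<close> along \<open>p\<close>; the germ at the end of \<open>p\<close> is that of \<open>s 1\<close>.\<close>

definition continues :: "'a \<Rightarrow> ('a \<Rightarrow> (complex^2) set) \<Rightarrow> (real \<Rightarrow> 'a) \<Rightarrow> (real \<Rightarrow> 'a \<Rightarrow> (complex^2) set) \<Rightarrow> bool" where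
  "continues x F0 p s \<longleftrightarrow> flat_section {0..1} p s \<and> germ_eq x (s 0) F0"

lemma continuation_exists:
  assumes F0: "flat N0 F0" "x \<in> N0" and p: "pth S p" "pathstart p = x"
  obtains s where "continues x F0 p s"
proof -
  have cp: "continuous_on {0..1} p" "p ` {0..1} \<subseteq> S" using p by (auto simp: pth_def path_def path_image_def)
  have "continuous_on ({0..1} \<times> {0..1}) (\<lambda>z. p (snd z))"
    by (rule continuous_on_compose2[OF cp(1)]) (auto intro!: continuous_intros)
  moreover have "(\<lambda>z. p (snd z)) ` ({0..1} \<times> {0..1}) \<subseteq> S" using cp(2) by auto
  ultimately obtain \<sigma> where \<sigma>: "flat_section ({0..1::real} \<times> {0..1}) (\<lambda>z. p (snd z)) \<sigma>"
    using flat_section_square[of "\<lambda>z. p (snd z)"] by blast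
  have "flat_section {0..1} p (\<lambda>t. \<sigma> (0, t))"
    by (rule flat_section_pullback[OF \<sigma>]) (auto intro!: continuous_intros)
  moreover have "p 0 = x" using p by (simp add: pathstart_def)
  ultimately show ?thesis
    using flat_section_normalise[of "{0..1}" p "\<lambda>t. \<sigma> (0, t)" 0 N0 F0] F0 that
    by (auto simp: continues_def)
qed

text \<open>A homotopy is a square in the surface. A flat section over the square, normalised at a corner,
  restricts to the continuations along \<open>p\<close> and \<open>q\<close>, and it is constant on the sides on which the
  homotopy fixes the end points.\<close>

lemma continuation_homotopic:
  assumes F0: "flat N0 F0" "x \<in> N0" and hom: "homotopic_paths S p q" and x: "pathstart p = x"
    and s: "continues x F0 p s" "continues x F0 q s'"
  shows "germ_eq (pathfinish p) (s 1) (s' 1)"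
proof -
  obtain h :: "real \<times> real \<Rightarrow> 'a" where h: "continuous_on ({0..1} \<times> {0..1}) h" "h \<in> ({0..1} \<times> {0..1}) \<rightarrow> S"
    "\<forall>t\<in>{0..1}. h (0, t) = p t" "\<forall>t\<in>{0..1}. h (1, t) = q t"
    "\<forall>u\<in>{0..1}. pathstart (h \<circ> Pair u) = pathstart p \<and> pathfinish (h \<circ> Pair u) = pathfinish p"
    using hom unfolding homotopic_paths by blast
  define y where "y = pathfinish p"
  have ends: "h (u, 0) = x" "h (u, 1) = y" if "u \<in> {0..1}" for u
    using h(5) that x by (auto simp: pathstart_def pathfinish_def y_def)
  have p01: "p 0 = x" "p 1 = y" "q 0 = x" "q 1 = y"
    using x ends[of 0] ends[of 1] h(3,4) by (auto simp: pathstart_def y_def pathfinish_def)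
  have hS: "h ` ({0..1::real} \<times> {0..1::real}) \<subseteq> S" using h(2) by blast
  obtain \<sigma>0 where \<sigma>0: "flat_section ({0..1} \<times> {0..1}) h \<sigma>0"
    using flat_section_square[OF h(1) hS] by blast
  obtain \<sigma> where \<sigma>: "flat_section ({0..1::real} \<times> {0..1::real}) h \<sigma>" "germ_eq (h (0, 0)) (\<sigma> (0, 0)) F0"
    by (rule flat_section_normalise[OF \<sigma>0, of "(0, 0)" N0 F0]) (use F0 ends in auto)
  have edge: "flat_section {0..1} c (\<lambda>t. \<sigma> (g t))"
    if "continuous_on {0..1} g" "g ` {0..1} \<subseteq> {0..1} \<times> {0..1}" "\<And>t. t \<in> {0..1} \<Longrightarrow> c t = h (g t)"
    for c and g :: "real \<Rightarrow> real \<times> real"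
    by (rule flat_section_pullback[OF \<sigma>(1) that])
  have e0: "flat_section {0..1} p (\<lambda>t. \<sigma> (0, t))"
    by (rule edge) (use h in \<open>auto intro!: continuous_intros\<close>)
  have e1: "flat_section {0..1} q (\<lambda>t. \<sigma> (1, t))"
    by (rule edge) (use h in \<open>auto intro!: continuous_intros\<close>)
  have eL: "flat_section {0..1} (\<lambda>_. x) (\<lambda>t. \<sigma> (t, 0))"
    by (rule edge) (use ends in \<open>auto intro!: continuous_intros\<close>)
  have eR: "flat_section {0..1} (\<lambda>_. y) (\<lambda>t. \<sigma> (t, 1))"
    by (rule edge) (use ends in \<open>auto intro!: continuous_intros\<close>)
  have paths: "continuous_on {0..1} p" "p ` {0..1} \<subseteq> S" "continuous_on {0..1} q" "q ` {0..1} \<subseteq> S"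
    using homotopic_paths_imp_path[OF hom] homotopic_paths_imp_subset[OF hom]
    by (auto simp: path_def path_image_def)
  then have xy: "x \<in> S" "y \<in> S" using p01 by force+
  have s1: "flat_section {0..1} p s" "germ_eq x (s 0) F0" "flat_section {0..1} q s'" "germ_eq x (s' 0) F0"
    using s by (auto simp: continues_def)
  have a: "germ_eq x (\<sigma> (0, 0)) F0" using \<sigma>(2) ends by simp
  have b: "germ_eq y (\<sigma> (0, 1)) (s 1)"
    using flat_section_unique[OF e0 s1(1) paths(1,2), of 0 1] germ_eq_trans[OF a germ_eq_sym[OF s1(2)]] p01
    by simp
  have "germ_eq x (\<sigma> (1, 0)) F0"
    using flat_section_unique[OF eL flat_section_const[OF F0(1)], of 0 1] F0(2) xy a by auto
  then have c: "germ_eq y (\<sigma> (1, 1)) (s' 1)"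
    using flat_section_unique[OF e1 s1(3) paths(3,4), of 0 1] germ_eq_trans[OF _ germ_eq_sym[OF s1(4)]] p01
    by simp
  obtain N F where F: "flat N F" "y \<in> N" "germ_eq y (\<sigma> (0, 1)) F"
    by (rule flat_sectionE_point[OF eR, of 0]) auto
  have "germ_eq y (\<sigma> (1, 1)) F"
    using flat_section_unique[OF eR flat_section_const[OF F(1)], of 0 1] F(2,3) xy by auto
  then have "germ_eq y (\<sigma> (0, 1)) (\<sigma> (1, 1))" using germ_eq_trans[OF F(3) germ_eq_sym] by blast
  from germ_eq_trans[OF germ_eq_trans[OF germ_eq_sym[OF b] this] c] show ?thesis by (simp add: y_def)
qed

lemma continues_join:
  assumes s: "continues x F0 p s" and p: "pth S p"
    and F: "flat N F" "germ_eq (pathfinish p) (s 1) F" and q: "pth N q" "pathstart q = pathfinish p"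
  shows "continues x F0 (p +++ q) (\<lambda>t. if t \<in> {0..1/2} then s (2 * t) else F)"
proof -
  let ?X = "{0..1/2::real}" and ?Y = "{1/2..1::real}"
  have un: "?X \<union> ?Y = {0..1}" by auto
  have "pth S q" by (rule pth_mono[OF q(1) opn_subset[OF flat_opn[OF F(1)]]])
  then have pq: "pth S (p +++ q)" using p q by simp
  have "flat_section (?X \<union> ?Y) (p +++ q) (\<lambda>t. if t \<in> ?X then s (2 * t) else F)"
  proof (rule flat_section_glue)
    show "continuous_on (?X \<union> ?Y) (p +++ q)" "(p +++ q) ` (?X \<union> ?Y) \<subseteq> S"
      unfolding un using pq by (auto simp: pth_def path_def path_image_def)
    have "flat_section {0..1} p s" using s by (simp add: continues_def)
    then show "flat_section ?X (p +++ q) (\<lambda>t. s (2 * t))"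
      by (rule flat_section_pullback) (auto simp: joinpaths_def intro!: continuous_intros)
    have "(p +++ q) t \<in> N" if "t \<in> ?Y" for t
    proof (cases "t = 1/2")
      case True
      have "(p +++ q) t = pathstart q" unfolding True q(2) by (simp add: joinpaths_def pathfinish_def)
      then show ?thesis using pth_ends(1)[OF q(1)] by simp
    next
      case False
      then have "(p +++ q) t = q (2 * t - 1)" using that by (simp add: joinpaths_def)
      moreover have "2 * t - 1 \<in> {0..1}" using that by auto
      ultimately show ?thesis using q(1) by (auto simp: pth_def path_image_def)
    qed
    then show "flat_section ?Y (p +++ q) (\<lambda>_. F)"
      by (intro flat_section_const[OF F(1)]) auto
    fix t assume "t \<in> ?X" "t \<in> ?Y"
    then have t: "t = 1/2" by simp
    show "germ_eq ((p +++ q) t) (s (2 * t)) F"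
      unfolding t using F(2) by (simp add: joinpaths_def pathfinish_def)
  qed auto
  then show ?thesis using s by (simp add: continues_def un)
qed

text \<open>The value at the class of \<open>p\<close> is the value of the continuation of a fixed germ along \<open>p\<close>.\<close>

lemma developing_map_exists:
  assumes x: "x \<in> S"
  obtains f where "developing_map S x A f"
proof -
  obtain N0 F0 where F0: "flat N0 F0" "x \<in> N0" using flat_exists[OF x] .
  define f where "f P = (THE v. \<exists>p s. pth S p \<and> pathstart p = x \<and> P = path_class S p \<and>
      continues x F0 p s \<and> v = s 1 (pathfinish p))" for P
  have f: "f (path_class S p) = s 1 (pathfinish p)"
    if p: "pth S p" "pathstart p = x" "continues x F0 p s" for p s
    unfolding f_def
  proof (rule the_equality)
    show "\<exists>p' s'. pth S p' \<and> pathstart p' = x \<and> path_class S p = path_class S p' \<and>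
      continues x F0 p' s' \<and> s 1 (pathfinish p) = s' 1 (pathfinish p')" using p by blast
    fix v assume "\<exists>p' s'. pth S p' \<and> pathstart p' = x \<and> path_class S p = path_class S p' \<and>
      continues x F0 p' s' \<and> v = s' 1 (pathfinish p')"
    then obtain p' s' where p': "pth S p'" "path_class S p = path_class S p'" "continues x F0 p' s'"
      "v = s' 1 (pathfinish p')" by blast
    have hom: "homotopic_paths S p p'" using p'(2) path_class_eq_iff[OF p(1)] by simp
    have "germ_eq (pathfinish p) (s 1) (s' 1)"
      by (rule continuation_homotopic[OF F0 hom p(2,3) p'(3)])
    then show "v = s 1 (pathfinish p)"
      using germ_eqD[of "pathfinish p" "s 1" "s' 1"] homotopic_paths_imp_pathfinish[OF hom] p'(4) by simp
  qed
  have "developing_map S x A f"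
    unfolding developing_map_iff
  proof (intro allI impI)
    fix p assume p: "pth S p \<and> pathstart p = x"
    then obtain s where s: "continues x F0 p s" using continuation_exists[OF F0] by blast
    then have "flat_section {0..1} p s" by (simp add: continues_def)
    then obtain N F where F: "flat N F" "p 1 \<in> N" "germ_eq (p 1) (s 1) F"
      by (rule flat_sectionE_point[of _ _ _ 1]) auto
    have F1: "germ_eq (pathfinish p) (s 1) F" "pathfinish p \<in> N" using F by (simp_all add: pathfinish_def)
    have "f Q = F (cover_proj Q)" if Q: "Q \<in> sheet S p N" for Q
    proof -
      obtain q where q: "pth N q" "pathstart q = pathfinish p" "Q = path_class S (p +++ q)"
        using Q by (auto simp: sheet_def)
      have "pth S q" by (rule pth_mono[OF q(1) opn_subset[OF flat_opn[OF F(1)]]])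
      then have pq: "pth S (p +++ q)" using p q by simp
      have "continues x F0 (p +++ q) (\<lambda>t. if t \<in> {0..1/2} then s (2 * t) else F)"
        using continues_join[OF s _ F(1) F1(1) q(1,2)] p by blast
      from f[OF pq _ this] show ?thesis using p pq q(3) by simp
    qed
    then show "\<exists>N F. flat N F \<and> pathfinish p \<in> N \<and> (\<forall>Q\<in>sheet S p N. f Q = F (cover_proj Q))"
      using F(1) F1(2) by blast
  qed
  then show ?thesis by (rule that)
qed

subsection \<open>Uniqueness\<close>

lemma developing_values:
  assumes "developing_map S x A f" "P \<in> ucover S x"
  shows "f P \<in> topspace CP1"
proof -
  obtain p where p: "pth S p" "pathstart p = x" "P = path_class S p" using assms(2) by (rule ucoverE)
  obtain N F where N: "flat N F" "pathfinish p \<in> N" "\<And>Q. Q \<in> sheet S p N \<Longrightarrow> f Q = F (cover_proj Q)"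
    by (rule developingE[OF assms(1) p(1,2)]) blast
  have "f P = F (pathfinish p)" using N(3) mem_sheet_self[OF p(1) N(2)] p by simp
  then show ?thesis using flat_values[OF N(1,2)] by simp
qed

lemma developing_act_unique:
  assumes f: "developing_map S x A f" and V: "openin (universal_cover S x) V" "P \<in> V"
    and M: "M \<in> carrier PSL2" "M' \<in> carrier PSL2" "\<And>Q. Q \<in> V \<Longrightarrow> PSL2_act M (f Q) = PSL2_act M' (f Q)"
  shows "M = M'"
proof -
  have "P \<in> ucover S x" using V unfolding openin_universal_cover by blast
  then obtain p where p: "pth S p" "pathstart p = x" "P = path_class S p" by (rule ucoverE)
  obtain N F where N: "flat N F" "pathfinish p \<in> N" "\<And>Q. Q \<in> sheet S p N \<Longrightarrow> f Q = F (cover_proj Q)"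
    by (rule developingE[OF f p(1,2)]) blast
  have "\<exists>U. opn U \<and> pathfinish p \<in> U \<and> sheet S p U \<subseteq> V"
    by (rule conjunct2[OF V(1)[unfolded openin_universal_cover], rule_format]) (use p V(2) in simp)
  then obtain U where U: "opn U" "pathfinish p \<in> U" "sheet S p U \<subseteq> V" by blast
  have "opn (U \<inter> N)" "pathfinish p \<in> U \<inter> N" using openin_Int[OF U(1) flat_opn[OF N(1)]] U(2) N(2) by auto
  then obtain W where W: "disc W" "pathfinish p \<in> W" "W \<subseteq> U \<inter> N" by (rule disc_nbhd)
  show ?thesis
  proof (rule flat_act_unique[OF N(1) disc_opn[OF W(1)] _ _ M(1,2)])
    fix y assume y: "y \<in> W"
    obtain a where a: "pth W a" "pathstart a = pathfinish p" "pathfinish a = y"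
      by (rule disc_path[OF W(1,2) y]) blast
    have "path_class S (p +++ a) \<in> sheet S p W" using a by (auto simp: sheet_def)
    then have Q: "path_class S (p +++ a) \<in> sheet S p N" "path_class S (p +++ a) \<in> V"
      using sheet_mono[of W N S p] sheet_mono[of W U S p] W(3) U(3) by auto
    have "pth S (p +++ a)" using p a pth_mono[OF a(1) opn_subset[OF disc_opn[OF W(1)]]] by simp
    then have "f (path_class S (p +++ a)) = F y" using N(3)[OF Q(1)] a(3) by simp
    then show "PSL2_act M (F y) = PSL2_act M' (F y)" using M(3)[OF Q(2)] by simp
  qed (use W in auto)
qed

text \<open>Locally two developing maps differ by a projective transformation. It is locally constant, because
  developing maps take infinitely many values on every open set, and the universal cover is connected.\<close>

lemma developing_unique:
  assumes f: "developing_map S x A f" and f': "developing_map S x A f'" and x: "x \<in> S"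
  obtains M where "M \<in> carrier PSL2" "\<And>P. P \<in> ucover S x \<Longrightarrow> f' P = PSL2_act M (f P)"
proof -
  let ?X = "universal_cover S x"
  have loc: "\<exists>V M. openin ?X V \<and> P \<in> V \<and> M \<in> carrier PSL2 \<and> (\<forall>Q\<in>V. f' Q = PSL2_act M (f Q))"
    if P: "P \<in> ucover S x" for P
  proof -
    obtain p where p: "pth S p" "pathstart p = x" "P = path_class S p" using P by (rule ucoverE)
    obtain N F where N: "flat N F" "pathfinish p \<in> N" "\<And>Q. Q \<in> sheet S p N \<Longrightarrow> f Q = F (cover_proj Q)"
      by (rule developingE[OF f p(1,2)]) blast
    obtain N' F' where N': "flat N' F'" "pathfinish p \<in> N'" "\<And>Q. Q \<in> sheet S p N' \<Longrightarrow> f' Q = F' (cover_proj Q)"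
      by (rule developingE[OF f' p(1,2)]) blast
    have "opn (N \<inter> N')" "pathfinish p \<in> N \<inter> N'"
      using openin_Int[OF flat_opn[OF N(1)] flat_opn[OF N'(1)]] N(2) N'(2) by auto
    then obtain T M where T: "opn T" "pathfinish p \<in> T" "T \<subseteq> N \<inter> N'" "M \<in> carrier PSL2"
      "\<And>z. z \<in> T \<Longrightarrow> F' z = PSL2_act M (F z)"
      by (rule germ_relE[OF flat_germ_rel[OF N'(1) N(1) N'(2) N(2)]]) blast
    have "f' Q = PSL2_act M (f Q)" if "Q \<in> sheet S p T" for Q
    proof -
      have "cover_proj Q \<in> T" by (rule cover_proj_sheet[OF p(1) opn_subset[OF T(1)] that])
      moreover have "Q \<in> sheet S p N" "Q \<in> sheet S p N'"
        using that sheet_mono[of T N S p] sheet_mono[of T N' S p] T(3) by auto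
      ultimately show ?thesis using N(3) N'(3) T(5) by simp
    qed
    then show ?thesis
      using openin_sheet[OF p(1,2) T(1,2)] mem_sheet_self[OF p(1) T(2)] T(4)
      by (intro exI[of _ "sheet S p T"] exI[of _ M]) (simp add: p(3))
  qed
  have P0: "path_class S (\<lambda>_. x) \<in> ucover S x" using x by (intro ucoverI) auto
  obtain V0 M where V0: "openin ?X V0" "path_class S (\<lambda>_. x) \<in> V0" "M \<in> carrier PSL2"
    "\<forall>Q\<in>V0. f' Q = PSL2_act M (f Q)" using loc[OF P0] by (elim exE conjE)
  define E where "E = {P. \<exists>V. openin ?X V \<and> P \<in> V \<and> (\<forall>Q\<in>V. f' Q = PSL2_act M (f Q))}"
  have E: "openin ?X E"
  proof (subst openin_subopen, intro ballI)
    fix P assume "P \<in> E"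
    then obtain V where V: "openin ?X V" "P \<in> V" "\<forall>Q\<in>V. f' Q = PSL2_act M (f Q)" by (auto simp: E_def)
    then have "V \<subseteq> E" unfolding E_def by blast
    then show "\<exists>T. openin ?X T \<and> P \<in> T \<and> T \<subseteq> E" using V by blast
  qed
  have "openin ?X (topspace ?X - E)"
  proof (subst openin_subopen, intro ballI)
    fix P assume P: "P \<in> topspace ?X - E"
    then have "P \<in> ucover S x" by (simp add: topspace_universal_cover)
    from loc[OF this]
    obtain V M1 where V: "openin ?X V" "P \<in> V" "M1 \<in> carrier PSL2" "\<forall>Q\<in>V. f' Q = PSL2_act M1 (f Q)"
      by (elim exE conjE)
    have "Q \<notin> E" if Q: "Q \<in> V" for Q
    proof
      assume "Q \<in> E"
      then obtain V' where V': "openin ?X V'" "Q \<in> V'" "\<forall>Q\<in>V'. f' Q = PSL2_act M (f Q)" by (auto simp: E_def)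
      have "M1 = M"
      proof (rule developing_act_unique[OF f openin_Int[OF V(1) V'(1)] _ V(3) V0(3)])
        show "Q \<in> V \<inter> V'" using Q V'(2) by blast
        show "PSL2_act M1 (f R) = PSL2_act M (f R)" if "R \<in> V \<inter> V'" for R
          using V(4) V'(3) that by (metis IntD1 IntD2)
      qed
      then have "P \<in> E" using V unfolding E_def by blast
      then show False using P by blast
    qed
    then show "\<exists>T. openin ?X T \<and> P \<in> T \<and> T \<subseteq> topspace ?X - E"
      using V openin_subset[OF V(1)] by (intro exI[of _ V]) auto
  qed
  then have "closedin ?X E" using E openin_subset by (simp add: closedin_def)
  then have "E = {} \<or> E = topspace ?X"
    using connected_space_universal_cover[of S x] E unfolding connected_space_clopen_in by blast
  moreover have "path_class S (\<lambda>_. x) \<in> E" using V0 unfolding E_def by blast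
  ultimately have "E = ucover S x" by (auto simp: topspace_universal_cover)
  then have "f' P = PSL2_act M (f P)" if "P \<in> ucover S x" for P using that unfolding E_def by blast
  then show ?thesis using that V0(3) by blast
qed

lemma developing_deck:
  assumes f: "developing_map S x A f" and g: "g \<in> carrier (fundamental_group S x)"
  shows "developing_map S x A (\<lambda>P. f (class_join S g P))"
  unfolding developing_map_iff
proof (intro allI impI)
  obtain l where l: "l \<in> loops S x" "g = path_class S l"
    using g by (auto simp: carrier_fundamental_group_loops)
  fix p assume p: "pth S p \<and> pathstart p = x"
  have lp: "pth S (l +++ p)" "pathstart (l +++ p) = x" using loopsD[OF l(1)] p by simp_all
  obtain N F where N: "flat N F" "pathfinish (l +++ p) \<in> N"
    "\<And>Q. Q \<in> sheet S (l +++ p) N \<Longrightarrow> f Q = F (cover_proj Q)"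
    by (rule developingE[OF f lp]) blast
  have NS: "N \<subseteq> S" by (rule opn_subset[OF flat_opn[OF N(1)]])
  have "f (class_join S g Q) = F (cover_proj Q)" if Q: "Q \<in> sheet S p N" for Q
  proof -
    have "class_join S g Q \<in> sheet S (l +++ p) N"
      using deck_sheet[OF l(1) _ _ NS, of p] p Q l(2) by blast
    moreover have "Q \<in> ucover S x" using sheet_in_ucover[of S p x N] p NS Q by blast
    ultimately show ?thesis using N(3) deck_in_ucover(2)[OF g] by simp
  qed
  then show "\<exists>N F. flat N F \<and> pathfinish p \<in> N \<and> (\<forall>Q\<in>sheet S p N. f (class_join S g Q) = F (cover_proj Q))"
    using N(1,2) by auto
qed

lemma developing_act:
  assumes f: "developing_map S x A f" and M: "M \<in> carrier PSL2"
  shows "developing_map S x A (\<lambda>P. PSL2_act M (f P))"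
  unfolding developing_map_iff
proof (intro allI impI)
  fix p assume p: "pth S p \<and> pathstart p = x"
  then have p': "pth S p" "pathstart p = x" by auto
  obtain N F where N: "flat N F" "pathfinish p \<in> N"
    "\<And>Q. Q \<in> sheet S p N \<Longrightarrow> f Q = F (cover_proj Q)"
    by (rule developingE[OF f p']) blast
  then show "\<exists>N F. flat N F \<and> pathfinish p \<in> N \<and> (\<forall>Q\<in>sheet S p N. PSL2_act M (f Q) = F (cover_proj Q))"
    using flat_act[OF N(1) M] by (intro exI[of _ N] exI[of _ "\<lambda>y. PSL2_act M (F y)"]) simp
qed

lemma equivariant_unique:
  assumes f: "developing_map S x A f" and x: "x \<in> S" and M: "M \<in> carrier PSL2" "M' \<in> carrier PSL2"
    and eq: "\<And>P. P \<in> ucover S x \<Longrightarrow> PSL2_act M (f P) = PSL2_act M' (f P)"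
  shows "M = M'"
proof (rule developing_act_unique[OF f openin_topspace _ M])
  show "path_class S (\<lambda>_. x) \<in> topspace (universal_cover S x)"
    unfolding topspace_universal_cover using x by (intro ucoverI) auto
qed (use eq in \<open>simp add: topspace_universal_cover\<close>)

text \<open>Composition of \<open>f\<close> with the deck transformation of \<open>g\<close> is again a developing map, which differs from
  \<open>f\<close> by a unique projective transformation \<open>\<rho> g\<close>.\<close>

lemma holonomy_exists:
  assumes f: "developing_map S x A f" and x: "x \<in> S"
  obtains \<rho> where "\<rho> \<in> topspace (Hom_topology (fundamental_group S x))" "equivariant S x f \<rho>"
proof -
  let ?G = "fundamental_group S x"
  have "\<exists>M. M \<in> carrier PSL2 \<and> (\<forall>P\<in>ucover S x. f (class_join S g P) = PSL2_act M (f P))"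
    if g: "g \<in> carrier ?G" for g
  proof -
    obtain M where "M \<in> carrier PSL2" "\<And>P. P \<in> ucover S x \<Longrightarrow> f (class_join S g P) = PSL2_act M (f P)"
      by (rule developing_unique[OF f developing_deck[OF f g] x]) blast
    then show ?thesis by (intro exI[of _ M]) simp
  qed
  then obtain r where r: "\<And>g. g \<in> carrier ?G \<Longrightarrow> r g \<in> carrier PSL2"
    "\<And>g P. g \<in> carrier ?G \<Longrightarrow> P \<in> ucover S x \<Longrightarrow> f (class_join S g P) = PSL2_act (r g) (f P)"
    by metis
  define \<rho> where "\<rho> = restrict r (carrier ?G)"
  have "\<rho> (class_join S g h) = \<rho> g \<otimes>\<^bsub>PSL2\<^esub> \<rho> h" if gh: "g \<in> carrier ?G" "h \<in> carrier ?G" for g h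
  proof (rule equivariant_unique[OF f x])
    have P0: "path_class S (\<lambda>_. x) \<in> ucover S x" using x by (intro ucoverI) auto
    have gh': "class_join S g h \<in> carrier ?G" by (rule deck_mult(2)[OF gh P0])
    show "\<rho> (class_join S g h) \<in> carrier PSL2" "\<rho> g \<otimes>\<^bsub>PSL2\<^esub> \<rho> h \<in> carrier PSL2"
      using gh gh' r(1) by (simp_all add: \<rho>_def)
    fix P assume P: "P \<in> ucover S x"
    have "PSL2_act (r (class_join S g h)) (f P) = f (class_join S g (class_join S h P))"
      using r(2)[OF gh' P] deck_mult(1)[OF gh P] by simp
    also have "\<dots> = PSL2_act (r g) (PSL2_act (r h) (f P))"
      using r(2) gh P deck_in_ucover(1)[OF gh(2) P] by simp
    also have "\<dots> = PSL2_act (r g \<otimes>\<^bsub>PSL2\<^esub> r h) (f P)"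
      using r(1) gh developing_values[OF f P] by (simp add: PSL2_act_mult)
    finally show "PSL2_act (\<rho> (class_join S g h)) (f P) = PSL2_act (\<rho> g \<otimes>\<^bsub>PSL2\<^esub> \<rho> h) (f P)"
      using gh gh' by (simp add: \<rho>_def)
  qed
  then have "\<rho> \<in> hom ?G PSL2" using r(1) by (auto simp: hom_def \<rho>_def)
  then have "\<rho> \<in> topspace (Hom_topology ?G)" by (simp add: topspace_Hom_topology \<rho>_def)
  moreover have "equivariant S x f \<rho>"
    using r(2) by (simp add: equivariant_def topspace_universal_cover \<rho>_def)
  ultimately show ?thesis by (rule that)
qed

end

subsection \<open>Conjugacy classes of representations\<close>

definition conj_rep :: "('g, 'b) monoid_scheme \<Rightarrow> (complex^2^2) set \<Rightarrow> ('g \<Rightarrow> (complex^2^2) set) \<Rightarrow> 'g \<Rightarrow> (complex^2^2) set" where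
  "conj_rep G M \<rho> = (\<lambda>g\<in>carrier G. M \<otimes>\<^bsub>PSL2\<^esub> \<rho> g \<otimes>\<^bsub>PSL2\<^esub> inv\<^bsub>PSL2\<^esub> M)"

lemma conj_class_eq: "conj_class G \<rho> = (\<lambda>M. conj_rep G M \<rho>) ` carrier PSL2"
  by (simp add: conj_class_def conj_rep_def)

lemma Hom_values: "\<rho> \<in> topspace (Hom_topology G) \<Longrightarrow> g \<in> carrier G \<Longrightarrow> \<rho> g \<in> carrier PSL2"
  by (auto simp: topspace_Hom_topology hom_def)

lemma conj_rep_conj_rep:
  assumes "\<rho> \<in> topspace (Hom_topology G)" "M \<in> carrier PSL2" "N \<in> carrier PSL2"
  shows "conj_rep G N (conj_rep G M \<rho>) = conj_rep G (N \<otimes>\<^bsub>PSL2\<^esub> M) \<rho>"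
  using assms Hom_values[OF assms(1)]
  by (auto simp: conj_rep_def fun_eq_iff PSL2.inv_mult_group PSL2.m_assoc)

lemma conj_rep_one:
  assumes "\<rho> \<in> topspace (Hom_topology G)"
  shows "conj_rep G \<one>\<^bsub>PSL2\<^esub> \<rho> = \<rho>"
proof
  fix g
  have "\<rho> \<in> extensional (carrier G)" using assms by (simp add: topspace_Hom_topology)
  then show "conj_rep G \<one>\<^bsub>PSL2\<^esub> \<rho> g = \<rho> g"
    using Hom_values[OF assms, of g] PSL2.r_one PSL2.l_one PSL2.inv_one PSL2.one_closed
    unfolding conj_rep_def by (cases "g \<in> carrier G") (simp_all del: one_PSL2 add: extensional_def)
qed

lemma conj_class_conj_rep:
  assumes \<rho>: "\<rho> \<in> topspace (Hom_topology G)" and M: "M \<in> carrier PSL2"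
  shows "conj_class G (conj_rep G M \<rho>) = conj_class G \<rho>"
proof (intro subset_antisym subsetI)
  fix \<sigma> assume "\<sigma> \<in> conj_class G (conj_rep G M \<rho>)"
  then obtain N where "N \<in> carrier PSL2" "\<sigma> = conj_rep G (N \<otimes>\<^bsub>PSL2\<^esub> M) \<rho>"
    using conj_rep_conj_rep[OF \<rho> M] by (auto simp: conj_class_eq)
  then show "\<sigma> \<in> conj_class G \<rho>" using M by (auto simp: conj_class_eq)
next
  fix \<sigma> assume "\<sigma> \<in> conj_class G \<rho>"
  then obtain N where N: "N \<in> carrier PSL2" "\<sigma> = conj_rep G N \<rho>" by (auto simp: conj_class_eq)
  have "N = (N \<otimes>\<^bsub>PSL2\<^esub> inv\<^bsub>PSL2\<^esub> M) \<otimes>\<^bsub>PSL2\<^esub> M" using N(1) M by (simp add: PSL2.m_assoc del: one_PSL2)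
  then have "\<sigma> = conj_rep G (N \<otimes>\<^bsub>PSL2\<^esub> inv\<^bsub>PSL2\<^esub> M) (conj_rep G M \<rho>)"
    using N M conj_rep_conj_rep[OF \<rho> M, of "N \<otimes>\<^bsub>PSL2\<^esub> inv\<^bsub>PSL2\<^esub> M"] by simp
  then show "\<sigma> \<in> conj_class G (conj_rep G M \<rho>)" using N(1) M by (auto simp: conj_class_eq)
qed

lemma conj_class_eqD:
  assumes "\<rho>' \<in> topspace (Hom_topology G)" "conj_class G \<rho>' = conj_class G \<rho>"
  obtains M where "M \<in> carrier PSL2" "\<rho>' = conj_rep G M \<rho>"
proof -
  have "\<rho>' \<in> conj_class G \<rho>'"
    unfolding conj_class_eq using conj_rep_one[OF assms(1)] PSL2.one_closed by (metis imageI)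
  then show ?thesis using that assms(2) by (auto simp: conj_class_eq)
qed

context branched
begin

lemma equivariant_act:
  assumes f: "developing_map S x A f" and \<rho>: "\<rho> \<in> topspace (Hom_topology (fundamental_group S x))"
    and e: "equivariant S x f \<rho>" and M: "M \<in> carrier PSL2"
  shows "equivariant S x (\<lambda>P. PSL2_act M (f P)) (conj_rep (fundamental_group S x) M \<rho>)"
  unfolding equivariant_def topspace_universal_cover
proof (intro ballI)
  fix g P assume g: "g \<in> carrier (fundamental_group S x)" and P: "P \<in> ucover S x"
  have v: "f P \<in> topspace CP1" by (rule developing_values[OF f P])
  have r: "\<rho> g \<in> carrier PSL2" by (rule Hom_values[OF \<rho> g])
  have "f (class_join S g P) = PSL2_act (\<rho> g) (f P)"
    using e g P by (simp add: equivariant_def topspace_universal_cover)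
  then show "PSL2_act M (f (class_join S g P)) =
      PSL2_act (conj_rep (fundamental_group S x) M \<rho> g) (PSL2_act M (f P))"
    using v r M g by (simp add: conj_rep_def PSL2_act_mult)
qed

text \<open>The projective transformation that relates two developing maps conjugates their holonomies.\<close>

lemma holonomy_class_unique:
  assumes x: "x \<in> S"
    and f: "developing_map S x A f" "\<rho> \<in> topspace (Hom_topology (fundamental_group S x))" "equivariant S x f \<rho>"
    and f': "developing_map S x A f'" "\<rho>' \<in> topspace (Hom_topology (fundamental_group S x))" "equivariant S x f' \<rho>'"
  shows "conj_class (fundamental_group S x) \<rho>' = conj_class (fundamental_group S x) \<rho>"
proof -
  let ?G = "fundamental_group S x"
  obtain M where M: "M \<in> carrier PSL2" "\<And>P. P \<in> ucover S x \<Longrightarrow> f' P = PSL2_act M (f P)"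
    by (rule developing_unique[OF f(1) f'(1) x]) blast
  note e = equivariant_act[OF f M(1)]
  have "\<rho>' g = conj_rep ?G M \<rho> g" for g
  proof (cases "g \<in> carrier ?G")
    case True
    show ?thesis
    proof (rule equivariant_unique[OF f'(1) x Hom_values[OF f'(2) True]])
      show "conj_rep ?G M \<rho> g \<in> carrier PSL2"
        using True M(1) Hom_values[OF f(2) True] by (simp add: conj_rep_def)
      fix P assume P: "P \<in> ucover S x"
      have "PSL2_act (\<rho>' g) (f' P) = f' (class_join S g P)"
        using f'(3) True P by (simp add: equivariant_def topspace_universal_cover)
      also have "\<dots> = PSL2_act (conj_rep ?G M \<rho> g) (f' P)"
        using e True P M(2) deck_in_ucover(1)[OF True P]
        by (simp add: equivariant_def topspace_universal_cover)
      finally show "PSL2_act (\<rho>' g) (f' P) = PSL2_act (conj_rep ?G M \<rho> g) (f' P)" .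
    qed
  next
    case False
    then show ?thesis using f'(2) by (simp add: topspace_Hom_topology extensional_def conj_rep_def)
  qed
  then have "\<rho>' = conj_rep ?G M \<rho>" by blast
  then show ?thesis using conj_class_conj_rep[OF f(2) M(1)] by simp
qed

end

section \<open>Isotopies\<close>

lemma isotopyE:
  assumes "isotopic_to_id S h"
  obtains H :: "real \<times> 'a::topological_space \<Rightarrow> 'a" where
    "continuous_map (prod_topology (top_of_set {0..1}) (top_of_set S)) (top_of_set S) H"
    "\<And>y. H (0, y) = y" "\<And>y. H (1, y) = h y"
    "homeomorphic_map (top_of_set S) (top_of_set S) h"
proof -
  obtain H where H: "continuous_map (prod_topology (top_of_set {0..1::real}) (top_of_set S)) (top_of_set S) H"
    "\<forall>y. H (0, y) = id y" "\<forall>y. H (1, y) = h y"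
    "\<forall>t\<in>{0..1}. homeomorphic_map (top_of_set S) (top_of_set S) (\<lambda>y. H (t, y))"
    using assms unfolding isotopic_to_id_def homotopic_with_def by blast
  have "homeomorphic_map (top_of_set S) (top_of_set S) (\<lambda>y. H (1, y))" using H(4) by simp
  then show ?thesis using H by (intro that[of H]) simp_all
qed

lemma isotopic_to_id_id: "isotopic_to_id S id"
  unfolding isotopic_to_id_def by (simp add: homotopic_with_refl homeomorphic_map_id)

text \<open>The two paths are the two ways around the square \<open>(u, t) \<mapsto> H (u, p t)\<close>.\<close>

lemma isotopy_square:
  assumes H: "continuous_map (prod_topology (top_of_set {0..1}) (top_of_set S)) (top_of_set S) H"
    and "\<And>y. H (0, y) = y" "\<And>y. H (1, y) = h y" and p: "pth S p"
  shows "homotopic_paths S (p +++ (\<lambda>u. H (u, pathfinish p))) ((\<lambda>u. H (u, pathstart p)) +++ (h \<circ> p))"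
    and "pth S (\<lambda>u. H (u, pathstart p))"
proof -
  define c :: "real \<times> real \<Rightarrow> 'a" where "c z = H (fst z, p (snd z))" for z
  let ?Q = "{0..1} \<times> {0..1} :: (real \<times> real) set"
  have cp: "continuous_map (top_of_set {0..1}) (top_of_set S) p"
    using p by (auto simp: pth_def path_def path_image_def)
  have "continuous_map (top_of_set ?Q) (prod_topology (top_of_set {0..1}) (top_of_set S)) (\<lambda>z. (fst z, p (snd z)))"
  proof (rule continuous_map_pairedI)
    show "continuous_map (top_of_set ?Q) (top_of_set {0..1}) fst" by (auto intro!: continuous_intros)
    have "continuous_map (top_of_set ?Q) (top_of_set {0..1}) snd" by (auto intro!: continuous_intros)
    from continuous_map_compose[OF this cp]
    show "continuous_map (top_of_set ?Q) (top_of_set S) (\<lambda>z. p (snd z))" by (simp only: o_def)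
  qed
  from continuous_map_compose[OF this H]
  have "continuous_map (top_of_set ?Q) (top_of_set S) c" by (simp only: o_def c_def[abs_def])
  then have c: "continuous_on ?Q c" "c ` ?Q \<subseteq> S" by auto
  let ?a = "linepath (0, 0) (0, 1) +++ linepath (0, 1) (1, 1) :: real \<Rightarrow> real \<times> real"
  let ?b = "linepath (0, 0) (1, 0) +++ linepath (1, 0) (1, 1) :: real \<Rightarrow> real \<times> real"
  have conv: "convex ?Q" by (simp add: convex_Times)
  have img: "path_image (linepath u v) \<subseteq> ?Q" if "u \<in> ?Q" "v \<in> ?Q" for u v
    unfolding path_image_linepath by (rule closed_segment_subset[OF that conv])
  have "homotopic_paths S (c \<circ> ?a) (c \<circ> ?b)"
  proof (rule homotopic_paths_push[OF conv c])
    show "path_image ?a \<subseteq> ?Q" "path_image ?b \<subseteq> ?Q"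
      by (intro subset_path_image_join img; simp)+
  qed auto
  moreover have "c \<circ> linepath (0, 0) (0, 1) = p" "c \<circ> linepath (0, 1) (1, 1) = (\<lambda>u. H (u, pathfinish p))"
    "c \<circ> linepath (0, 0) (1, 0) = (\<lambda>u. H (u, pathstart p))" "c \<circ> linepath (1, 0) (1, 1) = h \<circ> p"
    using assms(2,3) by (simp_all add: fun_eq_iff c_def linepath_def pathfinish_def pathstart_def)
  ultimately show "homotopic_paths S (p +++ (\<lambda>u. H (u, pathfinish p))) ((\<lambda>u. H (u, pathstart p)) +++ (h \<circ> p))"
    by (simp add: path_compose_join)
  have "path (c \<circ> linepath (0, 0) (1, 0))" "path_image (c \<circ> linepath (0, 0) (1, 0)) \<subseteq> S"
    using c img[of "(0, 0)" "(1, 0)"]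
    by (auto simp: path_image_compose intro!: path_continuous_image intro: continuous_on_subset)
  moreover have "c \<circ> linepath (0, 0) (1, 0) = (\<lambda>u. H (u, pathstart p))"
    by (simp add: fun_eq_iff c_def linepath_def pathstart_def)
  ultimately show "pth S (\<lambda>u. H (u, pathstart p))" by (simp add: pth_def)
qed

context branched
begin

lemma push_atlas_id: "push_atlas S id A = A"
proof -
  have "(id ` U, restrict (\<phi> \<circ> inv_into S id) (id ` U)) = (U, \<phi>)" if "(U, \<phi>) \<in> A" for U \<phi>
  proof -
    have c: "bp_chart S \<O> (U, \<phi>)" by (rule atlas_chart[OF that])
    have "inv_into S id y = y" if "y \<in> U" for y
      using that bp_chartD(1)[OF c] opn_subset by (metis id_apply inj_on_id inv_into_f_f subsetD)
    then show ?thesis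
      using bp_chartD(2)[OF c] by (auto simp: fun_eq_iff extensional_def)
  qed
  then show ?thesis
    unfolding push_atlas_def by (force simp: image_iff)
qed

text \<open>An isotopy \<open>H\<close> from the identity to \<open>h\<close> lifts to the universal cover: the class of a path \<open>p\<close>
  from \<open>x\<close> goes to the class of the track of \<open>x\<close> followed by \<open>h \<circ> p\<close>. The lift commutes with the
  deck transformations, since \<open>l +++ \<tau>\<close> and \<open>\<tau> +++ (h \<circ> l)\<close> are homotopic for every loop \<open>l\<close> at \<open>x\<close>
  with track \<open>\<tau>\<close>. Composition with the lift turns developing maps of the transported atlas into
  developing maps of the original one, with the same holonomy.\<close>

lemma developing_pull_back:
  assumes x: "x \<in> S" and h: "isotopic_to_id S h"
    and f: "developing_map S x (push_atlas S h A) f" and e: "equivariant S x f \<rho>"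
  obtains f' where "developing_map S x A f'" "equivariant S x f' \<rho>"
proof -
  obtain H :: "real \<times> 'a \<Rightarrow> 'a" where
    H: "continuous_map (prod_topology (top_of_set {0..1}) (top_of_set S)) (top_of_set S) H"
    "\<And>y. H (0, y) = y" "\<And>y. H (1, y) = h y" "homeomorphic_map (top_of_set S) (top_of_set S) h"
    by (rule isotopyE[OF h]) (rule that)
  have hS: "continuous_on S h" "h ` S = S" "inj_on h S"
    using homeomorphic_imp_continuous_map[OF H(4)] homeomorphic_imp_surjective_map[OF H(4)]
      homeomorphic_imp_injective_map[OF H(4)] by auto
  define \<tau> :: "real \<Rightarrow> 'a" where "\<tau> u = H (u, x)" for u
  have \<tau>: "pth S \<tau>" "pathstart \<tau> = x" "pathfinish \<tau> = h x"
    using isotopy_square(2)[OF H(1-3), of "\<lambda>_. x"] x H(2,3)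
    by (simp_all add: \<tau>_def[abs_def] pathstart_def pathfinish_def)
  have hp: "pth S (h \<circ> p)" if "pth S p" for p
    using that hS by (auto simp: pth_def path_image_compose intro!: path_continuous_image
        intro: continuous_on_subset)
  have hends: "pathstart (h \<circ> p) = h (pathstart p)" "pathfinish (h \<circ> p) = h (pathfinish p)" for p
    by (simp_all add: pathstart_compose pathfinish_compose)
  define L where "L P = path_class S (\<tau> +++ (h \<circ> (SOME p. p \<in> P)))" for P
  have L: "L (path_class S p) = path_class S (\<tau> +++ (h \<circ> p))" if p: "pth S p" "pathstart p = x" for p
  proof -
    define p' where "p' = (SOME p'. p' \<in> path_class S p)"
    have "p' \<in> path_class S p" unfolding p'_def
      using mem_path_class[OF p(1)] by (rule someI[where P = "\<lambda>q. q \<in> path_class S p"])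
    then have hom: "homotopic_paths S p p'" by (simp add: path_class_def)
    have "homotopic_paths S (h \<circ> p) (h \<circ> p')"
      by (rule homotopic_paths_continuous_image[OF hom hS(1)]) (use hS(2) in auto)
    from path_class_eqI[OF this]
    have "path_class S (\<tau> +++ (h \<circ> p)) = path_class S (\<tau> +++ (h \<circ> p'))"
      using \<tau> hp[OF p(1)] p hends by (intro path_class_join_cong) auto
    then show ?thesis by (simp add: L_def p'_def)
  qed
  have r: "pth S (\<tau> +++ (h \<circ> p))" "pathstart (\<tau> +++ (h \<circ> p)) = x"
    "pathfinish (\<tau> +++ (h \<circ> p)) = h (pathfinish p)" if "pth S p" "pathstart p = x" for p
    using \<tau> hp[OF that(1)] that hends by simp_all
  define f' where "f' P = f (L P)" for P
  have "developing_map S x A f'"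
    unfolding developing_map_iff
  proof (intro allI impI)
    fix p assume "pth S p \<and> pathstart p = x"
    then have p: "pth S p" "pathstart p = x" by auto
    define q where "q = \<tau> +++ (h \<circ> p)"
    note q = r[OF p, folded q_def]
    have "path_class S q \<in> topspace (universal_cover S x)"
      using q by (simp add: topspace_universal_cover ucoverI)
    from bspec[OF f[unfolded developing_map_def] this]
    obtain V c where V: "openin (universal_cover S x) V" "path_class S q \<in> V" "c \<in> push_atlas S h A"
      "case c of (U, \<phi>) \<Rightarrow> \<forall>Q\<in>V. cover_proj Q \<in> U \<and> f Q = \<phi> (cover_proj Q)"
      by (elim exE conjE bexE)
    obtain U \<phi> where c: "c = (h ` U, restrict (\<phi> \<circ> inv_into S h) (h ` U))" and U: "(U, \<phi>) \<in> A"
      using V(3) unfolding push_atlas_def by auto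
    have US: "U \<subseteq> S" by (rule opn_subset[OF flat_opn[OF flat_chart[OF U]]])
    have fV: "cover_proj Q \<in> h ` U" "f Q = \<phi> (inv_into S h (cover_proj Q))" if "Q \<in> V" for Q
      using V(4) that by (auto simp: c)
    have "\<exists>U. opn U \<and> pathfinish q \<in> U \<and> sheet S q U \<subseteq> V"
      by (rule conjunct2[OF V(1)[unfolded openin_universal_cover], rule_format]) (use q V(2) in simp)
    then obtain U' where U': "opn U'" "pathfinish q \<in> U'" "sheet S q U' \<subseteq> V" by blast
    define N where "N = U \<inter> (S \<inter> h -` U')"
    have "openin (top_of_set S) (S \<inter> h -` U')"
      using hS U'(1) by (intro continuous_openin_preimage) auto
    then have "opn N" unfolding N_def by (rule openin_Int[OF flat_opn[OF flat_chart[OF U]]])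
    then have N: "flat N \<phi>" using flat_subset[OF flat_chart[OF U]] by (simp add: N_def)
    have "h (pathfinish p) \<in> h ` U" using fV(1)[OF V(2)] q by simp
    then have pU: "pathfinish p \<in> U"
      using inj_on_image_mem_iff[OF hS(3) pth_ends(2)[OF p(1)] US] by simp
    then have pN: "pathfinish p \<in> N" using U'(2) q(3) pth_ends(2)[OF p(1)] by (simp add: N_def)
    have "f' Q = \<phi> (cover_proj Q)" if Q: "Q \<in> sheet S p N" for Q
    proof -
      obtain b where b: "pth N b" "pathstart b = pathfinish p" "Q = path_class S (p +++ b)"
        using Q by (auto simp: sheet_def)
      have bS: "pth S b" by (rule pth_mono[OF b(1)]) (auto simp: N_def)
      have pb: "pth S (p +++ b)" "pathstart (p +++ b) = x" using p b bS by simp_all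
      have "pth U' (h \<circ> b)"
        using hp[OF bS] b(1) by (auto simp: pth_def path_image_compose N_def)
      moreover have "pathstart (h \<circ> b) = pathfinish q" using b(2) q(3) hends by simp
      moreover have "L Q = path_class S (q +++ (h \<circ> b))"
      proof -
        have "L Q = path_class S (\<tau> +++ ((h \<circ> p) +++ (h \<circ> b)))"
          unfolding b(3) L[OF pb] path_compose_join ..
        also have "\<dots> = path_class S (q +++ (h \<circ> b))"
          unfolding q_def using \<tau> p hp[OF p(1)] hp[OF bS] b(2) hends
          by (intro path_class_assoc[symmetric]) simp_all
        finally show ?thesis .
      qed
      ultimately have LV: "L Q \<in> V" using U'(3) by (auto simp: sheet_def)
      have "cover_proj (L Q) = h (pathfinish b)"
        unfolding b(3) L[OF pb] using r[OF pb] b(2) by simp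
      then have "f' Q = \<phi> (inv_into S h (h (pathfinish b)))" using fV(2)[OF LV] by (simp add: f'_def)
      also have "\<dots> = \<phi> (pathfinish b)" using hS(3) pth_ends(2)[OF bS] by simp
      finally show ?thesis using pb b by simp
    qed
    then show "\<exists>N F. flat N F \<and> pathfinish p \<in> N \<and> (\<forall>Q\<in>sheet S p N. f' Q = F (cover_proj Q))"
      using N pN by blast
  qed
  moreover have "equivariant S x f' \<rho>"
    unfolding equivariant_def topspace_universal_cover
  proof (intro ballI)
    fix g P assume g: "g \<in> carrier (fundamental_group S x)" and P: "P \<in> ucover S x"
    obtain l where l: "l \<in> loops S x" "g = path_class S l"
      using g by (auto simp: carrier_fundamental_group_loops)
    obtain p where p: "pth S p" "pathstart p = x" "P = path_class S p" using P by (rule ucoverE)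
    note lD = loopsD[OF l(1)]
    have lp: "pth S (l +++ p)" "pathstart (l +++ p) = x" using lD p by simp_all
    have comm: "path_class S (l +++ \<tau>) = path_class S (\<tau> +++ (h \<circ> l))"
      using path_class_eqI[OF isotopy_square(1)[OF H(1-3) lD(1)]] lD by (simp add: \<tau>_def[abs_def])
    have "L (class_join S g P) = path_class S (\<tau> +++ ((h \<circ> l) +++ (h \<circ> p)))"
      unfolding l(2) p(3) deck_path_class[OF l(1) p(1,2)] L[OF lp] path_compose_join ..
    also have "\<dots> = path_class S ((\<tau> +++ (h \<circ> l)) +++ (h \<circ> p))"
      using \<tau> lD p hp[OF p(1)] hp[OF lD(1)] hends by (intro path_class_assoc[symmetric]) simp_all
    also have "\<dots> = path_class S ((l +++ \<tau>) +++ (h \<circ> p))"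
      using \<tau> lD p hp[OF p(1)] hp[OF lD(1)] hends
      by (intro path_class_join_cong[OF comm[symmetric] refl]) simp_all
    also have "\<dots> = path_class S (l +++ (\<tau> +++ (h \<circ> p)))"
      using \<tau> lD p hp[OF p(1)] hends by (intro path_class_assoc) simp_all
    also have "\<dots> = class_join S g (L P)"
      unfolding l(2) p(3) L[OF p(1,2)] using r[OF p(1,2)] by (intro deck_path_class[OF l(1), symmetric]) simp_all
    finally have "L (class_join S g P) = class_join S g (L P)" .
    moreover have "L P \<in> ucover S x" unfolding p(3) L[OF p(1,2)] using r[OF p(1,2)] by (intro ucoverI)
    ultimately show "f' (class_join S g P) = PSL2_act (\<rho> g) (f' P)"
      using e g by (simp add: f'_def equivariant_def topspace_universal_cover)
  qed
  ultimately show ?thesis by (rule that)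
qed

text \<open>All atlases in the orbit and all their developing maps yield the same class: a developing map of a
  transported atlas is pulled back along the lifted isotopy, and those of \<open>A\<close> itself differ by
  projective transformations.\<close>

lemma Hol_eq:
  assumes x: "x \<in> S"
    and f: "developing_map S x A f" "\<rho> \<in> topspace (Hom_topology (fundamental_group S x))" "equivariant S x f \<rho>"
  shows "Hol S x (bp_structure_of S A) = conj_class (fundamental_group S x) \<rho>"
  unfolding Hol_def
proof (rule the_equality)
  have "A \<in> bp_structure_of S A"
    unfolding bp_structure_of_def using push_atlas_id isotopic_to_id_id by (metis (mono_tags, lifting) mem_Collect_eq)
  then show "\<exists>A'\<in>bp_structure_of S A. \<exists>f' \<rho>'. developing_map S x A' f' \<and>
     \<rho>' \<in> topspace (Hom_topology (fundamental_group S x)) \<and> equivariant S x f' \<rho>' \<and>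
     conj_class (fundamental_group S x) \<rho> = conj_class (fundamental_group S x) \<rho>'"
    using f by blast
next
  fix C assume "\<exists>A'\<in>bp_structure_of S A. \<exists>f' \<rho>'. developing_map S x A' f' \<and>
     \<rho>' \<in> topspace (Hom_topology (fundamental_group S x)) \<and> equivariant S x f' \<rho>' \<and>
     C = conj_class (fundamental_group S x) \<rho>'"
  then obtain h f' \<rho>' where *: "isotopic_to_id S h" "developing_map S x (push_atlas S h A) f'"
    "\<rho>' \<in> topspace (Hom_topology (fundamental_group S x))" "equivariant S x f' \<rho>'"
    "C = conj_class (fundamental_group S x) \<rho>'"
    by (auto simp: bp_structure_of_def)
  obtain f'' where "developing_map S x A f''" "equivariant S x f'' \<rho>'"
    by (rule developing_pull_back[OF x *(1,2,4)]) blast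
  then show "C = conj_class (fundamental_group S x) \<rho>"
    using holonomy_class_unique[OF x f _ *(3)] *(5) by simp
qed

end

section \<open>Perturbations of the identity of the projective line\<close>

text \<open>One constant for values and differences, so that it can be tracked through products and inverses.\<close>

definition lip_bounded :: "complex set \<Rightarrow> real \<Rightarrow> (complex \<Rightarrow> complex) \<Rightarrow> bool" where
  "lip_bounded B \<eta> h \<longleftrightarrow> (\<forall>z\<in>B. norm (h z) \<le> \<eta>) \<and> (\<forall>z\<in>B. \<forall>w\<in>B. norm (h z - h w) \<le> \<eta> * norm (z - w))"

lemma lip_boundedI:
  assumes "\<And>z. z \<in> B \<Longrightarrow> norm (h z) \<le> \<eta>"
    "\<And>z w. z \<in> B \<Longrightarrow> w \<in> B \<Longrightarrow> norm (h z - h w) \<le> \<eta> * norm (z - w)"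
  shows "lip_bounded B \<eta> h"
  using assms by (simp add: lip_bounded_def)

lemma lip_boundedD:
  assumes "lip_bounded B \<eta> h"
  shows "z \<in> B \<Longrightarrow> norm (h z) \<le> \<eta>"
    "z \<in> B \<Longrightarrow> w \<in> B \<Longrightarrow> norm (h z - h w) \<le> \<eta> * norm (z - w)"
  using assms by (auto simp: lip_bounded_def)

lemma lip_bounded_mono:
  assumes "lip_bounded B \<eta> h" "\<eta> \<le> \<eta>'" "B' \<subseteq> B"
  shows "lip_bounded B' \<eta>' h"
proof (rule lip_boundedI)
  show "norm (h z) \<le> \<eta>'" if "z \<in> B'" for z
    using lip_boundedD(1)[OF assms(1), of z] that assms(2,3) by auto
  show "norm (h z - h w) \<le> \<eta>' * norm (z - w)" if "z \<in> B'" "w \<in> B'" for z w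
    using lip_boundedD(2)[OF assms(1), of z w] that assms(3)
      mult_right_mono[OF assms(2), of "norm (z - w)"] by fastforce
qed

lemma lip_bounded_const: "lip_bounded B (norm c) (\<lambda>_. c)"
  by (rule lip_boundedI) auto

lemma lip_bounded_add:
  assumes "lip_bounded B \<eta> g" "lip_bounded B \<eta>' h"
  shows "lip_bounded B (\<eta> + \<eta>') (\<lambda>z. g z + h z)"
proof (rule lip_boundedI)
  show "norm (g z + h z) \<le> \<eta> + \<eta>'" if "z \<in> B" for z
    using norm_triangle_ineq[of "g z" "h z"] lip_boundedD(1)[OF assms(1) that] lip_boundedD(1)[OF assms(2) that]
    by linarith
  fix z w assume zw: "z \<in> B" "w \<in> B"
  have "norm (g z + h z - (g w + h w)) \<le> norm (g z - g w) + norm (h z - h w)"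
    using norm_triangle_ineq[of "g z - g w" "h z - h w"] by (simp add: algebra_simps)
  also have "\<dots> \<le> \<eta> * norm (z - w) + \<eta>' * norm (z - w)"
    by (intro add_mono lip_boundedD(2)[OF assms(1) zw] lip_boundedD(2)[OF assms(2) zw])
  finally show "norm (g z + h z - (g w + h w)) \<le> (\<eta> + \<eta>') * norm (z - w)"
    by (simp add: distrib_right)
qed

lemma lip_bounded_minus: "lip_bounded B \<eta> h \<Longrightarrow> lip_bounded B \<eta> (\<lambda>z. - h z)"
  by (simp add: lip_bounded_def norm_minus_commute)

lemma lip_bounded_diff:
  assumes "lip_bounded B \<eta> g" "lip_bounded B \<eta>' h"
  shows "lip_bounded B (\<eta> + \<eta>') (\<lambda>z. g z - h z)"
  using lip_bounded_add[OF assms(1) lip_bounded_minus[OF assms(2)]] by simp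

lemma lip_bounded_mult:
  assumes "lip_bounded B \<eta> g" "lip_bounded B \<eta>' h" "0 \<le> \<eta>" "0 \<le> \<eta>'"
  shows "lip_bounded B (2 * \<eta> * \<eta>') (\<lambda>z. g z * h z)"
proof (rule lip_boundedI)
  show "norm (g z * h z) \<le> 2 * \<eta> * \<eta>'" if "z \<in> B" for z
  proof -
    have "norm (g z * h z) \<le> \<eta> * \<eta>'"
      unfolding norm_mult using lip_boundedD(1)[OF assms(1) that] lip_boundedD(1)[OF assms(2) that] assms(3)
      by (intro mult_mono) auto
    also have "\<dots> \<le> 2 * \<eta> * \<eta>'" using mult_nonneg_nonneg[OF assms(3,4)] by simp
    finally show ?thesis .
  qed
  fix z w assume zw: "z \<in> B" "w \<in> B"
  have "g z * h z - g w * h w = g z * (h z - h w) + (g z - g w) * h w" by (simp add: algebra_simps)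
  then have "norm (g z * h z - g w * h w) \<le> norm (g z) * norm (h z - h w) + norm (g z - g w) * norm (h w)"
    using norm_triangle_ineq[of "g z * (h z - h w)" "(g z - g w) * h w"] by (simp add: norm_mult)
  also have "\<dots> \<le> \<eta> * (\<eta>' * norm (z - w)) + (\<eta> * norm (z - w)) * \<eta>'"
    using lip_boundedD[OF assms(1)] lip_boundedD[OF assms(2)] zw assms(3,4)
    by (intro add_mono mult_mono) (auto intro: mult_nonneg_nonneg)
  finally show "norm (g z * h z - g w * h w) \<le> 2 * \<eta> * \<eta>' * norm (z - w)"
    by (simp add: algebra_simps)
qed

lemma lip_bounded_cmult:
  assumes "lip_bounded B \<eta> h"
  shows "lip_bounded B (norm c * \<eta>) (\<lambda>z. h z * c)"
proof (rule lip_boundedI)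
  show "norm (h z * c) \<le> norm c * \<eta>" if "z \<in> B" for z
    using mult_left_mono[OF lip_boundedD(1)[OF assms that], of "norm c"] by (simp add: norm_mult mult.commute)
  fix z w assume zw: "z \<in> B" "w \<in> B"
  have "h z * c - h w * c = (h z - h w) * c" by (simp add: algebra_simps)
  then show "norm (h z * c - h w * c) \<le> norm c * \<eta> * norm (z - w)"
    using mult_left_mono[OF lip_boundedD(2)[OF assms zw], of "norm c"]
    by (simp add: norm_mult mult.commute mult.left_commute)
qed

lemma lip_bounded_inverse:
  assumes "lip_bounded B \<eta> h" "m > 0" "\<And>z. z \<in> B \<Longrightarrow> m \<le> norm (h z)" "0 \<le> \<eta>"
  shows "lip_bounded B (1 / m + \<eta> / m\<^sup>2) (\<lambda>z. inverse (h z))"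
proof (rule lip_boundedI)
  have le: "1 / m \<le> 1 / m + \<eta> / m\<^sup>2" "\<eta> / m\<^sup>2 \<le> 1 / m + \<eta> / m\<^sup>2" using assms(2,4) by auto
  show "norm (inverse (h z)) \<le> 1 / m + \<eta> / m\<^sup>2" if "z \<in> B" for z
  proof -
    have "norm (inverse (h z)) \<le> 1 / m"
      using le_imp_inverse_le[OF assms(3)[OF that] assms(2)] by (simp add: norm_inverse divide_inverse)
    then show ?thesis using le(1) by linarith
  qed
  fix z w assume zw: "z \<in> B" "w \<in> B"
  have nz: "h z \<noteq> 0" "h w \<noteq> 0" using assms(2) assms(3)[OF zw(1)] assms(3)[OF zw(2)] by auto
  have "inverse (h z) - inverse (h w) = (h w - h z) / (h z * h w)"
    using nz by (simp add: field_simps)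
  then have "norm (inverse (h z) - inverse (h w)) = norm (h z - h w) / (norm (h z) * norm (h w))"
    by (simp add: norm_divide norm_mult norm_minus_commute)
  also have "\<dots> \<le> (\<eta> * norm (z - w)) / (m * m)"
    using lip_boundedD(2)[OF assms(1) zw] assms(2) assms(3)[OF zw(1)] assms(3)[OF zw(2)] assms(4)
    by (intro frac_le mult_mono) auto
  also have "\<dots> = \<eta> / m\<^sup>2 * norm (z - w)" by (simp add: power2_eq_square)
  also have "\<dots> \<le> (1 / m + \<eta> / m\<^sup>2) * norm (z - w)" using le(2) by (intro mult_right_mono) auto
  finally show "norm (inverse (h z) - inverse (h w)) \<le> (1 / m + \<eta> / m\<^sup>2) * norm (z - w)" .
qed

lemma lip_bounded_sum:
  assumes "finite J" "\<And>j. j \<in> J \<Longrightarrow> lip_bounded B \<eta> (h j)"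
  shows "lip_bounded B (of_nat (card J) * \<eta>) (\<lambda>z. \<Sum>j\<in>J. h j z)"
  using assms
proof (induction J rule: finite_induct)
  case empty
  then show ?case using lip_bounded_const[of B 0] by simp
next
  case (insert j J)
  have "lip_bounded B (\<eta> + of_nat (card J) * \<eta>) (\<lambda>z. h j z + (\<Sum>j\<in>J. h j z))"
    using insert by (intro lip_bounded_add) auto
  then show ?case using insert(1,2) by (simp add: algebra_simps)
qed

definition loc_lip :: "complex \<Rightarrow> (complex \<Rightarrow> complex) \<Rightarrow> bool" where
  "loc_lip z0 h \<longleftrightarrow> (\<exists>r>0. \<exists>\<eta>\<ge>0. lip_bounded (ball z0 r) \<eta> h)"

lemma loc_lipI: "r > 0 \<Longrightarrow> \<eta> \<ge> 0 \<Longrightarrow> lip_bounded (ball z0 r) \<eta> h \<Longrightarrow> loc_lip z0 h"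
  unfolding loc_lip_def by blast

lemma loc_lipE:
  assumes "loc_lip z0 h" "R > 0"
  obtains r \<eta> where "r > 0" "r \<le> R" "\<eta> \<ge> 0" "lip_bounded (ball z0 r) \<eta> h"
proof -
  obtain r \<eta> where "r > 0" "\<eta> \<ge> 0" "lip_bounded (ball z0 r) \<eta> h" using assms(1) unfolding loc_lip_def by blast
  moreover from this(3) have "lip_bounded (ball z0 (min r R)) \<eta> h" by (rule lip_bounded_mono) auto
  ultimately show ?thesis using assms(2) by (intro that[of "min r R" \<eta>]) auto
qed

lemma loc_lip_const: "loc_lip z0 (\<lambda>_. c)"
  using lip_bounded_const by (intro loc_lipI[of 1 "norm c"]) auto

lemma lip_bounded_id: "lip_bounded (ball z0 1) (norm z0 + 1) (\<lambda>z. z)"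
proof (rule lip_boundedI)
  show "norm z \<le> norm z0 + 1" if "z \<in> ball z0 1" for z
    using that norm_triangle_ineq2[of z z0] by (simp add: dist_norm norm_minus_commute)
  show "norm (z - w) \<le> (norm z0 + 1) * norm (z - w)" for z w
    by (simp add: distrib_right)
qed

lemma loc_lip_id: "loc_lip z0 (\<lambda>z. z)"
  using lip_bounded_id by (intro loc_lipI[of 1 "norm z0 + 1"]) auto

lemma loc_lip_pair:
  assumes "loc_lip z0 g" "loc_lip z0 h"
  obtains r \<eta> where "r > 0" "\<eta> \<ge> 0" "lip_bounded (ball z0 r) \<eta> g" "lip_bounded (ball z0 r) \<eta> h"
proof -
  obtain r \<eta> where 1: "r > 0" "\<eta> \<ge> 0" "lip_bounded (ball z0 r) \<eta> g"
    using assms(1) unfolding loc_lip_def by blast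
  obtain s \<eta>' where 2: "s > 0" "s \<le> r" "\<eta>' \<ge> 0" "lip_bounded (ball z0 s) \<eta>' h"
    by (rule loc_lipE[OF assms(2) 1(1)]) blast
  have "ball z0 s \<subseteq> ball z0 r" using 2(2) by auto
  then show ?thesis
    using that[of s "max \<eta> \<eta>'"] 1 2 lip_bounded_mono[OF 1(3), of "max \<eta> \<eta>'" "ball z0 s"]
      lip_bounded_mono[OF 2(4), of "max \<eta> \<eta>'" "ball z0 s"] by simp
qed

lemma loc_lip_add:
  assumes "loc_lip z0 g" "loc_lip z0 h" shows "loc_lip z0 (\<lambda>z. g z + h z)"
proof -
  obtain r \<eta> where r: "r > 0" "\<eta> \<ge> 0" "lip_bounded (ball z0 r) \<eta> g" "lip_bounded (ball z0 r) \<eta> h"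
    by (rule loc_lip_pair[OF assms]) blast
  then show ?thesis using lip_bounded_add[OF r(3,4)] by (intro loc_lipI[of r "\<eta> + \<eta>"]) auto
qed

lemma loc_lip_mult:
  assumes "loc_lip z0 g" "loc_lip z0 h" shows "loc_lip z0 (\<lambda>z. g z * h z)"
proof -
  obtain r \<eta> where r: "r > 0" "\<eta> \<ge> 0" "lip_bounded (ball z0 r) \<eta> g" "lip_bounded (ball z0 r) \<eta> h"
    by (rule loc_lip_pair[OF assms]) blast
  then show ?thesis using lip_bounded_mult[OF r(3,4,2,2)] by (intro loc_lipI[of r "2 * \<eta> * \<eta>"]) auto
qed

lemma loc_lip_cont:
  assumes "loc_lip z0 h" shows "continuous (at z0) h"
proof -
  obtain r \<eta> where r: "r > 0" "\<eta> \<ge> 0" "lip_bounded (ball z0 r) \<eta> h"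
    using assms unfolding loc_lip_def by blast
  have "\<eta>-lipschitz_on (ball z0 r) h"
    using lip_boundedD(2)[OF r(3)] r(2) by (intro lipschitz_onI) (auto simp: dist_norm)
  then have "continuous_on (ball z0 r) h" by (rule lipschitz_on_continuous_on)
  then show ?thesis using r(1) by (simp add: continuous_on_eq_continuous_at)
qed

lemma loc_lip_inverse:
  assumes "loc_lip z0 h" "h z0 \<noteq> 0"
  shows "loc_lip z0 (\<lambda>z. inverse (h z))"
proof -
  have "0 < norm (h z0) / 2" using assms(2) by simp
  then obtain R where R: "R > 0" "\<forall>z. dist z z0 < R \<longrightarrow> dist (h z) (h z0) < norm (h z0) / 2"
    using loc_lip_cont[OF assms(1)] unfolding continuous_at_eps_delta by blast
  obtain r \<eta> where r: "r > 0" "r \<le> R" "\<eta> \<ge> 0" "lip_bounded (ball z0 r) \<eta> h"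
    by (rule loc_lipE[OF assms(1) R(1)]) blast
  have "norm (h z0) / 2 \<le> norm (h z)" if "z \<in> ball z0 r" for z
  proof -
    have "dist z z0 < R" using that r(2) by (simp add: dist_commute)
    then have "dist (h z) (h z0) < norm (h z0) / 2" by (rule R(2)[rule_format])
    then have "norm (h z0 - h z) < norm (h z0) / 2" by (simp only: dist_norm norm_minus_commute)
    then show ?thesis using norm_triangle_ineq2[of "h z0" "h z0 - h z"] by simp
  qed
  from lip_bounded_inverse[OF r(4) _ this r(3)]
  have "lip_bounded (ball z0 r) (1 / (norm (h z0) / 2) + \<eta> / (norm (h z0) / 2)\<^sup>2) (\<lambda>z. inverse (h z))"
    using assms(2) by simp
  then show ?thesis using r(1,3) by (intro loc_lipI) auto
qed

lemma loc_lip_cong: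
  assumes "loc_lip z0 g" "R > 0" "\<And>z. z \<in> ball z0 R \<Longrightarrow> h z = g z"
  shows "loc_lip z0 h"
proof -
  obtain r \<eta> where r: "r > 0" "r \<le> R" "\<eta> \<ge> 0" "lip_bounded (ball z0 r) \<eta> g"
    by (rule loc_lipE[OF assms(1,2)]) blast
  have "lip_bounded (ball z0 r) \<eta> h"
    using r(2,4) assms(3) by (auto simp: lip_bounded_def)
  then show ?thesis using r by (intro loc_lipI)
qed

lemma loc_lip_sum:
  assumes "finite J" "\<And>j. j \<in> J \<Longrightarrow> loc_lip z0 (h j)"
  shows "loc_lip z0 (\<lambda>z. \<Sum>j\<in>J. h j z)"
  using assms by (induction J rule: finite_induct) (auto intro: loc_lip_const loc_lip_add)

text \<open>The bump functions on the surface have this form when they are expressed by the values of a chart.\<close>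

lemma loc_lip_bump:
  assumes "loc_lip z0 h" "\<delta> > 0"
  shows "loc_lip z0 (\<lambda>z. complex_of_real (max 0 (\<delta> - norm (h z - c))))"
proof -
  obtain r \<eta> where r: "r > 0" "\<eta> \<ge> 0" "lip_bounded (ball z0 r) \<eta> h"
    using assms(1) unfolding loc_lip_def by blast
  have "lip_bounded (ball z0 r) (\<delta> + \<eta>) (\<lambda>z. complex_of_real (max 0 (\<delta> - norm (h z - c))))"
  proof (rule lip_boundedI)
    show "norm (complex_of_real (max 0 (\<delta> - norm (h z - c)))) \<le> \<delta> + \<eta>" for z
    proof -
      have "max 0 (\<delta> - norm (h z - c)) \<le> \<delta>" using assms(2) by simp
      also have "\<dots> \<le> \<delta> + \<eta>" using r(2) by simp
      finally show ?thesis by (simp only: norm_of_real abs_of_nonneg max.cobounded1)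
    qed
    fix z w assume zw: "z \<in> ball z0 r" "w \<in> ball z0 r"
    have "\<bar>max 0 (\<delta> - norm (h z - c)) - max 0 (\<delta> - norm (h w - c))\<bar> \<le> \<bar>norm (h z - c) - norm (h w - c)\<bar>"
      by (auto simp: max_def)
    also have "\<dots> \<le> norm (h z - h w)"
      using norm_triangle_ineq3[of "h z - c" "h w - c"] by simp
    also have "\<dots> \<le> \<eta> * norm (z - w)" by (rule lip_boundedD(2)[OF r(3) zw])
    also have "\<dots> \<le> (\<delta> + \<eta>) * norm (z - w)" using assms(2) by (intro mult_right_mono) auto
    finally show "norm (complex_of_real (max 0 (\<delta> - norm (h z - c))) -
        complex_of_real (max 0 (\<delta> - norm (h w - c)))) \<le> (\<delta> + \<eta>) * norm (z - w)"
      by (simp flip: of_real_diff)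
  qed
  then show ?thesis using r assms(2) by (intro loc_lipI) auto
qed

lemma loc_lip_PSL2_act:
  assumes M: "M \<in> carrier PSL2" and z0: "PSL2_act M (affline a z0) \<in> affdom b"
  shows "loc_lip z0 (\<lambda>z. affcoord b (PSL2_act M (affline a z)))"
    and "\<exists>R>0. \<forall>z\<in>ball z0 R. PSL2_act M (affline a z) \<in> affdom b"
proof -
  obtain p q r s where pqrs: "p * s - q * r \<noteq> 0"
    "\<And>z. PSL2_act M (affline a z) \<in> affdom b \<longleftrightarrow> r * z + s \<noteq> 0"
    "\<And>z. r * z + s \<noteq> 0 \<Longrightarrow> affcoord b (PSL2_act M (affline a z)) = (p * z + q) / (r * z + s)"
    by (rule PSL2_act_affine_form[OF M, of a b]) blast
  have nz: "r * z0 + s \<noteq> 0" using z0 pqrs(2) by simp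
  have lip: "loc_lip z0 (\<lambda>z. p * z + q)" "loc_lip z0 (\<lambda>z. r * z + s)"
    by (intro loc_lip_add loc_lip_mult loc_lip_const loc_lip_id)+
  have quot: "loc_lip z0 (\<lambda>z. (p * z + q) * inverse (r * z + s))"
    by (intro loc_lip_mult lip loc_lip_inverse nz)
  have op: "open {z. r * z + s \<noteq> 0}"
    by (intro open_Collect_neq continuous_intros)
  have "z0 \<in> {z. r * z + s \<noteq> 0}" using nz by simp
  from bspec[OF iffD1[OF open_contains_ball op] this]
  obtain R where R: "R > 0" "ball z0 R \<subseteq> {z. r * z + s \<noteq> 0}" by blast
  then have R': "r * z + s \<noteq> 0" if "z \<in> ball z0 R" for z using that by blast
  then show "\<exists>R>0. \<forall>z\<in>ball z0 R. PSL2_act M (affline a z) \<in> affdom b"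
    using R(1) pqrs(2) by blast
  show "loc_lip z0 (\<lambda>z. affcoord b (PSL2_act M (affline a z)))"
    by (rule loc_lip_cong[OF quot R(1)]) (use R' pqrs(3) in \<open>simp add: divide_inverse\<close>)
qed

text \<open>The difference \<open>\<kappa> z - z\<close> is a numerator with Lipschitz constant at most \<open>\<eta> (1 + 2 R)\<^sup>2\<close> over a
  denominator close to 1. The constant \<open>60 = 2 * 10 * 3\<close> is the product of the factor 2 in the product
  rule, the constant 10 of the inverse of the denominator and the target 1/3.\<close>

lemma moebius_near_identity:
  assumes id: "lip_bounded B R (\<lambda>z. z)" "R \<ge> 1"
    and small: "lip_bounded B \<eta> \<alpha>" "lip_bounded B \<eta> b" "lip_bounded B \<eta> c" "lip_bounded B \<eta> d"
    and \<eta>: "\<eta> \<ge> 0" "\<eta> * (60 * (1 + 2 * R)\<^sup>2) \<le> 1"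
  defines "\<kappa> \<equiv> \<lambda>z. ((1 + \<alpha> z) * z + b z) / (1 + d z + c z * z)"
  shows "z \<in> B \<Longrightarrow> 1 + d z + c z * z \<noteq> 0"
    and "z \<in> B \<Longrightarrow> w \<in> B \<Longrightarrow> norm (\<kappa> z - \<kappa> w - (z - w)) \<le> norm (z - w) / 3"
proof -
  have R0: "0 \<le> R" using id(2) by simp
  define num where "num z = \<alpha> z * z + b z - (c z * z) * z - d z * z" for z
  define den where "den z = 1 + (d z + c z * z)" for z
  have cz: "lip_bounded B (2 * \<eta> * R) (\<lambda>z. c z * z)" by (rule lip_bounded_mult[OF small(3) id(1) \<eta>(1) R0])
  have "lip_bounded B (2 * \<eta> * R + \<eta> + 2 * (2 * \<eta> * R) * R + 2 * \<eta> * R) num"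
    unfolding num_def
    by (intro lip_bounded_diff lip_bounded_add lip_bounded_mult cz small id \<eta>(1) R0)
      (use \<eta>(1) R0 in auto)
  moreover have "2 * \<eta> * R + \<eta> + 2 * (2 * \<eta> * R) * R + 2 * \<eta> * R = \<eta> * (1 + 2 * R)\<^sup>2"
    by (simp add: power2_eq_square algebra_simps)
  ultimately have num: "lip_bounded B (\<eta> * (1 + 2 * R)\<^sup>2) num" by simp
  have "lip_bounded B (\<eta> + 2 * \<eta> * R) (\<lambda>z. d z + c z * z)"
    by (rule lip_bounded_add[OF small(4) cz])
  moreover have "\<eta> + 2 * \<eta> * R \<le> 1/2"
  proof -
    have "\<eta> + 2 * \<eta> * R = \<eta> * (1 + 2 * R)" by (simp add: algebra_simps)
    also have "\<dots> \<le> \<eta> * (1 + 2 * R)\<^sup>2"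
      using \<eta>(1) R0 by (intro mult_left_mono) (auto simp: power2_eq_square intro: mult_nonneg_nonneg)
    finally show ?thesis using \<eta>(2) by (simp add: mult.left_commute)
  qed
  ultimately have e: "lip_bounded B (1/2) (\<lambda>z. d z + c z * z)" by (rule lip_bounded_mono) simp
  then have "lip_bounded B (norm (1::complex) + 1/2) den"
    unfolding den_def by (intro lip_bounded_add lip_bounded_const)
  then have den: "lip_bounded B 2 den" by (rule lip_bounded_mono) auto
  have den_ge: "1/2 \<le> norm (den z)" if "z \<in> B" for z
    using norm_diff_ineq[of 1 "d z + c z * z"] lip_boundedD(1)[OF e that] by (simp add: den_def)
  have "lip_bounded B (1 / (1/2) + 2 / (1/2)\<^sup>2) (\<lambda>z. inverse (den z))"
    by (rule lip_bounded_inverse[OF den _ den_ge]) auto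
  then have "lip_bounded B 10 (\<lambda>z. inverse (den z))" by (simp add: power2_eq_square)
  from lip_bounded_mult[OF num this]
  have "lip_bounded B (2 * (\<eta> * (1 + 2 * R)\<^sup>2) * 10) (\<lambda>z. num z * inverse (den z))"
    using \<eta>(1) by simp
  then have quot: "lip_bounded B (1/3) (\<lambda>z. num z * inverse (den z))"
    by (rule lip_bounded_mono) (use \<eta>(2) in \<open>auto simp: mult.left_commute\<close>)
  have nz: "den z \<noteq> 0" if "z \<in> B" for z using den_ge[OF that] by auto
  then show "z \<in> B \<Longrightarrow> 1 + d z + c z * z \<noteq> 0" by (simp add: den_def add.assoc)
  have \<kappa>: "\<kappa> z - z = num z * inverse (den z)" if "z \<in> B" for z
    using nz[OF that] unfolding \<kappa>_def num_def
    by (simp add: den_def divide_inverse[symmetric] add.assoc) (simp add: field_simps)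
  show "norm (\<kappa> z - \<kappa> w - (z - w)) \<le> norm (z - w) / 3" if "z \<in> B" "w \<in> B"
  proof -
    have "\<kappa> z - \<kappa> w - (z - w) = num z * inverse (den z) - num w * inverse (den w)"
      using \<kappa>[OF that(1)] \<kappa>[OF that(2)] by (simp add: algebra_simps)
    then show ?thesis using lip_boundedD(2)[OF quot that] by simp
  qed
qed

text \<open>The image of a line under a matrix, which may be singular.\<close>

definition mact :: "complex^2^2 \<Rightarrow> (complex^2) set \<Rightarrow> (complex^2) set" where
  "mact A L = (\<lambda>v. A *v v) ` L"

lemma mact_span: "mact A (vec.span {v}) = vec.span {A *v v}"
proof -
  have "A *v (c *s v) = c *s (A *v v)" for c
    by (simp add: matrix_vector_mult_def vec_eq_iff sum_distrib_left algebra_simps)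
  then show ?thesis by (simp add: mact_def vec.span_singleton image_image)
qed

lemma mact_mult: "mact (A ** B) L = mact A (mact B L)"
  by (auto simp: mact_def image_image matrix_vector_mul_assoc)

lemma PSL2_act_mact:
  assumes "L \<in> topspace CP1" shows "PSL2_act (pm A) L = mact A L"
  using assms by (auto elim!: CP1_E simp: PSL2_act_pm mact_span)

lemma or_iso_cong:
  assumes k: "or_iso N N' k k'" and eq: "\<And>L. L \<in> N \<Longrightarrow> k L = l L"
  shows "or_iso N N' l k'"
proof -
  have N: "openin CP1 N" using k by (simp add: or_iso_def)
  then have top: "topspace (subtopology CP1 N) = N" using openin_subset by auto
  have "CP1_or_at l L" if L: "L \<in> N" for L
  proof -
    obtain a b where ab: "L \<in> affdom a" "k L \<in> affdom b" "or_at (\<lambda>z. affcoord b (k (affline a z))) (affcoord a L)"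
      using k L unfolding or_iso_def CP1_or_at_def by blast
    have "open (affcoord a ` (N \<inter> affdom a))"
      using planar_chartD(4)[OF planar_chart_aff openin_Int[OF N planar_chartD(1)[OF planar_chart_aff]]] by blast
    moreover have "affcoord a L \<in> affcoord a ` (N \<inter> affdom a)" using L ab by blast
    ultimately have "\<forall>\<^sub>F z in nhds (affcoord a L). z \<in> affcoord a ` (N \<inter> affdom a)"
      by (rule eventually_nhds_in_open)
    then have ev: "\<forall>\<^sub>F z in nhds (affcoord a L). affcoord b (k (affline a z)) = affcoord b (l (affline a z))"
      by eventually_elim (use eq in auto)
    then have "or_at (\<lambda>z. affcoord b (l (affline a z))) (affcoord a L)"
      using ab(3) by (simp only: or_at_cong[OF ev])
    then show ?thesis unfolding CP1_or_at_def using ab(1,2) eq[OF L] by auto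
  qed
  moreover have "homeomorphic_maps (subtopology CP1 N) (subtopology CP1 N') l k'"
    by (rule homeomorphic_maps_eq[of _ _ k k']) (use k eq top in \<open>auto simp: or_iso_def\<close>)
  ultimately show ?thesis using k unfolding or_iso_def by blast
qed

definition mat_comb :: "'i set \<Rightarrow> ('i \<Rightarrow> complex) \<Rightarrow> ('i \<Rightarrow> complex^2^2) \<Rightarrow> complex^2^2" where
  "mat_comb J u C = (\<chi> k l. \<Sum>j\<in>J. u j * C j $ k $ l)"

text \<open>In an affine coordinate the combination acts by a Moebius formula whose coefficients are functions
  of the point. They differ from those of the identity by functions with small Lipschitz constants,
  so that the action is close to the identity in the Lipschitz sense.\<close>

lemma mat_comb_near_identity:
  fixes u :: "'i \<Rightarrow> complex \<Rightarrow> complex"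
  assumes J: "finite J" and u: "\<And>j. j \<in> J \<Longrightarrow> loc_lip z0 (u j)"
    and one: "R0 > 0" "\<And>z. z \<in> ball z0 R0 \<Longrightarrow> (\<Sum>j\<in>J. u j z) = 1"
  obtains r \<epsilon> where "r > 0" "r \<le> R0" "\<epsilon> > 0"
    "\<forall>C :: 'i \<Rightarrow> complex^2^2. (\<forall>j\<in>J. norm (C j - mat 1) < \<epsilon>) \<longrightarrow> (\<exists>N' k'.
       or_iso (affline a ` ball z0 r) N' (\<lambda>L. mact (mat_comb J (\<lambda>j. u j (affcoord a L)) C) L) k')"
proof -
  have "\<exists>r \<Lambda>. r > 0 \<and> r \<le> min 1 R0 \<and> \<Lambda> \<ge> 0 \<and> (\<forall>j\<in>J. lip_bounded (ball z0 r) \<Lambda> (u j))"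
    using J u
  proof (induction J rule: finite_induct)
    case empty
    then show ?case using one(1) by (intro exI[of _ "min 1 R0"] exI[of _ 0]) auto
  next
    case (insert j J)
    then obtain r \<Lambda> where r: "r > 0" "r \<le> min 1 R0" "\<Lambda> \<ge> 0" "\<forall>j\<in>J. lip_bounded (ball z0 r) \<Lambda> (u j)"
      by auto
    have "loc_lip z0 (u j)" using insert by simp
    then obtain s \<eta> where s: "s > 0" "s \<le> r" "\<eta> \<ge> 0" "lip_bounded (ball z0 s) \<eta> (u j)"
      by (rule loc_lipE[OF _ r(1)]) blast
    have sub: "ball z0 s \<subseteq> ball z0 r" using s(2) by auto
    have "lip_bounded (ball z0 s) (max \<Lambda> \<eta>) (u i)" if "i \<in> insert j J" for i
      using that r(4) s(4) sub by (auto intro: lip_bounded_mono)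
    then show ?case using r s by (intro exI[of _ s] exI[of _ "max \<Lambda> \<eta>"]) auto
  qed
  then obtain r \<Lambda> where r: "r > 0" "r \<le> 1" "r \<le> R0" "\<Lambda> \<ge> 0" "\<And>j. j \<in> J \<Longrightarrow> lip_bounded (ball z0 r) \<Lambda> (u j)"
    by auto
  let ?B = "ball z0 r"
  define R where "R = norm z0 + 1"
  have id: "lip_bounded ?B R (\<lambda>z. z)" unfolding R_def
    by (rule lip_bounded_mono[OF lip_bounded_id]) (use r(2) in auto)
  have R1: "R \<ge> 1" by (simp add: R_def)
  define X where "X = 60 * (1 + 2 * R)\<^sup>2"
  have X: "X > 0" unfolding X_def using R1 by (intro mult_pos_pos zero_less_power) auto
  define n where "n = real (card J)"
  \<comment> \<open>the entries of the combination differ from those of the identity by functions with constant \<open>n * \<epsilon> * \<Lambda>\<close>\<close>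
  define \<epsilon> where "\<epsilon> = 1 / (X * (n * \<Lambda> + 1))"
  have n: "n * \<Lambda> \<ge> 0" using r(4) by (simp add: n_def)
  have \<epsilon>: "\<epsilon> > 0" unfolding \<epsilon>_def using X n by (simp add: add_nonneg_pos)
  define \<eta> where "\<eta> = n * (\<epsilon> * \<Lambda>)"
  have \<eta>0: "\<eta> \<ge> 0" using \<epsilon> r(4) by (simp add: \<eta>_def n_def)
  have "\<epsilon> * X = 1 / (n * \<Lambda> + 1)" using X by (simp add: \<epsilon>_def)
  moreover have "\<eta> * X = (n * \<Lambda>) * (\<epsilon> * X)" by (simp add: \<eta>_def)
  ultimately have "\<eta> * X = (n * \<Lambda>) / (n * \<Lambda> + 1)" by simp
  also have "\<dots> \<le> 1" using n by simp
  finally have \<eta>: "\<eta> \<ge> 0" "\<eta> * (60 * (1 + 2 * R)\<^sup>2) \<le> 1" using \<eta>0 by (simp_all add: X_def)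
  show ?thesis
  proof (rule that[OF r(1,3) \<epsilon>], intro allI impI)
    fix C :: "'i \<Rightarrow> complex^2^2" assume C': "\<forall>j\<in>J. norm (C j - mat 1) < \<epsilon>"
    note C = C'[rule_format]
    define E where "E k l z = (\<Sum>j\<in>J. u j z * (C j - mat 1) $ k $ l)" for k l z
    have E: "lip_bounded ?B \<eta> (E k l)" for k l
      unfolding E_def \<eta>_def n_def
    proof (rule lip_bounded_sum[OF J])
      fix j assume j: "j \<in> J"
      have "norm ((C j - mat 1) $ k $ l) \<le> norm ((C j - mat 1) $ k)" by (rule Finite_Cartesian_Product.norm_nth_le)
      also have "\<dots> \<le> norm (C j - mat 1)" by (rule Finite_Cartesian_Product.norm_nth_le)
      finally have "norm ((C j - mat 1) $ k $ l) \<le> \<epsilon>" using C[OF j] by simp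
      then have "norm ((C j - mat 1) $ k $ l) * \<Lambda> \<le> \<epsilon> * \<Lambda>" using r(4) by (rule mult_right_mono)
      then show "lip_bounded ?B (\<epsilon> * \<Lambda>) (\<lambda>z. u j z * (C j - mat 1) $ k $ l)"
        by (rule lip_bounded_mono[OF lip_bounded_cmult[OF r(5)[OF j]]]) simp
    qed
    define A where "A z = mat_comb J (\<lambda>j. u j z) C" for z
    have A: "A z $ k $ l = mat 1 $ k $ l + E k l z" if "z \<in> ?B" for z k l
    proof -
      have "E k l z = (\<Sum>j\<in>J. u j z * C j $ k $ l) - (\<Sum>j\<in>J. u j z) * mat 1 $ k $ l"
        by (simp add: E_def right_diff_distrib sum_subtractf sum_distrib_right)
      then show ?thesis using one(2)[of z] that r(3) by (simp add: A_def mat_comb_def)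
    qed
    define \<kappa> where "\<kappa> z = slope a (A z *v affvec a z)" for z
    define k1 k2 :: 2 where "k1 = (if a then 2 else 1)" and "k2 = (if a then 1 else 2)"
    have form: "\<kappa> z = ((1 + E k1 k1 z) * z + E k1 k2 z) / (1 + E k2 k2 z + E k2 k1 z * z)"
      "denom a (A z *v affvec a z) = 1 + E k2 k2 z + E k2 k1 z * z" if "z \<in> ?B" for z
      using A[OF that]
      by (auto simp: \<kappa>_def slope_def denom_def affvec_def matrix_vector_mult_def sum_2 mat_def k1_def k2_def algebra_simps)
    note near = moebius_near_identity[OF id R1 E[of k1 k1] E[of k1 k2] E[of k2 k1] E[of k2 k2] \<eta>]
    have nz: "denom a (A z *v affvec a z) \<noteq> 0" if "z \<in> ?B" for z
      unfolding form(2)[OF that] by (rule near(1)[OF that])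
    have "norm (\<kappa> z - \<kappa> w - (z - w)) \<le> norm (z - w) / 3" if "z \<in> ?B" "w \<in> ?B" for z w
      unfolding form(1)[OF that(1)] form(1)[OF that(2)] by (rule near(2)[OF that])
    from or_iso_near_identity[OF r(1) this, where b = a]
    have "or_iso (affline a ` ?B) (affline a ` \<kappa> ` ?B) (\<lambda>L. affline a (\<kappa> (affcoord a L)))
      (\<lambda>L. affline a (inv_into ?B \<kappa> (affcoord a L)))" .
    moreover have "affline a (\<kappa> (affcoord a L)) = mact (A (affcoord a L)) L" if L: "L \<in> affline a ` ?B" for L
    proof -
      obtain z where z: "z \<in> ?B" "L = affline a z" using L by blast
      have "mact (A z) L = vec.span {A z *v affvec a z}" unfolding z(2) affline_def by (rule mact_span)
      also have "\<dots> = affline a (\<kappa> z)" unfolding \<kappa>_def by (rule span_eq_affline[OF nz[OF z(1)]])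
      finally show ?thesis using z by simp
    qed
    ultimately have "or_iso (affline a ` ?B) (affline a ` \<kappa> ` ?B) (\<lambda>L. mact (A (affcoord a L)) L)
      (\<lambda>L. affline a (inv_into ?B \<kappa> (affcoord a L)))"
      by (rule or_iso_cong)
    then show "\<exists>N' k'. or_iso (affline a ` ?B) N' (\<lambda>L. mact (mat_comb J (\<lambda>j. u j (affcoord a L)) C) L) k'"
      unfolding A_def by blast
  qed
qed

section \<open>Perturbation of a developing map\<close>

lemma deck_free:
  assumes "g \<in> carrier (fundamental_group S x)" "h \<in> carrier (fundamental_group S x)" "Q \<in> ucover S x"
    and eq: "class_join S g Q = class_join S h Q"
  shows "g = h"
proof -
  obtain l m where l: "l \<in> loops S x" "g = path_class S l" and m: "m \<in> loops S x" "h = path_class S m"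
    using assms(1,2) by (auto simp: carrier_fundamental_group_loops)
  obtain q where q: "pth S q" "pathstart q = x" "Q = path_class S q" using assms(3) by (rule ucoverE)
  note lD = loopsD[OF l(1)] and mD = loopsD[OF m(1)]
  have e: "path_class S (l +++ q) = path_class S (m +++ q)"
    using eq unfolding l(2) m(2) q(3) deck_path_class[OF l(1) q(1,2)] deck_path_class[OF m(1) q(1,2)] .
  have "g = path_class S ((l +++ q) +++ reversepath q)"
    unfolding l(2) using lD q by (intro path_class_cancel_right'[symmetric]) auto
  also have "\<dots> = path_class S ((m +++ q) +++ reversepath q)"
    using lD q by (intro path_class_join_cong[OF e refl]) auto
  also have "\<dots> = h"
    unfolding m(2) using mD q by (intro path_class_cancel_right') auto
  finally show ?thesis .
qed

definition deck_diff :: "'a::topological_space set \<Rightarrow> 'a \<Rightarrow> (real \<Rightarrow> 'a) set \<Rightarrow> (real \<Rightarrow> 'a) set \<Rightarrow> (real \<Rightarrow> 'a) set" where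
  "deck_diff S x P Q = (SOME g. g \<in> carrier (fundamental_group S x) \<and> P = class_join S g Q)"

lemma deck_diff:
  assumes "P \<in> ucover S x" "Q \<in> ucover S x" "cover_proj P = cover_proj Q"
  shows "deck_diff S x P Q \<in> carrier (fundamental_group S x)" "class_join S (deck_diff S x P Q) Q = P"
proof -
  have "\<exists>g. g \<in> carrier (fundamental_group S x) \<and> P = class_join S g Q"
    using deck_transitive[OF assms] by blast
  from someI_ex[OF this]
  show "deck_diff S x P Q \<in> carrier (fundamental_group S x)" "class_join S (deck_diff S x P Q) Q = P"
    by (simp_all add: deck_diff_def)
qed

lemma deck_diff_eqI:
  assumes "g \<in> carrier (fundamental_group S x)" "Q \<in> ucover S x" "P = class_join S g Q"
  shows "deck_diff S x P Q = g"
proof -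
  have P: "P \<in> ucover S x" "cover_proj P = cover_proj Q" using deck_in_ucover[OF assms(1,2)] assms(3) by simp_all
  note d = deck_diff[OF P(1) assms(2) P(2)]
  show ?thesis by (rule deck_free[OF d(1) assms(1,2) trans[OF d(2) assms(3)]])
qed

lemma deck_diff_deck:
  assumes "P \<in> ucover S x" "Q \<in> ucover S x" "cover_proj P = cover_proj Q" "g \<in> carrier (fundamental_group S x)"
  shows "deck_diff S x (class_join S g P) Q = class_join S g (deck_diff S x P Q)"
proof (rule deck_diff_eqI[OF _ assms(2)])
  note d = deck_diff[OF assms(1-3)]
  show "class_join S g (deck_diff S x P Q) \<in> carrier (fundamental_group S x)"
    by (rule deck_mult(2)[OF assms(4) d(1) assms(2)])
  show "class_join S g P = class_join S (class_join S g (deck_diff S x P Q)) Q"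
    using deck_mult(1)[OF assms(4) d(1) assms(2)] d(2) by simp
qed

lemma PSL2_act_mult_span:
  assumes "M \<in> carrier PSL2" "N \<in> carrier PSL2"
  shows "PSL2_act (M \<otimes>\<^bsub>PSL2\<^esub> N) (vec.span {v}) = PSL2_act M (PSL2_act N (vec.span {v}))"
  using assms by (auto elim!: PSL2_E simp: PSL2_act_pm matrix_vector_mul_assoc)

lemma mat_comb_conj: "mat_comb J u (\<lambda>j. X ** C j ** Y) = X ** mat_comb J u C ** Y"
  by (simp add: mat_comb_def vec_eq_iff matrix_matrix_mult_def sum_2 forall_2
      sum_distrib_left sum_distrib_right sum.distrib algebra_simps)

lemma mat_comb_cong:
  assumes "\<And>j. j \<in> J \<Longrightarrow> u j \<noteq> 0 \<Longrightarrow> C j = C' j"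
  shows "mat_comb J u C = mat_comb J u C'"
proof -
  have "u j * C j $ k $ l = u j * C' j $ k $ l" if "j \<in> J" for j k l
    using assms[OF that] by (cases "u j = 0") auto
  then have "(\<Sum>j\<in>J. u j * C j $ k $ l) = (\<Sum>j\<in>J. u j * C' j $ k $ l)" for k l
    by (intro sum.cong refl)
  then show ?thesis by (simp add: mat_comb_def)
qed

lemma mat_comb_mono_neutral:
  assumes "finite I" "J \<subseteq> I" "\<And>j. j \<in> I - J \<Longrightarrow> u j = 0"
  shows "mat_comb I u C = mat_comb J u C"
  unfolding mat_comb_def using assms
  by (auto simp: vec_eq_iff intro!: sum.mono_neutral_right)

lemma mact_mat_comb_scale:
  assumes "c \<noteq> 0" "L \<in> topspace CP1"
  shows "mact (mat_comb J (\<lambda>j. u j * c) C) L = mact (mat_comb J u C) L"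
proof -
  obtain v where v: "L = vec.span {v}" using assms(2) by (rule CP1_E)
  have "mat_comb J (\<lambda>j. u j * c) C *v v = c *s (mat_comb J u C *v v)"
    by (simp add: mat_comb_def vec_eq_iff matrix_vector_mult_def sum_2 forall_2
        sum_distrib_left sum_distrib_right sum.distrib algebra_simps)
  then show ?thesis unfolding v mact_span using assms(1) by (intro line_eqI)
qed

lemma tendsto_matrix_mult:
  fixes X Y :: "'b \<Rightarrow> complex^2^2"
  assumes "(X \<longlongrightarrow> A) F" "(Y \<longlongrightarrow> B) F"
  shows "((\<lambda>t. X t ** Y t) \<longlongrightarrow> A ** B) F"
  unfolding matrix_matrix_mult_def
  by (intro tendsto_vec_lambda tendsto_sum tendsto_mult tendsto_vec_nth assms)

locale developed = branched S \<O> A for S :: "'a::topological_space set" and \<O> A +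
  fixes x :: 'a and f :: "(real \<Rightarrow> 'a) set \<Rightarrow> (complex^2) set" and \<rho> :: "(real \<Rightarrow> 'a) set \<Rightarrow> (complex^2^2) set"
  assumes x: "x \<in> S" and dev: "developing_map S x A f"
    and hom: "\<rho> \<in> topspace (Hom_topology (fundamental_group S x))" and equiv: "equivariant S x f \<rho>"
begin

abbreviation G :: "(real \<Rightarrow> 'a) set monoid" where "G \<equiv> fundamental_group S x"

lemma equivD:
  "g \<in> carrier G \<Longrightarrow> P \<in> ucover S x \<Longrightarrow> f (class_join S g P) = PSL2_act (\<rho> g) (f P)"
  using equiv by (simp add: equivariant_def topspace_universal_cover)

text \<open>A disc around \<open>q\<close> over which \<open>f\<close>, continued along \<open>p\<close>, is a map \<open>\<phi>\<close> into an affine part of the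
  projective line. The compact set \<open>K\<close> contains the support of the bump function of the disc.\<close>

definition chart_data :: "'a \<Rightarrow> (real \<Rightarrow> 'a) \<Rightarrow> 'a set \<Rightarrow> ('a \<Rightarrow> (complex^2) set) \<Rightarrow> bool \<Rightarrow> real \<Rightarrow> 'a set \<Rightarrow> bool" where
  "chart_data q p W \<phi> a \<delta> K \<longleftrightarrow> pth S p \<and> pathstart p = x \<and> pathfinish p = q \<and> disc W \<and> q \<in> W \<and>
     flat W \<phi> \<and> (\<forall>Q\<in>sheet S p W. f Q = \<phi> (cover_proj Q)) \<and> \<phi> ` W \<subseteq> affdom a \<and> \<delta> > 0 \<and>
     compact K \<and> K \<subseteq> W \<and> (\<forall>y\<in>W. norm (affcoord a (\<phi> y) - affcoord a (\<phi> q)) < \<delta> \<longrightarrow> y \<in> K) \<and>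
     continuous_map (subtopology (top_of_set S) W) CP1 \<phi>"

lemma chart_data_exists:
  assumes q: "q \<in> S"
  shows "\<exists>p W \<phi> a \<delta> K. chart_data q p W \<phi> a \<delta> K"
proof -
  obtain p where p: "pth S p" "pathstart p = x" "pathfinish p = q" by (rule path_to[OF x q]) blast
  obtain N F where N: "flat N F" "pathfinish p \<in> N" "\<And>Q. Q \<in> sheet S p N \<Longrightarrow> f Q = F (cover_proj Q)"
    by (rule developingE[OF dev p(1,2)]) blast
  have qN: "q \<in> N" using N(2) p(3) by simp
  let ?F = "restrict F N"
  obtain m where m: "m \<ge> 1" "power_form_at S \<O> (N, ?F) q m"
    using bp_chartD(3)[OF atlas_chart[OF flat_in_atlas[OF N(1)]] qN] by blast
  obtain W w a r \<delta> K where W: "planar_chart (top_of_set S) (W, w)" "q \<in> W" "W \<subseteq> N \<inter> N"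
    "w ` W = ball 0 r" "r > 0" "?F ` W \<subseteq> affdom a" "\<delta> > 0" "compact K" "K \<subseteq> W"
    "\<And>y. y \<in> W \<Longrightarrow> norm (affcoord a (?F y) - affcoord a (?F q)) < \<delta> \<Longrightarrow> y \<in> K"
    "continuous_map (subtopology (top_of_set S) W) CP1 ?F"
    by (rule power_form_disc[OF m(2,1) flat_opn[OF N(1)] qN]) (rule that)
  have disc: "disc W" unfolding disc_def using W(1,4) by (intro exI[of _ w]) simp
  have WN: "W \<subseteq> N" using W(3) by simp
  have "flat W ?F"
    by (rule flat_subset[OF flat_chart[OF flat_in_atlas[OF N(1)]] disc_opn[OF disc] WN])
  moreover have "f Q = ?F (cover_proj Q)" if "Q \<in> sheet S p W" for Q
  proof -
    have "Q \<in> sheet S p N" using sheet_mono[OF WN, of S p] that by blast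
    moreover from this have "cover_proj Q \<in> N"
      by (rule cover_proj_sheet[OF p(1) opn_subset[OF flat_opn[OF N(1)]]])
    ultimately show ?thesis using N(3) by simp
  qed
  ultimately have "chart_data q p W ?F a \<delta> K"
    unfolding chart_data_def using p W disc by simp
  then show ?thesis by blast
qed

text \<open>A lift of the holonomy to matrices, and nearby lifts of nearby representations. The lifts are
  not multiplicative, only multiplicative up to sign.\<close>

definition lift :: "(real \<Rightarrow> 'a) set \<Rightarrow> complex^2^2" where
  "lift g = (SOME A. det A = 1 \<and> \<rho> g = pm A)"

definition near_lift :: "((real \<Rightarrow> 'a) set \<Rightarrow> (complex^2^2) set) \<Rightarrow> (real \<Rightarrow> 'a) set \<Rightarrow> complex^2^2" where
  "near_lift \<rho>' g = (SOME A. det A = 1 \<and> \<rho>' g = pm A \<and> norm (A - lift g) \<le> norm (- A - lift g))"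

lemma lift: "g \<in> carrier G \<Longrightarrow> det (lift g) = 1 \<and> \<rho> g = pm (lift g)"
proof -
  assume "g \<in> carrier G"
  then have "\<exists>A. det A = 1 \<and> \<rho> g = pm A" using Hom_values[OF hom] by (metis PSL2_E)
  from someI_ex[OF this] show ?thesis by (simp add: lift_def)
qed

lemma near_lift:
  assumes "\<rho>' \<in> topspace (Hom_topology G)" "g \<in> carrier G"
  shows "det (near_lift \<rho>' g) = 1" "\<rho>' g = pm (near_lift \<rho>' g)"
    "norm (near_lift \<rho>' g - lift g) \<le> norm (- near_lift \<rho>' g - lift g)"
proof -
  obtain A where A: "det A = 1" "\<rho>' g = pm A" using Hom_values[OF assms] by (rule PSL2_E)
  have "\<exists>A. det A = 1 \<and> \<rho>' g = pm A \<and> norm (A - lift g) \<le> norm (- A - lift g)"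
  proof (cases "norm (A - lift g) \<le> norm (- A - lift g)")
    case True then show ?thesis using A by blast
  next
    case False then show ?thesis using A by (intro exI[of _ "- A"]) simp
  qed
  from someI_ex[OF this]
  show "det (near_lift \<rho>' g) = 1" "\<rho>' g = pm (near_lift \<rho>' g)"
    "norm (near_lift \<rho>' g - lift g) \<le> norm (- near_lift \<rho>' g - lift g)"
    by (simp_all add: near_lift_def)
qed

abbreviation near :: "((real \<Rightarrow> 'a) set \<Rightarrow> (complex^2^2) set) filter" where
  "near \<equiv> nhdsin (Hom_topology G) \<rho>"

lemma eventually_Hom: "\<forall>\<^sub>F \<rho>' in near. \<rho>' \<in> topspace (Hom_topology G)"
  unfolding eventually_nhdsin using hom by (intro disjI2 exI[of _ "topspace (Hom_topology G)"]) simp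

lemma near_lift_tendsto:
  assumes g: "g \<in> carrier G"
  shows "((\<lambda>\<rho>'. near_lift \<rho>' g) \<longlongrightarrow> lift g) near"
proof (rule tendstoI)
  fix e :: real assume "e > 0"
  obtain U where U: "openin PSL2_topology U" "pm (lift g) \<in> U"
    "\<And>M. M \<in> U \<Longrightarrow> \<exists>A. det A = 1 \<and> M = pm A \<and> norm (A - lift g) < e"
    by (rule PSL2_topology_nbhd[OF _ \<open>e > 0\<close>, of "lift g"]) (use lift[OF g] in auto)
  have "continuous_map (Hom_topology G) PSL2_topology (\<lambda>\<rho>'. \<rho>' g)"
    unfolding Hom_topology_def
    by (intro continuous_map_from_subtopology continuous_map_product_projection g)
  then have op: "openin (Hom_topology G) {\<rho>' \<in> topspace (Hom_topology G). \<rho>' g \<in> U}"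
    using U(1) by (rule openin_continuous_map_preimage)
  have "dist (near_lift \<rho>' g) (lift g) < e" if \<rho>': "\<rho>' \<in> topspace (Hom_topology G)" "\<rho>' g \<in> U" for \<rho>'
  proof -
    obtain A where A: "det A = 1" "\<rho>' g = pm A" "norm (A - lift g) < e" using U(3)[OF \<rho>'(2)] by blast
    note n = near_lift[OF \<rho>'(1) g]
    have "near_lift \<rho>' g = A \<or> near_lift \<rho>' g = - A" using A(2) n(2) by (simp add: pm_eq_iff)
    then show ?thesis using A(3) n(3) by (auto simp: dist_norm)
  qed
  then show "\<forall>\<^sub>F \<rho>' in near. dist (near_lift \<rho>' g) (lift g) < e"
    unfolding eventually_nhdsin using op hom U(2) lift[OF g]
    by (intro disjI2 exI[of _ "{\<rho>' \<in> topspace (Hom_topology G). \<rho>' g \<in> U}"]) auto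
qed

text \<open>The sign defect of the lifts is locally constant in the representation.\<close>

lemma near_lift_mult:
  assumes g: "g \<in> carrier G" "h \<in> carrier G"
  shows "\<forall>\<^sub>F \<rho>' in near. \<exists>s::real. s \<noteq> 0 \<and> lift g ** lift h = s *\<^sub>R lift (class_join S g h) \<and>
    near_lift \<rho>' g ** near_lift \<rho>' h = s *\<^sub>R near_lift \<rho>' (class_join S g h)"
proof -
  have P0: "path_class S (\<lambda>_. x) \<in> ucover S x" using x by (intro ucoverI) auto
  define gh where "gh = class_join S g h"
  have gh: "gh \<in> carrier G" unfolding gh_def by (rule deck_mult(2)[OF g P0])
  have mult: "\<rho>' gh = \<rho>' g \<otimes>\<^bsub>PSL2\<^esub> \<rho>' h" if "\<rho>' \<in> topspace (Hom_topology G)" for \<rho>'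
    using that g unfolding gh_def by (auto simp: topspace_Hom_topology hom_def)
  have "pm (lift gh) = pm (lift g ** lift h)"
    using mult[OF hom] lift[OF g(1)] lift[OF g(2)] lift[OF gh] by simp
  then have "lift g ** lift h = lift gh \<or> lift g ** lift h = - lift gh" by (auto simp: pm_eq_iff)
  then obtain s :: real where s: "s = 1 \<or> s = -1" "lift g ** lift h = s *\<^sub>R lift gh" by force
  have "((\<lambda>\<rho>'. near_lift \<rho>' g ** near_lift \<rho>' h + s *\<^sub>R near_lift \<rho>' gh) \<longlongrightarrow> lift g ** lift h + s *\<^sub>R lift gh) near"
    by (intro tendsto_add tendsto_matrix_mult tendsto_scaleR tendsto_const near_lift_tendsto g gh)
  moreover have "lift g ** lift h + s *\<^sub>R lift gh \<noteq> 0"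
  proof -
    have "lift gh \<noteq> 0" using lift[OF gh] by (auto simp: det_2)
    then show ?thesis using s by (auto simp flip: scaleR_left_distrib)
  qed
  ultimately have "\<forall>\<^sub>F \<rho>' in near. near_lift \<rho>' g ** near_lift \<rho>' h + s *\<^sub>R near_lift \<rho>' gh \<noteq> 0"
    by (rule tendsto_imp_eventually_ne)
  then show ?thesis
    using eventually_Hom
  proof eventually_elim
    case (elim \<rho>')
    have "pm (near_lift \<rho>' gh) = pm (near_lift \<rho>' g ** near_lift \<rho>' h)"
      using mult[OF elim(2)] near_lift(2)[OF elim(2)] g gh by simp
    then have "near_lift \<rho>' g ** near_lift \<rho>' h = near_lift \<rho>' gh \<or>
        near_lift \<rho>' g ** near_lift \<rho>' h = - near_lift \<rho>' gh" by (auto simp: pm_eq_iff)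
    then have "near_lift \<rho>' g ** near_lift \<rho>' h = s *\<^sub>R near_lift \<rho>' gh" using elim(1) s(1) by auto
    then show ?case using s by (intro exI[of _ s]) (auto simp: gh_def)
  qed
qed

end

locale perturbation = developed S \<O> A x f \<rho>
  for S :: "'a::topological_space set" and \<O> A x f \<rho> +
  fixes I :: "'a set" and pp W \<phi> a \<delta> K
  assumes fin: "finite I" and data: "\<And>i. i \<in> I \<Longrightarrow> chart_data i (pp i) (W i) (\<phi> i) (a i) (\<delta> i) (K i)"
    and cover: "\<And>y. y \<in> S \<Longrightarrow> \<exists>i\<in>I. y \<in> W i \<and> norm (affcoord (a i) (\<phi> i y) - affcoord (a i) (\<phi> i i)) < \<delta> i"
begin

lemma dataD:
  assumes "i \<in> I"
  shows "pth S (pp i)" "pathstart (pp i) = x" "pathfinish (pp i) = i" "disc (W i)" "i \<in> W i" "flat (W i) (\<phi> i)"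
    "\<And>Q. Q \<in> sheet S (pp i) (W i) \<Longrightarrow> f Q = \<phi> i (cover_proj Q)" "\<And>y. y \<in> W i \<Longrightarrow> \<phi> i y \<in> affdom (a i)"
    "\<delta> i > 0" "compact (K i)" "K i \<subseteq> W i"
    "\<And>y. y \<in> W i \<Longrightarrow> norm (affcoord (a i) (\<phi> i y) - affcoord (a i) (\<phi> i i)) < \<delta> i \<Longrightarrow> y \<in> K i"
    "continuous_map (subtopology (top_of_set S) (W i)) CP1 (\<phi> i)" "W i \<subseteq> S"
  using data[OF assms] disc_opn opn_subset by (auto simp: chart_data_def)

definition val :: "'a \<Rightarrow> 'a \<Rightarrow> complex" where
  "val i y = affcoord (a i) (\<phi> i y)"

text \<open>A Lipschitz function of the value of \<open>\<phi> i\<close>, so that it is also a function of the value of any other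
  chart.\<close>

definition bump :: "'a \<Rightarrow> 'a \<Rightarrow> real" where
  "bump i y = (if y \<in> W i then max 0 (\<delta> i - norm (val i y - val i i)) else 0)"

lemma bump_nonneg: "bump i y \<ge> 0"
  by (simp add: bump_def)

lemma bump_pos: "bump i y > 0 \<longleftrightarrow> y \<in> W i \<and> norm (val i y - val i i) < \<delta> i"
  by (auto simp: bump_def)

lemma bump_support: "i \<in> I \<Longrightarrow> bump i y > 0 \<Longrightarrow> y \<in> K i"
  using dataD(12) by (auto simp: bump_pos val_def)

definition idx :: "'a \<Rightarrow> 'a" where
  "idx y = (SOME i. i \<in> I \<and> bump i y > 0)"

lemma idx: "y \<in> S \<Longrightarrow> idx y \<in> I" "y \<in> S \<Longrightarrow> bump (idx y) y > 0"
proof -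
  assume "y \<in> S"
  then have "\<exists>i. i \<in> I \<and> bump i y > 0" using cover unfolding bump_pos val_def by blast
  from someI_ex[OF this] show "idx y \<in> I" "bump (idx y) y > 0" by (simp_all add: idx_def)
qed

text \<open>The section of the universal cover over the disc \<open>W i\<close> through the class of \<open>pp i\<close>.\<close>

definition sec :: "'a \<Rightarrow> 'a \<Rightarrow> (real \<Rightarrow> 'a) set" where
  "sec i y = path_class S (pp i +++ (SOME c. pth (W i) c \<and> pathstart c = i \<and> pathfinish c = y))"

lemma secE:
  assumes "i \<in> I" "y \<in> W i"
  obtains c where "pth (W i) c" "pathstart c = i" "pathfinish c = y" "sec i y = path_class S (pp i +++ c)"
proof -
  have "\<exists>c. pth (W i) c \<and> pathstart c = i \<and> pathfinish c = y"
    using disc_path[OF dataD(4,5)[OF assms(1)] assms(2)] by metis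
  from someI_ex[OF this] show ?thesis by (intro that) (auto simp: sec_def)
qed

lemma sec:
  assumes "i \<in> I" "y \<in> W i"
  shows "sec i y \<in> ucover S x" "cover_proj (sec i y) = y" "f (sec i y) = \<phi> i y"
proof -
  note d = dataD[OF assms(1)]
  obtain c where c: "pth (W i) c" "pathstart c = i" "pathfinish c = y" "sec i y = path_class S (pp i +++ c)"
    by (rule secE[OF assms]) blast
  have pc: "pth S (pp i +++ c)" using d(1,3) pth_mono[OF c(1) d(14)] c(2) by simp
  show "sec i y \<in> ucover S x" unfolding c(4) using pc d(2) by (intro ucoverI) simp_all
  show proj: "cover_proj (sec i y) = y" unfolding c(4) using pc c(3) by simp
  have "sec i y \<in> sheet S (pp i) (W i)"
    unfolding sheet_def c(4) by (rule imageI) (use c d(3) in simp)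
  then show "f (sec i y) = \<phi> i y" using d(7) proj by simp
qed

lemma sec_continue:
  assumes i: "i \<in> I" and c: "pth (W i) c" and p: "pth S p" "pathfinish p = pathstart c"
    and eq: "sec i (pathstart c) = path_class S p"
  shows "sec i (pathfinish c) = path_class S (p +++ c)"
proof -
  note d = dataD[OF i]
  obtain c1 where c1: "pth (W i) c1" "pathstart c1 = i" "pathfinish c1 = pathstart c"
    "sec i (pathstart c) = path_class S (pp i +++ c1)"
    by (rule secE[OF i pth_ends(1)[OF c]]) blast
  obtain c2 where c2: "pth (W i) c2" "pathstart c2 = i" "pathfinish c2 = pathfinish c"
    "sec i (pathfinish c) = path_class S (pp i +++ c2)"
    by (rule secE[OF i pth_ends(2)[OF c]]) blast
  note mono = pth_mono[OF _ d(14)]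
  have "path_class S (p +++ c) = path_class S ((pp i +++ c1) +++ c)"
    using eq c1(4) p mono[OF c] by (intro path_class_join_cong) auto
  also have "\<dots> = path_class S (pp i +++ (c1 +++ c))"
    using d(1,3) c1(2,3) mono[OF c1(1)] mono[OF c] by (intro path_class_assoc) auto
  also have "\<dots> = path_class S (pp i +++ c2)"
  proof (rule path_class_join_cong[OF refl])
    show "path_class S (c1 +++ c) = path_class S c2"
      by (rule path_class_eqI[OF disc_homotopic[OF d(4)]]) (use c1 c2 c in auto)
  qed (use d(1,3) c1(2,3) mono[OF c1(1)] mono[OF c] in auto)
  finally show ?thesis using c2(4) by simp
qed

text \<open>The element \<open>g\<^sub>i\<^sub>j\<close> that takes the section over \<open>W j\<close> to the section over \<open>W i\<close>.\<close>

definition trans_elt :: "'a \<Rightarrow> 'a \<Rightarrow> 'a \<Rightarrow> (real \<Rightarrow> 'a) set" where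
  "trans_elt i j y = deck_diff S x (sec i y) (sec j y)"

lemma trans_elt:
  assumes "i \<in> I" "j \<in> I" "y \<in> W i" "y \<in> W j"
  shows "trans_elt i j y \<in> carrier G" "class_join S (trans_elt i j y) (sec j y) = sec i y"
  using deck_diff[of "sec i y" S x "sec j y"] sec[OF assms(1,3)] sec[OF assms(2,4)]
  by (simp_all add: trans_elt_def)

lemma trans_elt_eqI:
  assumes "j \<in> I" "y \<in> W j" "g \<in> carrier G" "sec i y = class_join S g (sec j y)"
  shows "trans_elt i j y = g"
  unfolding trans_elt_def by (rule deck_diff_eqI[OF assms(3) sec(1)[OF assms(1,2)] assms(4)])

lemma trans_elt_cocycle:
  assumes "i \<in> I" "k \<in> I" "j \<in> I" "y \<in> W i" "y \<in> W k" "y \<in> W j"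
  shows "trans_elt i j y = class_join S (trans_elt i k y) (trans_elt k j y)"
proof (rule trans_elt_eqI[OF assms(3,6)])
  note 1 = trans_elt[OF assms(1,2,4,5)] and 2 = trans_elt[OF assms(2,3,5,6)] and s = sec(1)[OF assms(3,6)]
  show "class_join S (trans_elt i k y) (trans_elt k j y) \<in> carrier G" by (rule deck_mult(2)[OF 1(1) 2(1) s])
  show "sec i y = class_join S (class_join S (trans_elt i k y) (trans_elt k j y)) (sec j y)"
    using deck_mult(1)[OF 1(1) 2(1) s] 1(2) 2(2) by simp
qed

text \<open>Continuation along a path in \<open>W i\<close> moves a translate of the section over \<open>W i\<close> along itself, so
  that every sheet over a subset of \<open>W i\<close> lies in one translate of the section.\<close>

lemma sheet_translate:
  assumes i: "i \<in> I" and p: "pth S p" "pathstart p = x" "pathfinish p \<in> W i"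
    and g: "g \<in> carrier G" "class_join S g (sec i (pathfinish p)) = path_class S p"
    and c: "pth (W i) c" "pathstart c = pathfinish p"
  shows "path_class S (p +++ c) = class_join S g (sec i (pathfinish c))"
proof -
  obtain l where l: "l \<in> loops S x" "g = path_class S l"
    using g(1) by (auto simp: carrier_fundamental_group_loops)
  obtain q where q: "pth S q" "pathstart q = x" "sec i (pathfinish p) = path_class S q"
    by (rule ucoverE[OF sec(1)[OF i p(3)]])
  have qy: "pathfinish q = pathfinish p" using sec(2)[OF i p(3)] q by simp
  note lD = loopsD[OF l(1)]
  have cS: "pth S c" by (rule pth_mono[OF c(1) dataD(14)[OF i]])
  have "path_class S p = path_class S (l +++ q)"
    using g(2) deck_path_class[OF l(1) q(1,2)] q(3) l(2) by simp
  then have "path_class S (p +++ c) = path_class S ((l +++ q) +++ c)"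
    using p c lD q qy cS by (intro path_class_join_cong) auto
  also have "\<dots> = path_class S (l +++ (q +++ c))"
    using lD q qy c cS by (intro path_class_assoc) auto
  also have "\<dots> = class_join S g (path_class S (q +++ c))"
    unfolding l(2) using q qy c cS by (intro deck_path_class[OF l(1), symmetric]) auto
  also have "path_class S (q +++ c) = sec i (pathfinish c)"
    using sec_continue[OF i c(1) q(1)] c q qy by simp
  finally show ?thesis .
qed

lemma trans_elt_const:
  assumes ij: "i \<in> I" "j \<in> I" and D: "disc D" "D \<subseteq> W i" "D \<subseteq> W j" "y \<in> D" "z \<in> D"
  shows "trans_elt i j z = trans_elt i j y"
proof (rule trans_elt_eqI[OF ij(2)])
  have y: "y \<in> W i" "y \<in> W j" using D by auto
  show "z \<in> W j" using D by auto
  note t = trans_elt[OF ij y]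
  show "trans_elt i j y \<in> carrier G" by (rule t(1))
  obtain p where p: "pth S p" "pathstart p = x" "sec i y = path_class S p" by (rule ucoverE[OF sec(1)[OF ij(1) y(1)]])
  have py: "pathfinish p = y" using sec(2)[OF ij(1) y(1)] p by simp
  obtain c where c: "pth D c" "pathstart c = y" "pathfinish c = z" by (rule disc_path[OF D(1,4,5)]) blast
  have "sec i z = path_class S (p +++ c)"
    using sec_continue[OF ij(1) pth_mono[OF c(1) D(2)] p(1)] c p py by simp
  also have "\<dots> = class_join S (trans_elt i j y) (sec j z)"
    using sheet_translate[OF ij(2) p(1,2) _ t(1) _ pth_mono[OF c(1) D(3)]] t(2) y c p py by simp
  finally show "sec i z = class_join S (trans_elt i j y) (sec j z)" .
qed

lemma chart_relation:
  assumes "i \<in> I" "j \<in> I" "y \<in> W i" "y \<in> W j"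
  shows "\<phi> i y = PSL2_act (\<rho> (trans_elt i j y)) (\<phi> j y)"
    and "\<phi> j y = PSL2_act (inv\<^bsub>PSL2\<^esub> (\<rho> (trans_elt i j y))) (\<phi> i y)"
proof -
  note t = trans_elt[OF assms]
  show 1: "\<phi> i y = PSL2_act (\<rho> (trans_elt i j y)) (\<phi> j y)"
    using equivD[OF t(1) sec(1)[OF assms(2,4)]] t(2) sec[OF assms(1,3)] sec[OF assms(2,4)] by simp
  have "\<phi> j y \<in> topspace CP1" using dataD(8)[OF assms(2,4)] affdom_subset by blast
  then show "\<phi> j y = PSL2_act (inv\<^bsub>PSL2\<^esub> (\<rho> (trans_elt i j y))) (\<phi> i y)"
    unfolding 1 using Hom_values[OF hom t(1)] by simp
qed

text \<open>The lift of \<open>\<rho>'(g) \<rho>(g)\<^sup>-\<^sup>1\<close> that is close to the identity matrix, and not to its negative.\<close>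

definition corr :: "((real \<Rightarrow> 'a) set \<Rightarrow> (complex^2^2) set) \<Rightarrow> (real \<Rightarrow> 'a) set \<Rightarrow> complex^2^2" where
  "corr \<rho>' g = near_lift \<rho>' g ** matrix_inv (lift g)"

text \<open>The weights are not normalised to sum 1, since a scalar factor does not move a line.\<close>

definition avg :: "((real \<Rightarrow> 'a) set \<Rightarrow> (complex^2^2) set) \<Rightarrow> 'a \<Rightarrow> 'a \<Rightarrow> complex^2^2" where
  "avg \<rho>' i y = mat_comb I (\<lambda>j. complex_of_real (bump j y)) (\<lambda>j. corr \<rho>' (trans_elt i j y))"

text \<open>Along the section over the disc of index \<open>i = idx y\<close> the map \<open>\<phi> i\<close> is corrected by the averaged matrix;
  the deck transformations extend this to the whole fibre over \<open>y\<close>.\<close>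

definition pert :: "((real \<Rightarrow> 'a) set \<Rightarrow> (complex^2^2) set) \<Rightarrow> (real \<Rightarrow> 'a) set \<Rightarrow> (complex^2) set" where
  "pert \<rho>' P = (let y = cover_proj P; i = idx y in
     PSL2_act (\<rho>' (deck_diff S x P (sec i y))) (mact (avg \<rho>' i y) (\<phi> i y)))"

lemma cover_proj_in: "P \<in> ucover S x \<Longrightarrow> cover_proj P \<in> S"
  by (auto elim!: ucoverE dest: pth_ends(2))

lemma pert_equivariant:
  assumes \<rho>': "\<rho>' \<in> topspace (Hom_topology G)" and g: "g \<in> carrier G" and P: "P \<in> ucover S x"
  shows "pert \<rho>' (class_join S g P) = PSL2_act (\<rho>' g) (pert \<rho>' P)"
proof -
  define y where "y = cover_proj P"
  define i where "i = idx y"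
  have yS: "y \<in> S" unfolding y_def by (rule cover_proj_in[OF P])
  have i: "i \<in> I" "y \<in> W i" using idx[OF yS] by (auto simp: i_def bump_pos)
  note s = sec[OF i] and d = deck_in_ucover[OF g P]
  note dd = deck_diff[OF P s(1)]
  have py: "cover_proj P = cover_proj (sec i y)" using s(2) by (simp add: y_def)
  have mult: "\<rho>' (class_join S g (deck_diff S x P (sec i y))) = \<rho>' g \<otimes>\<^bsub>PSL2\<^esub> \<rho>' (deck_diff S x P (sec i y))"
    using \<rho>' g dd(1)[OF py] by (auto simp: topspace_Hom_topology hom_def)
  have "\<phi> i y \<in> topspace CP1" using dataD(8)[OF i] affdom_subset by blast
  then obtain v where v: "\<phi> i y = vec.span {v}" by (rule CP1_E)
  have "pert \<rho>' (class_join S g P) =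
      PSL2_act (\<rho>' (class_join S g (deck_diff S x P (sec i y)))) (mact (avg \<rho>' i y) (\<phi> i y))"
    using d(2) deck_diff_deck[OF P s(1) py g] by (simp add: pert_def Let_def flip: y_def i_def)
  also have "\<dots> = PSL2_act (\<rho>' g) (PSL2_act (\<rho>' (deck_diff S x P (sec i y))) (mact (avg \<rho>' i y) (\<phi> i y)))"
    unfolding mult v mact_span
    by (rule PSL2_act_mult_span[OF Hom_values[OF \<rho>' g] Hom_values[OF \<rho>' dd(1)[OF py]]])
  also have "\<dots> = PSL2_act (\<rho>' g) (pert \<rho>' P)" by (simp add: pert_def Let_def flip: y_def i_def)
  finally show ?thesis .
qed

text \<open>A map of this form has the same local power form as \<open>\<phi> i\<close>.\<close>

definition good :: "((real \<Rightarrow> 'a) set \<Rightarrow> (complex^2^2) set) \<Rightarrow> 'a \<Rightarrow> bool" where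
  "good \<rho>' y \<longleftrightarrow> (\<exists>i\<in>I. \<exists>D M M' k k'. opn D \<and> y \<in> D \<and> D \<subseteq> W i \<and> or_iso M M' k k' \<and>
     (\<forall>z\<in>D. \<phi> i z \<in> M \<and> pert \<rho>' (sec i z) = k (\<phi> i z)))"

lemma corr_tendsto: "g \<in> carrier G \<Longrightarrow> ((\<lambda>\<rho>'. corr \<rho>' g) \<longlongrightarrow> mat 1) near"
  unfolding corr_def
  using tendsto_matrix_mult[OF near_lift_tendsto tendsto_const, of g "matrix_inv (lift g)"] lift[of g]
  by (simp add: det_matrix_inv_1)

lemma matrix_inv_unique_right:
  fixes Z Q :: "complex^2^2"
  assumes "det Z = 1" "Z ** Q = mat 1"
  shows "matrix_inv Z = Q"
proof -
  have "matrix_inv Z = matrix_inv Z ** (Z ** Q)" by (simp add: assms(2))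
  also have "\<dots> = (matrix_inv Z ** Z) ** Q" by (rule matrix_mul_assoc)
  also have "\<dots> = Q" by (simp add: det_matrix_inv_1(1)[OF assms(1)])
  finally show ?thesis .
qed

lemma matrix_scaleR: "(s *\<^sub>R X) ** Y = s *\<^sub>R (X ** Y)" "X ** (s *\<^sub>R Y) = s *\<^sub>R (X ** Y)"
  for X Y :: "complex^2^2"
  by (simp_all add: matrix_scalar_ac scalar_matrix_assoc)

text \<open>The corrections of the charts satisfy the cocycle relation that makes the averaged maps
  over different discs compatible; the signs of the lifts cancel.\<close>

lemma corr_cocycle:
  assumes g: "g \<in> carrier G" "h \<in> carrier G" and gh: "class_join S g h \<in> carrier G"
    and s: "s \<noteq> 0" "lift g ** lift h = s *\<^sub>R lift (class_join S g h)"
      "near_lift \<rho>' g ** near_lift \<rho>' h = s *\<^sub>R near_lift \<rho>' (class_join S g h)"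
  shows "near_lift \<rho>' g ** corr \<rho>' h ** matrix_inv (lift g) = corr \<rho>' (class_join S g h)"
proof -
  let ?A = "lift (class_join S g h)" and ?A' = "near_lift \<rho>' (class_join S g h)"
  let ?X = "lift g" and ?Y = "lift h"
  have d: "det ?A = 1" "det ?X = 1" "det ?Y = 1" using lift[OF gh] lift[OF g(1)] lift[OF g(2)] by simp_all
  have dXY: "det (?X ** ?Y) = 1" using d by (simp add: det_mul)
  have "(?X ** ?Y) ** (matrix_inv ?Y ** matrix_inv ?X) = ?X ** (?Y ** matrix_inv ?Y) ** matrix_inv ?X"
    by (simp only: matrix_mul_assoc)
  also have "\<dots> = mat 1" by (simp add: det_matrix_inv_1(2) d)
  finally have 1: "matrix_inv (?X ** ?Y) = matrix_inv ?Y ** matrix_inv ?X"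
    by (rule matrix_inv_unique_right[OF dXY])
  have "(?X ** ?Y) ** ((1 / s) *\<^sub>R matrix_inv ?A) = mat 1"
    unfolding s(2) using s(1) by (simp add: matrix_scaleR det_matrix_inv_1(2) d)
  then have 2: "matrix_inv (?X ** ?Y) = (1 / s) *\<^sub>R matrix_inv ?A"
    by (rule matrix_inv_unique_right[OF dXY])
  have "near_lift \<rho>' g ** corr \<rho>' h ** matrix_inv ?X =
      (near_lift \<rho>' g ** near_lift \<rho>' h) ** (matrix_inv ?Y ** matrix_inv ?X)"
    unfolding corr_def by (simp only: matrix_mul_assoc)
  also have "\<dots> = (s *\<^sub>R ?A') ** ((1 / s) *\<^sub>R matrix_inv ?A)"
    unfolding s(3) 1[symmetric] 2 ..
  also have "\<dots> = corr \<rho>' (class_join S g h)"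
    using s(1) by (simp add: corr_def matrix_scaleR)
  finally show ?thesis .
qed

lemma opn_val_ball: "i \<in> I \<Longrightarrow> opn {y \<in> W i. val i y \<in> ball c r}"
  unfolding val_def by (rule opn_affcoord_ball[OF disc_opn[OF dataD(4)] dataD(13,8)])

lemma bump_pos_ball: "bump i y > 0 \<longleftrightarrow> y \<in> {y \<in> W i. val i y \<in> ball (val i i) (\<delta> i)}"
  by (auto simp: bump_pos dist_norm norm_minus_commute)

text \<open>Near \<open>y0\<close>, every bump function and hence the averaged matrix is a locally Lipschitz function of
  the value of one chart, so that the perturbed map is that chart followed by a near-identity map.
  The neighbourhood of \<open>y0\<close> does not depend on the representation.\<close>

lemma good_near_point:
  assumes y0: "y0 \<in> S"
  obtains N where "opn N" "y0 \<in> N" "\<forall>\<^sub>F \<rho>' in near. \<forall>y\<in>N. good \<rho>' y"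
proof -
  define i where "i = idx y0"
  have i: "i \<in> I" "bump i y0 > 0" "y0 \<in> W i" using idx[OF y0] by (auto simp: i_def bump_pos)
  note d = dataD[OF i(1)]
  define J where "J = {j \<in> I. y0 \<in> W j}"
  have J: "finite J" "J \<subseteq> I" "i \<in> J" using fin i by (auto simp: J_def)
  have Haus: "Hausdorff_space (top_of_set S)" using surface by (simp add: closed_oriented_surface_def)
  have opK: "opn (S - K j)" if "j \<in> I" for j
  proof -
    have "compactin (top_of_set S) (K j)" using dataD(10,11,14)[OF that] by (auto simp: compactin_subtopology)
    then have "closedin (top_of_set S) (K j)" by (rule compactin_imp_closedin[OF Haus])
    then show ?thesis by (simp add: closedin_def)
  qed
  \<comment> \<open>on \<open>D1\<close> only the bump functions with index in \<open>J\<close> contribute\<close>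
  define D1 where "D1 = S \<inter> (\<Inter>j\<in>J. W j) \<inter> (\<Inter>j\<in>I - J. S - K j) \<inter> {y \<in> W i. val i y \<in> ball (val i i) (\<delta> i)}"
  have "opn (S \<inter> (\<Inter>j\<in>J. W j))" if "finite J" "J \<subseteq> I" for J
    using that
  proof (induction J rule: finite_induct)
    case (insert j J)
    have "S \<inter> (\<Inter>j\<in>insert j J. W j) = W j \<inter> (S \<inter> (\<Inter>j\<in>J. W j))" by auto
    then show ?case using insert disc_opn[OF dataD(4)] by (simp add: openin_Int del: INT_insert)
  qed simp
  note opJ = this[OF J(1,2)]
  have "opn (S \<inter> (\<Inter>j\<in>J'. S - K j))" if "finite J'" "J' \<subseteq> I" for J'
    using that
  proof (induction J' rule: finite_induct)
    case (insert j J')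
    have "S \<inter> (\<Inter>j\<in>insert j J'. S - K j) = (S - K j) \<inter> (S \<inter> (\<Inter>j\<in>J'. S - K j))" by auto
    then show ?case using insert opK by (simp add: openin_Int del: INT_insert)
  qed simp
  from this[of "I - J"] have opIJ: "opn (S \<inter> (\<Inter>j\<in>I - J. S - K j))" using fin by blast
  have "D1 = (S \<inter> (\<Inter>j\<in>J. W j)) \<inter> (S \<inter> (\<Inter>j\<in>I - J. S - K j)) \<inter> {y \<in> W i. val i y \<in> ball (val i i) (\<delta> i)}"
    by (auto simp: D1_def)
  then have "opn D1" using openin_Int[OF openin_Int[OF opJ opIJ] opn_val_ball[OF i(1)]] by simp
  moreover have "y0 \<in> D1"
  proof -
    have "y0 \<notin> K j" if "j \<in> I - J" for j using that dataD(11) by (auto simp: J_def)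
    then show ?thesis using y0 i(2) by (auto simp: D1_def J_def bump_pos_ball)
  qed
  ultimately obtain D0 where D0: "disc D0" "y0 \<in> D0" "D0 \<subseteq> D1" by (rule disc_nbhd)
  have DW: "D0 \<subseteq> W j" if "j \<in> J" for j using D0(3) that by (auto simp: D1_def)
  have bump0: "bump j y = 0" if "j \<in> I - J" "y \<in> D0" for j y
  proof -
    have "y \<in> D1" using D0(3) that(2) by blast
    then have "y \<notin> K j" using that(1) unfolding D1_def by blast
    then have "\<not> bump j y > 0" using bump_support that(1) by blast
    then show ?thesis using bump_nonneg[of j y] by simp
  qed
  define t where "t k j = trans_elt k j y0" for k j
  have t: "trans_elt k j y = t k j" "t k j \<in> carrier G" if "k \<in> J" "j \<in> J" "y \<in> D0" for k j y
    using trans_elt_const[of k j D0 y0 y] trans_elt(1)[of k j y0] that D0 DW J(2)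
    by (auto simp: t_def J_def)
  \<comment> \<open>the bump function of \<open>W j\<close> in terms of the value \<open>z\<close> of \<open>\<phi> i\<close>\<close>
  define \<beta> where "\<beta> j z = complex_of_real (max 0 (\<delta> j - norm (affcoord (a j)
      (PSL2_act (inv\<^bsub>PSL2\<^esub> (\<rho> (t i j))) (affline (a i) z)) - val j j)))" for j z
  have aff: "affline (a i) (val i y) = \<phi> i y" if "y \<in> W i" for y
    using d(8)[OF that] by (simp add: val_def)
  have chart_j: "\<phi> j y = PSL2_act (inv\<^bsub>PSL2\<^esub> (\<rho> (t i j))) (\<phi> i y)" if "j \<in> J" "y \<in> D0" for j y
    using chart_relation(2)[of i j y] t(1)[OF J(3) that] that i(1) J(2) DW[OF J(3)] DW[OF that(1)] by auto
  have \<beta>: "complex_of_real (bump j y) = \<beta> j (val i y)" if "j \<in> J" "y \<in> D0" for j y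
    using chart_j[OF that] aff[of y] that DW[OF J(3)] DW[OF that(1)]
    by (auto simp: \<beta>_def bump_def val_def)
  define z0 where "z0 = val i y0"
  have tM: "inv\<^bsub>PSL2\<^esub> (\<rho> (t i j)) \<in> carrier PSL2" if "j \<in> J" for j
    using Hom_values[OF hom t(2)[OF J(3) that D0(2)]] by simp
  have lip\<beta>: "loc_lip z0 (\<beta> j)" if j: "j \<in> J" for j
    unfolding \<beta>_def
  proof (rule loc_lip_bump[OF loc_lip_PSL2_act(1)[OF tM[OF j]]])
    have "\<phi> j y0 \<in> affdom (a j)" using dataD(8)[of j y0] j by (auto simp: J_def)
    then show "PSL2_act (inv\<^bsub>PSL2\<^esub> (\<rho> (t i j))) (affline (a i) z0) \<in> affdom (a j)"
      using chart_j[OF j D0(2)] aff[OF i(3)] by (simp add: z0_def)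
    show "\<delta> j > 0" using dataD(9)[of j] j J(2) by blast
  qed
  define tot where "tot z = (\<Sum>j\<in>J. \<beta> j z)" for z
  have lipt: "loc_lip z0 tot" unfolding tot_def by (rule loc_lip_sum[OF J(1) lip\<beta>])
  have "tot z0 = complex_of_real (\<Sum>j\<in>J. bump j y0)"
    using \<beta>[OF _ D0(2)] by (simp add: tot_def z0_def)
  moreover have "(\<Sum>j\<in>J. bump j y0) > 0"
    using i(2) J(3) by (intro sum_pos2[OF J(1) J(3)]) (auto simp: bump_nonneg)
  ultimately have tot0: "tot z0 \<noteq> 0" by (simp del: of_real_sum)
  have "\<forall>\<^sub>F z in nhds z0. tot z \<noteq> 0"
    using tendsto_imp_eventually_ne[OF loc_lip_cont[OF lipt, unfolded continuous_at] tot0]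
    by (simp add: eventually_nhds_conv_at tot0)
  then obtain R0 where R0: "R0 > 0" "\<And>z. z \<in> ball z0 R0 \<Longrightarrow> tot z \<noteq> 0"
    unfolding eventually_nhds_metric by (auto simp: dist_commute)
  \<comment> \<open>normalised weights, which make the combination close to the identity\<close>
  define u where "u j z = \<beta> j z * inverse (tot z)" for j z
  have lipu: "loc_lip z0 (u j)" if "j \<in> J" for j
    unfolding u_def by (intro loc_lip_mult loc_lip_inverse lip\<beta> lipt that tot0)
  have one: "(\<Sum>j\<in>J. u j z) = 1" if "z \<in> ball z0 R0" for z
    using R0(2)[OF that] by (simp add: u_def tot_def flip: sum_distrib_right)
  obtain r \<epsilon> where r: "r > 0" "r \<le> R0" "\<epsilon> > 0"
    "\<forall>C :: 'a \<Rightarrow> complex^2^2. (\<forall>j\<in>J. norm (C j - mat 1) < \<epsilon>) \<longrightarrow> (\<exists>N' k'.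
       or_iso (affline (a i) ` ball z0 r) N' (\<lambda>L. mact (mat_comb J (\<lambda>j. u j (affcoord (a i) L)) C) L) k')"
    by (rule mat_comb_near_identity[OF J(1) lipu R0(1) one, of "a i"], assumption, assumption, rule that)
  define D where "D = D0 \<inter> {y \<in> W i. val i y \<in> ball z0 r}"
  have D: "opn D" "y0 \<in> D" "D \<subseteq> W i" "D \<subseteq> D0"
    using openin_Int[OF disc_opn[OF D0(1)] opn_val_ball[OF i(1)]] D0(2) i(3) r(1)
    by (auto simp: D_def z0_def)
  \<comment> \<open>only finitely many elements \<open>t k j\<close> occur, so that finitely many conditions on \<open>\<rho>'\<close> suffice\<close>
  have ev1: "\<forall>\<^sub>F \<rho>' in near. \<forall>j\<in>J. norm (corr \<rho>' (t i j) - mat 1) < \<epsilon>"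
  proof (rule eventually_ball_finite[OF J(1)], rule ballI)
    fix j assume "j \<in> J"
    from tendstoD[OF corr_tendsto[OF t(2)[OF J(3) this D0(2)]] r(3)]
    show "\<forall>\<^sub>F \<rho>' in near. norm (corr \<rho>' (t i j) - mat 1) < \<epsilon>" by (simp add: dist_norm)
  qed
  have ev2: "\<forall>\<^sub>F \<rho>' in near. \<forall>k\<in>J. \<forall>j\<in>J. near_lift \<rho>' (t i k) ** corr \<rho>' (t k j) ** matrix_inv (lift (t i k)) = corr \<rho>' (t i j)"
  proof (rule eventually_ball_finite[OF J(1)], rule ballI, rule eventually_ball_finite[OF J(1)], rule ballI)
    fix k j assume kj: "k \<in> J" "j \<in> J"
    have coc: "class_join S (t i k) (t k j) = t i j"
      using trans_elt_cocycle[of i k j y0] kj i J by (simp add: t_def J_def)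
    note c = t(2)[OF J(3) kj(1) D0(2)] t(2)[OF kj D0(2)] t(2)[OF J(3) kj(2) D0(2)]
    show "\<forall>\<^sub>F \<rho>' in near. near_lift \<rho>' (t i k) ** corr \<rho>' (t k j) ** matrix_inv (lift (t i k)) = corr \<rho>' (t i j)"
      using near_lift_mult[OF c(1,2)]
    proof eventually_elim
      case (elim \<rho>')
      then obtain s :: real where "s \<noteq> 0" "lift (t i k) ** lift (t k j) = s *\<^sub>R lift (class_join S (t i k) (t k j))"
        "near_lift \<rho>' (t i k) ** near_lift \<rho>' (t k j) = s *\<^sub>R near_lift \<rho>' (class_join S (t i k) (t k j))"
        by (elim exE conjE)
      from corr_cocycle[OF c(1,2) _ this] show ?case using c(3) by (simp add: coc)
    qed
  qed
  have "\<forall>\<^sub>F \<rho>' in near. \<forall>y\<in>D. good \<rho>' y"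
    using ev1 ev2 eventually_Hom
  proof eventually_elim
    case (elim \<rho>')
    obtain N' k' where iso: "or_iso (affline (a i) ` ball z0 r) N'
        (\<lambda>L. mact (mat_comb J (\<lambda>j. u j (affcoord (a i) L)) (\<lambda>j. corr \<rho>' (t i j))) L) k'"
      using r(4)[THEN spec, THEN mp, OF elim(1)] by (elim exE)
    have "\<phi> i y \<in> affline (a i) ` ball z0 r \<and>
        pert \<rho>' (sec i y) = mact (mat_comb J (\<lambda>j. u j (affcoord (a i) (\<phi> i y))) (\<lambda>j. corr \<rho>' (t i j))) (\<phi> i y)"
      if y: "y \<in> D" for y
    proof
      have yD: "y \<in> D0" "y \<in> W i" "val i y \<in> ball z0 r" using y by (auto simp: D_def)
      show "\<phi> i y \<in> affline (a i) ` ball z0 r"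
        using aff[OF yD(2)] yD(3) by (metis imageI)
      have yS: "y \<in> S" using yD(2) d(14) by blast
      define k where "k = idx y"
      have k: "k \<in> I" "bump k y > 0" using idx[OF yS] by (auto simp: k_def)
      have kJ: "k \<in> J" using bump0[of k y] k yD(1) by force
      have CP: "\<phi> i y \<in> topspace CP1" "\<phi> k y \<in> topspace CP1"
        using dataD(8)[OF i(1) yD(2)] dataD(8)[OF k(1), of y] DW[OF kJ] yD(1) affdom_subset by blast+
      have avg_J: "avg \<rho>' l y = mat_comb J (\<lambda>j. \<beta> j (val i y)) (\<lambda>j. corr \<rho>' (t l j))" if l: "l \<in> J" for l
      proof -
        have "avg \<rho>' l y = mat_comb J (\<lambda>j. complex_of_real (bump j y)) (\<lambda>j. corr \<rho>' (trans_elt l j y))"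
          unfolding avg_def by (rule mat_comb_mono_neutral[OF fin J(2)]) (use bump0 yD(1) in simp)
        also have "\<dots> = mat_comb J (\<lambda>j. \<beta> j (val i y)) (\<lambda>j. corr \<rho>' (t l j))"
          using \<beta>[OF _ yD(1)] t(1)[OF l _ yD(1)] by (simp add: mat_comb_def)
        finally show ?thesis .
      qed
      have tik: "t i k \<in> carrier G" by (rule t(2)[OF J(3) kJ D0(2)])
      note nl = near_lift[OF elim(3) tik] and l = lift[OF tik]
      obtain v where v: "\<phi> k y = vec.span {v}" using CP(2) by (rule CP1_E)
      have "pert \<rho>' (sec i y) = PSL2_act (\<rho>' (t i k)) (mact (avg \<rho>' k y) (\<phi> k y))"
        using sec(2)[OF i(1) yD(2)] t(1)[OF J(3) kJ yD(1)]
        by (simp add: pert_def Let_def trans_elt_def flip: k_def)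
      also have "\<dots> = mact (near_lift \<rho>' (t i k)) (mact (avg \<rho>' k y) (\<phi> k y))"
        unfolding v mact_span nl(2) by (rule PSL2_act_pm)
      also have "\<phi> k y = mact (matrix_inv (lift (t i k))) (\<phi> i y)"
        using chart_j[OF kJ yD(1)] l CP(1) by (simp add: inv_pm PSL2_act_mact)
      also have "mact (near_lift \<rho>' (t i k)) (mact (avg \<rho>' k y) (mact (matrix_inv (lift (t i k))) (\<phi> i y))) =
          mact (near_lift \<rho>' (t i k) ** avg \<rho>' k y ** matrix_inv (lift (t i k))) (\<phi> i y)"
        by (simp add: mact_mult)
      also have "near_lift \<rho>' (t i k) ** avg \<rho>' k y ** matrix_inv (lift (t i k)) =
          mat_comb J (\<lambda>j. \<beta> j (val i y)) (\<lambda>j. near_lift \<rho>' (t i k) ** corr \<rho>' (t k j) ** matrix_inv (lift (t i k)))"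
        unfolding avg_J[OF kJ] mat_comb_conj ..
      also have "\<dots> = mat_comb J (\<lambda>j. \<beta> j (val i y)) (\<lambda>j. corr \<rho>' (t i j))"
        by (rule mat_comb_cong) (use elim(2) kJ in blast)
      also have "mact \<dots> (\<phi> i y) = mact (mat_comb J (\<lambda>j. u j (val i y)) (\<lambda>j. corr \<rho>' (t i j))) (\<phi> i y)"
        unfolding u_def
        by (rule mact_mat_comb_scale[symmetric]) (use R0(2)[of "val i y"] yD(3) r(2) CP(1) in auto)
      finally show "pert \<rho>' (sec i y) =
          mact (mat_comb J (\<lambda>j. u j (affcoord (a i) (\<phi> i y))) (\<lambda>j. corr \<rho>' (t i j))) (\<phi> i y)"
        by (simp add: val_def)
    qed
    then have "\<forall>z\<in>D. \<phi> i z \<in> affline (a i) ` ball z0 r \<and> pert \<rho>' (sec i z) =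
        (\<lambda>L. mact (mat_comb J (\<lambda>j. u j (affcoord (a i) L)) (\<lambda>j. corr \<rho>' (t i j))) L) (\<phi> i z)" by simp
    then have "good \<rho>' y" if "y \<in> D" for y
      unfolding good_def
      by (intro bexI[OF _ i(1)] exI[of _ D] exI[of _ "affline (a i) ` ball z0 r"] exI[of _ N'] exI[of _ k']
          exI[of _ "\<lambda>L. mact (mat_comb J (\<lambda>j. u j (affcoord (a i) L)) (\<lambda>j. corr \<rho>' (t i j))) L"]
          conjI D(1,3) that iso)
    then show ?case by simp
  qed
  then show ?thesis by (rule that[OF D(1,2)])
qed

lemma eventually_good: "\<forall>\<^sub>F \<rho>' in near. \<forall>y\<in>S. good \<rho>' y"
proof -
  have "\<exists>N. opn N \<and> y \<in> N \<and> (\<forall>\<^sub>F \<rho>' in near. \<forall>z\<in>N. good \<rho>' z)" if "y \<in> S" for y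
    by (rule good_near_point[OF that]) (intro exI conjI)
  then have "\<forall>y\<in>S. \<exists>N. opn N \<and> y \<in> N \<and> (\<forall>\<^sub>F \<rho>' in near. \<forall>z\<in>N. good \<rho>' z)" by simp
  from bchoice[OF this] obtain N where N': "\<forall>y\<in>S. opn (N y) \<and> y \<in> N y \<and> (\<forall>\<^sub>F \<rho>' in near. \<forall>z\<in>N y. good \<rho>' z)"
    by (elim exE)
  have N: "opn (N y)" "y \<in> N y" "\<forall>\<^sub>F \<rho>' in near. \<forall>z\<in>N y. good \<rho>' z" if "y \<in> S" for y
    using N'[rule_format, OF that] by simp_all
  obtain Y where Y: "finite Y" "Y \<subseteq> S" "S \<subseteq> \<Union>(N ` Y)" by (rule finite_opn_cover[OF N(1,2)])
  have "\<forall>\<^sub>F \<rho>' in near. \<forall>y\<in>Y. \<forall>z\<in>N y. good \<rho>' z"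
    by (rule eventually_ball_finite[OF Y(1)]) (intro ballI N(3) subsetD[OF Y(2)])
  then show ?thesis
  proof eventually_elim
    case (elim \<rho>')
    show ?case
    proof
      fix y assume "y \<in> S"
      then obtain z where "z \<in> Y" "y \<in> N z" using Y(3) by auto
      then show "good \<rho>' y" using elim by simp
    qed
  qed
qed

end

section \<open>The perturbed projective structure\<close>

locale nearby = perturbation S \<O> A x f \<rho> I pp W \<phi> a \<delta> K
  for S :: "'a::topological_space set" and \<O> A x f \<rho> I pp W \<phi> a \<delta> K +
  fixes \<rho>' :: "(real \<Rightarrow> 'a) set \<Rightarrow> (complex^2^2) set"
  assumes hom': "\<rho>' \<in> topspace (Hom_topology G)" and good: "\<And>y. y \<in> S \<Longrightarrow> good \<rho>' y"
begin

definition chart' :: "'a \<Rightarrow> 'a \<Rightarrow> (complex^2) set" where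
  "chart' i y = pert \<rho>' (sec i y)"

lemma goodE:
  assumes "y \<in> S"
  obtains i D M M' k k' where "i \<in> I" "opn D" "y \<in> D" "D \<subseteq> W i" "or_iso M M' k k'"
    "\<And>z. z \<in> D \<Longrightarrow> \<phi> i z \<in> M" "\<And>z. z \<in> D \<Longrightarrow> chart' i z = k (\<phi> i z)"
proof -
  from good[OF assms] obtain i where "i \<in> I" and "\<exists>D M M' k k'. opn D \<and> y \<in> D \<and> D \<subseteq> W i \<and>
      or_iso M M' k k' \<and> (\<forall>z\<in>D. \<phi> i z \<in> M \<and> pert \<rho>' (sec i z) = k (\<phi> i z))"
    unfolding good_def by (rule bexE)
  then obtain D M M' k k' where "opn D" "y \<in> D" "D \<subseteq> W i" "or_iso M M' k k'"
    "\<forall>z\<in>D. \<phi> i z \<in> M \<and> pert \<rho>' (sec i z) = k (\<phi> i z)" by (elim exE conjE)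
  then show ?thesis using that[OF \<open>i \<in> I\<close>, of D M M' k k'] by (simp add: chart'_def)
qed

lemma chart'_trans:
  assumes "i \<in> I" "j \<in> I" "disc D" "D \<subseteq> W i" "D \<subseteq> W j" "y \<in> D" "z \<in> D"
  shows "chart' i z = PSL2_act (\<rho>' (trans_elt i j y)) (chart' j z)"
proof -
  have z: "z \<in> W i" "z \<in> W j" using assms by auto
  note t = trans_elt[OF assms(1,2) z]
  show ?thesis
    using pert_equivariant[OF hom' t(1) sec(1)[OF assms(2) z(2)]] t(2) trans_elt_const[OF assms]
    by (simp add: chart'_def)
qed

lemma chart'_values:
  assumes "j \<in> I" "y \<in> W j"
  shows "chart' j y \<in> topspace CP1"
proof -
  have yS: "y \<in> S" using assms dataD(14) by blast
  obtain i D M M' k k' where D: "i \<in> I" "opn D" "y \<in> D" "D \<subseteq> W i" "or_iso M M' k k'"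
    "\<And>z. z \<in> D \<Longrightarrow> \<phi> i z \<in> M" "\<And>z. z \<in> D \<Longrightarrow> chart' i z = k (\<phi> i z)"
    by (rule goodE[OF yS]) (rule that)
  have yi: "y \<in> W i" using D(3,4) by blast
  have "chart' i y \<in> topspace CP1"
    unfolding D(7)[OF D(3)] using or_isoD(5)[OF D(5) D(6)[OF D(3)]] openin_subset[OF or_isoD(2)[OF D(5)]] by blast
  moreover have "opn (W j \<inter> W i)" by (intro openin_Int disc_opn dataD(4) assms D(1))
  then obtain V where V: "disc V" "y \<in> V" "V \<subseteq> W j \<inter> W i"
    by (rule disc_nbhd) (use assms yi in auto)
  have "\<rho>' (trans_elt j i y) \<in> carrier PSL2"
    by (rule Hom_values[OF hom' trans_elt(1)[OF assms(1) D(1) assms(2) yi]])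
  ultimately show ?thesis
    using chart'_trans[OF assms(1) D(1) V(1) _ _ V(2,2)] V(3) by simp
qed

lemma chart'_germ_rel:
  assumes "i \<in> I" "j \<in> I" "y \<in> W i" "y \<in> W j"
  shows "germ_rel y (chart' i) (chart' j)"
proof -
  have "opn (W i \<inter> W j)" by (intro openin_Int disc_opn dataD(4) assms)
  then obtain V where V: "disc V" "y \<in> V" "V \<subseteq> W i \<inter> W j"
    by (rule disc_nbhd) (use assms in auto)
  show ?thesis
  proof (rule germ_relI[OF disc_opn[OF V(1)] V(2)])
    show "\<rho>' (trans_elt i j y) \<in> carrier PSL2" by (rule Hom_values[OF hom' trans_elt(1)[OF assms]])
    show "chart' j z \<in> topspace CP1" if "z \<in> V" for z using chart'_values[OF assms(2)] V(3) that by blast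
    show "chart' i z = PSL2_act (\<rho>' (trans_elt i j y)) (chart' j z)" if "z \<in> V" for z
      using chart'_trans[OF assms(1,2) V(1) _ _ V(2) that] V(3) by simp
  qed
qed

definition A' :: "'a bp_chart set" where
  "A' = charts_of (\<lambda>y F. \<exists>i\<in>I. y \<in> W i \<and> germ_rel y F (chart' i))"

text \<open>Both \<open>k\<close> and its inverse preserve the orientation, so that orders transfer in both directions.\<close>

lemma power_form_transfer:
  assumes D: "i \<in> I" "opn D" "D \<subseteq> W i" "or_iso M M' k k'"
    "\<And>z. z \<in> D \<Longrightarrow> \<phi> i z \<in> M" "\<And>z. z \<in> D \<Longrightarrow> chart' i z = k (\<phi> i z)" and p: "p \<in> D"
  shows "power_form_at S \<O> (W i, restrict (\<phi> i) (W i)) p m \<longleftrightarrow> power_form_at S \<O> (D, restrict (chart' i) D) p m"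
proof
  have pW: "p \<in> W i" using D(3) p by blast
  show "power_form_at S \<O> (D, restrict (chart' i) D) p m"
    if "power_form_at S \<O> (W i, restrict (\<phi> i) (W i)) p m"
    by (rule power_form_at_or_iso[OF that D(4) _ D(2) p]) (use D pW p in auto)
  show "power_form_at S \<O> (W i, restrict (\<phi> i) (W i)) p m"
    if "power_form_at S \<O> (D, restrict (chart' i) D) p m"
    by (rule power_form_at_or_iso[OF that or_iso_sym[OF D(4)] _ D(2) p D(3)])
      (use D pW p or_isoD(5,7)[OF D(4)] in auto)
qed

lemma restricted_chart: "i \<in> I \<Longrightarrow> (W i, restrict (\<phi> i) (W i)) \<in> A"
  by (rule flat_in_atlas[OF dataD(6)])

lemma germ_rel_restrict:
  assumes "opn D" "y \<in> D" "D \<subseteq> W i" "i \<in> I"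
  shows "germ_rel y (restrict (chart' i) D) (chart' i)"
  by (rule germ_relI[OF assms(1,2) PSL2.one_closed]) (use assms chart'_values[OF assms(4)] in auto)

lemma chart'_in_A':
  assumes D: "i \<in> I" "opn D" "D \<subseteq> W i" "or_iso M M' k k'"
    "\<And>z. z \<in> D \<Longrightarrow> \<phi> i z \<in> M" "\<And>z. z \<in> D \<Longrightarrow> chart' i z = k (\<phi> i z)"
  shows "(D, restrict (chart' i) D) \<in> A'"
proof -
  have "\<exists>m\<ge>1. power_form_at S \<O> (D, restrict (chart' i) D) p m" if p: "p \<in> D" for p
  proof -
    have "p \<in> W i" using D(3) p by blast
    then obtain m where "m \<ge> 1" "power_form_at S \<O> (W i, restrict (\<phi> i) (W i)) p m"
      using bp_chartD(3)[OF atlas_chart[OF restricted_chart[OF D(1)]]] by blast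
    then show ?thesis using power_form_transfer[OF D p] by (intro exI[of _ m]) simp
  qed
  then have "bp_chart S \<O> (D, restrict (chart' i) D)" using D(2) by (simp add: bp_chart_def)
  moreover have "\<exists>i\<in>I. y \<in> W i \<and> germ_rel y (restrict (chart' i') D) (chart' i)" if "y \<in> D" "i' = i" for y i'
    unfolding that(2) using germ_rel_restrict[OF D(2) that(1) D(3,1)] D(1,3) that(1)
    by (intro bexI[of _ i] conjI) auto
  ultimately show ?thesis unfolding A'_def charts_of_def by simp
qed

lemma maximal': "maximal_bp_atlas S \<O> A'"
  unfolding A'_def
proof (rule maximal_charts_of)
  fix y assume y: "y \<in> S"
  obtain i D M M' k k' where D: "i \<in> I" "opn D" "y \<in> D" "D \<subseteq> W i" "or_iso M M' k k'"
    "\<And>z. z \<in> D \<Longrightarrow> \<phi> i z \<in> M" "\<And>z. z \<in> D \<Longrightarrow> chart' i z = k (\<phi> i z)"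
    by (rule goodE[OF y]) (rule that)
  have "(D, restrict (chart' i) D) \<in> A'" by (rule chart'_in_A'[OF D(1,2,4-7)])
  then show "\<exists>U \<phi>. bp_chart S \<O> (U, \<phi>) \<and> y \<in> U \<and> (\<forall>z\<in>U. \<exists>i\<in>I. z \<in> W i \<and> germ_rel z \<phi> (chart' i))"
    using D(3) unfolding A'_def charts_of_def
    by (intro exI[of _ D] exI[of _ "restrict (chart' i) D"]) simp
next
  fix y F F'
  assume "\<exists>i\<in>I. y \<in> W i \<and> germ_rel y F (chart' i)" "\<exists>i\<in>I. y \<in> W i \<and> germ_rel y F' (chart' i)"
  then obtain i j where i: "i \<in> I" "y \<in> W i" "germ_rel y F (chart' i)" and j: "j \<in> I" "y \<in> W j" "germ_rel y F' (chart' j)"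
    by (elim bexE conjE)
  show "germ_rel y F F'"
    by (rule germ_rel_trans[OF i(3) germ_rel_trans[OF chart'_germ_rel[OF i(1) j(1) i(2) j(2)] germ_rel_sym[OF j(3)]]])
next
  fix y F F'
  assume "\<exists>i\<in>I. y \<in> W i \<and> germ_rel y F' (chart' i)" "germ_rel y F F'"
  then obtain i where "i \<in> I" "y \<in> W i" "germ_rel y F (chart' i)" by (elim bexE conjE) (rule that, auto intro: germ_rel_trans)
  then show "\<exists>i\<in>I. y \<in> W i \<and> germ_rel y F (chart' i)" by (intro bexI conjI)
qed

lemma has_order_iff:
  assumes p: "p \<in> S"
  shows "has_order S \<O> A' p n \<longleftrightarrow> has_order S \<O> A p n"
proof -
  obtain i D M M' k k' where D: "i \<in> I" "opn D" "p \<in> D" "D \<subseteq> W i" "or_iso M M' k k'"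
    "\<And>z. z \<in> D \<Longrightarrow> \<phi> i z \<in> M" "\<And>z. z \<in> D \<Longrightarrow> chart' i z = k (\<phi> i z)"
    by (rule goodE[OF p]) (rule that)
  interpret B: branched S \<O> A' by unfold_locales (rule maximal')
  have pW: "p \<in> W i" using D by blast
  note c = restricted_chart[OF D(1)] and c' = chart'_in_A'[OF D(1,2,4-7)]
  note tr = power_form_transfer[OF D(1,2,4-7,3)]
  have 1: "has_order S \<O> A p n \<longleftrightarrow> power_form_at S \<O> (W i, restrict (\<phi> i) (W i)) p (n + 1)"
  proof
    assume "has_order S \<O> A p n"
    then obtain U \<psi> where U: "(U, \<psi>) \<in> A" "p \<in> U" "power_form_at S \<O> (U, \<psi>) p (n + 1)"
      by (auto simp: has_order_def)
    show "power_form_at S \<O> (W i, restrict (\<phi> i) (W i)) p (n + 1)"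
      by (rule power_form_at_germ_rel[OF U(3) atlas_germ_rel[OF c U(1) pW U(2)] disc_opn[OF dataD(4)[OF D(1)]] pW])
  next
    show "has_order S \<O> A p n" if "power_form_at S \<O> (W i, restrict (\<phi> i) (W i)) p (n + 1)"
      unfolding has_order_def by (rule bexI[OF _ c]) (use that pW in simp)
  qed
  have 2: "has_order S \<O> A' p n \<longleftrightarrow> power_form_at S \<O> (D, restrict (chart' i) D) p (n + 1)"
  proof
    assume "has_order S \<O> A' p n"
    then obtain U \<psi> where U: "(U, \<psi>) \<in> A'" "p \<in> U" "power_form_at S \<O> (U, \<psi>) p (n + 1)"
      by (auto simp: has_order_def)
    show "power_form_at S \<O> (D, restrict (chart' i) D) p (n + 1)"
      by (rule power_form_at_germ_rel[OF U(3) B.atlas_germ_rel[OF c' U(1) D(3) U(2)] D(2,3)])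
  next
    show "has_order S \<O> A' p n" if "power_form_at S \<O> (D, restrict (chart' i) D) p (n + 1)"
      unfolding has_order_def by (rule bexI[OF _ c']) (use that D(3) in simp)
  qed
  show ?thesis by (rule trans[OF 2 trans[OF tr[symmetric] 1[symmetric]]])
qed

lemma developing': "developing_map S x A' (pert \<rho>')"
proof -
  interpret B: branched S \<O> A' by unfold_locales (rule maximal')
  show ?thesis
    unfolding B.developing_map_iff
  proof (intro allI impI)
    fix p assume p: "pth S p \<and> pathstart p = x"
    then have pS: "pathfinish p \<in> S" using pth_ends(2) by blast
    obtain i D M M' k k' where D: "i \<in> I" "opn D" "pathfinish p \<in> D" "D \<subseteq> W i" "or_iso M M' k k'"
      "\<And>z. z \<in> D \<Longrightarrow> \<phi> i z \<in> M" "\<And>z. z \<in> D \<Longrightarrow> chart' i z = k (\<phi> i z)"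
      by (rule goodE[OF pS]) (rule that)
    have pW: "pathfinish p \<in> W i" using D by blast
    have u: "path_class S p \<in> ucover S x" using p by (intro ucoverI) auto
    define g where "g = deck_diff S x (path_class S p) (sec i (pathfinish p))"
    have g: "g \<in> carrier G" "class_join S g (sec i (pathfinish p)) = path_class S p"
      unfolding g_def using deck_diff[OF u sec(1)[OF D(1) pW]] sec(2)[OF D(1) pW] p by simp_all
    define F where "F z = PSL2_act (\<rho>' g) (restrict (chart' i) D z)" for z
    have "B.flat D F"
      unfolding F_def
      by (rule B.flat_act[OF B.flat_chart[OF chart'_in_A'[OF D(1,2,4-7)]] Hom_values[OF hom' g(1)]])
    moreover have "pert \<rho>' Q = F (cover_proj Q)" if "Q \<in> sheet S p D" for Q
    proof -
      obtain c where c: "pth D c" "pathstart c = pathfinish p" "Q = path_class S (p +++ c)"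
        using \<open>Q \<in> sheet S p D\<close> unfolding sheet_def by (elim imageE CollectE conjE)
      have cS: "pth S c" by (rule pth_mono[OF c(1) opn_subset[OF D(2)]])
      have z: "pathfinish c \<in> D" by (rule pth_ends(2)[OF c(1)])
      then have zW: "pathfinish c \<in> W i" using D(4) by blast
      have "Q = class_join S g (sec i (pathfinish c))"
        unfolding c(3) by (rule sheet_translate[OF D(1) _ _ pW g pth_mono[OF c(1) D(4)] c(2)]) (use p in auto)
      moreover have "cover_proj Q = pathfinish c" unfolding c(3) using p c(2) cS by simp
      ultimately show ?thesis
        using pert_equivariant[OF hom' g(1) sec(1)[OF D(1) zW]] z by (simp add: F_def chart'_def)
    qed
    ultimately show "\<exists>N F. B.flat N F \<and> pathfinish p \<in> N \<and> (\<forall>Q\<in>sheet S p N. pert \<rho>' Q = F (cover_proj Q))"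
      using D(3) by (intro exI[of _ D] exI[of _ F]) simp
  qed
qed

lemma conj_class_in_image:
  assumes ps: "distinct ps" "set ps = branch_points S \<O> A" "list_all2 (has_order S \<O> A) ps ns"
  shows "conj_class G \<rho>' \<in> Hol S x ` bp_structures S \<O> ns"
proof -
  interpret B: branched S \<O> A' by unfold_locales (rule maximal')
  have "equivariant S x (pert \<rho>') \<rho>'"
    using pert_equivariant[OF hom'] by (simp add: equivariant_def topspace_universal_cover)
  then have "Hol S x (bp_structure_of S A') = conj_class G \<rho>'"
    by (rule B.Hol_eq[OF x developing' hom'])
  have bp: "branch_points S \<O> A' = branch_points S \<O> A"
    using has_order_iff by (auto simp: branch_points_def)
  have "list_all2 (has_order S \<O> A') ps ns"
  proof (rule list_all2_mono[OF ps(3)])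
    fix p n assume o: "has_order S \<O> A p n"
    then obtain U \<psi> where "(U, \<psi>) \<in> A" "p \<in> U" by (auto simp: has_order_def)
    then have "p \<in> S" using opn_subset[OF bp_chartD(1)[OF atlas_chart]] by blast
    then show "has_order S \<O> A' p n" using o has_order_iff by simp
  qed
  then have "bp_structure_of S A' \<in> bp_structures S \<O> ns"
    unfolding bp_structures_def using maximal' ps(1,2) bp by auto
  with \<open>Hol S x (bp_structure_of S A') = conj_class G \<rho>'\<close> show ?thesis by (metis imageI)
qed

end

text \<open>Compactness of the surface yields finitely many discs, so that every developed structure admits
  a perturbation.\<close>

lemma (in developed) nearby_holonomy:
  assumes ps: "distinct ps" "set ps = branch_points S \<O> A" "list_all2 (has_order S \<O> A) ps ns"
  shows "\<forall>\<^sub>F \<rho>' in near. conj_class G \<rho>' \<in> Hol S x ` bp_structures S \<O> ns"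
proof -
  have "\<forall>q\<in>S. \<exists>t. case t of (p, W, \<phi>, a, \<delta>, K) \<Rightarrow> chart_data q p W \<phi> a \<delta> K"
    using chart_data_exists by auto
  from bchoice[OF this] obtain t where t: "\<forall>q\<in>S. case t q of (p, W, \<phi>, a, \<delta>, K) \<Rightarrow> chart_data q p W \<phi> a \<delta> K"
    by (elim exE)
  define pp where "pp q = fst (t q)" for q
  define W where "W q = fst (snd (t q))" for q
  define \<phi> where "\<phi> q = fst (snd (snd (t q)))" for q
  define a where "a q = fst (snd (snd (snd (t q))))" for q
  define \<delta> where "\<delta> q = fst (snd (snd (snd (snd (t q)))))" for q
  define K where "K q = snd (snd (snd (snd (snd (t q)))))" for q
  have data: "chart_data q (pp q) (W q) (\<phi> q) (a q) (\<delta> q) (K q)" if "q \<in> S" for q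
    using t that by (auto simp: pp_def W_def \<phi>_def a_def \<delta>_def K_def split: prod.splits)
  define N where "N q = {y \<in> W q. norm (affcoord (a q) (\<phi> q y) - affcoord (a q) (\<phi> q q)) < \<delta> q}" for q
  have N: "opn (N q)" "q \<in> N q" if "q \<in> S" for q
  proof -
    have d: "disc (W q)" "continuous_map (subtopology (top_of_set S) (W q)) CP1 (\<phi> q)" "q \<in> W q" "\<delta> q > 0"
      "\<phi> q ` W q \<subseteq> affdom (a q)"
      using data[OF that] by (auto simp: chart_data_def)
    have "opn {y \<in> W q. affcoord (a q) (\<phi> q y) \<in> ball (affcoord (a q) (\<phi> q q)) (\<delta> q)}"
      by (rule opn_affcoord_ball[OF disc_opn[OF d(1)] d(2)]) (use d(5) in blast)
    then show "opn (N q)" by (simp add: N_def dist_norm norm_minus_commute)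
    show "q \<in> N q" using d(3,4) by (simp add: N_def)
  qed
  obtain I where I: "finite I" "I \<subseteq> S" "S \<subseteq> \<Union>(N ` I)" by (rule finite_opn_cover[OF N])
  interpret perturbation S \<O> A x f \<rho> I pp W \<phi> a \<delta> K
  proof unfold_locales
    show "finite I" by (rule I(1))
    show "chart_data i (pp i) (W i) (\<phi> i) (a i) (\<delta> i) (K i)" if "i \<in> I" for i
      by (rule data) (use that I(2) in blast)
    show "\<exists>i\<in>I. y \<in> W i \<and> norm (affcoord (a i) (\<phi> i y) - affcoord (a i) (\<phi> i i)) < \<delta> i" if "y \<in> S" for y
    proof -
      have "y \<in> \<Union>(N ` I)" using I(3) that by blast
      then obtain i where "i \<in> I" "y \<in> N i" by blast
      then show ?thesis by (intro bexI[of _ i]) (simp_all add: N_def)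
    qed
  qed
  show ?thesis
    using eventually_good eventually_Hom
  proof eventually_elim
    case (elim \<rho>')
    interpret nearby S \<O> A x f \<rho> I pp W \<phi> a \<delta> K \<rho>'
      by unfold_locales (use elim in simp_all)
    show ?case by (rule conj_class_in_image[OF ps])
  qed
qed

section \<open>Openness of the set of holonomies\<close>

theorem proposition1p6:
  fixes S :: "'a::topological_space set"
    and \<O> :: "('a set \<times> ('a \<Rightarrow> complex)) set"
    and x :: 'a
    and ns :: "nat list"
  assumes "closed_oriented_surface S \<O>"
    and "x \<in> S"
    and "\<forall>n\<in>set ns. n \<ge> 1"
  shows "openin (Hom_mod_conj (fundamental_group S x)) (Hol S x ` bp_structures S \<O> ns)"
proof -
  let ?G = "fundamental_group S x" and ?H = "Hol S x ` bp_structures S \<O> ns"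
  have developed_structure: "\<exists>f \<rho>. developed S \<O> A x f \<rho> \<and> Hol S x \<sigma> = conj_class ?G \<rho>"
    if "\<sigma> = bp_structure_of S A" "maximal_bp_atlas S \<O> A" for \<sigma> A
  proof -
    interpret branched S \<O> A by unfold_locales (rule assms(1), rule that(2))
    obtain f where f: "developing_map S x A f" by (rule developing_map_exists[OF assms(2)])
    obtain \<rho> where \<rho>: "\<rho> \<in> topspace (Hom_topology ?G)" "equivariant S x f \<rho>"
      by (rule holonomy_exists[OF f assms(2)])
    have "developed S \<O> A x f \<rho>" by unfold_locales (rule assms(2) f \<rho>)+
    then show ?thesis using Hol_eq[OF assms(2) f \<rho>] that(1) by blast
  qed
  have "?H \<subseteq> conj_class ?G ` topspace (Hom_topology ?G)"
  proof
    fix C assume "C \<in> ?H"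
    then obtain \<sigma> A where \<sigma>: "C = Hol S x \<sigma>" "\<sigma> = bp_structure_of S A" "maximal_bp_atlas S \<O> A"
      by (auto simp: bp_structures_def)
    obtain f \<rho> where "developed S \<O> A x f \<rho>" "Hol S x \<sigma> = conj_class ?G \<rho>"
      using developed_structure[OF \<sigma>(2,3)] by (elim exE conjE)
    then show "C \<in> conj_class ?G ` topspace (Hom_topology ?G)" using developed.hom \<sigma>(1) by blast
  qed
  moreover have "openin (Hom_topology ?G) {\<rho> \<in> topspace (Hom_topology ?G). conj_class ?G \<rho> \<in> ?H}"
  proof (subst openin_subopen, rule ballI)
    fix \<rho>1 assume "\<rho>1 \<in> {\<rho> \<in> topspace (Hom_topology ?G). conj_class ?G \<rho> \<in> ?H}"
    then have \<rho>1: "\<rho>1 \<in> topspace (Hom_topology ?G)" "conj_class ?G \<rho>1 \<in> ?H" by simp_all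
    obtain \<sigma> A ps where \<sigma>: "conj_class ?G \<rho>1 = Hol S x \<sigma>" "\<sigma> = bp_structure_of S A" "maximal_bp_atlas S \<O> A"
      and ps: "distinct ps" "set ps = branch_points S \<O> A" "list_all2 (has_order S \<O> A) ps ns"
      using \<rho>1(2) by (auto simp: bp_structures_def)
    obtain f \<rho> where d: "developed S \<O> A x f \<rho>" "Hol S x \<sigma> = conj_class ?G \<rho>"
      using developed_structure[OF \<sigma>(2,3)] by (elim exE conjE)
    interpret developed S \<O> A x f \<rho> by (rule d(1))
    \<comment> \<open>\<open>\<rho>1\<close> is the holonomy of the developing map \<open>f\<close> followed by \<open>M\<close>\<close>
    obtain M where M: "M \<in> carrier PSL2" "\<rho>1 = conj_rep ?G M \<rho>"
      by (rule conj_class_eqD[OF \<rho>1(1) trans[OF \<sigma>(1) d(2)]])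
    have "equivariant S x (\<lambda>P. PSL2_act M (f P)) \<rho>1"
      unfolding M(2) by (rule equivariant_act[OF dev hom equiv M(1)])
    then interpret B: developed S \<O> A x "\<lambda>P. PSL2_act M (f P)" \<rho>1
      by (unfold_locales, intro assms(2), intro developing_act[OF dev M(1)], intro \<rho>1(1))
    from B.nearby_holonomy[OF ps]
    obtain T where T: "openin (Hom_topology ?G) T" "\<rho>1 \<in> T" "\<forall>\<rho>'\<in>T. conj_class ?G \<rho>' \<in> ?H"
      unfolding eventually_nhdsin using \<rho>1(1) by blast
    then show "\<exists>T. openin (Hom_topology ?G) T \<and> \<rho>1 \<in> T \<and> T \<subseteq> {\<rho> \<in> topspace (Hom_topology ?G). conj_class ?G \<rho> \<in> ?H}"
      using openin_subset[OF T(1)] by (intro exI[of _ T]) auto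
  qed
  ultimately show ?thesis by (simp add: Hom_mod_conj_def openin_quotient_topology)
qed

end
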